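(* Let $n\ge 2$, $1<p<\infty$, let $\mu$ be a weight with $\mu^p\in\mathcal{A}_p(\mathbb{R}^n)$, let $Q_r\subset\mathbb{R}^n$ be a cube, let $Q_{r/2}$, $Q_{2r}$ be the concentric cubes, and let $K$ be a closed subset of $\overline{Q}_r$. (a) There exists $p_0=p_0(n,p,[\mu^p]_{\mathcal{A}_p})\in(1,p)$ such that for each $q\in[p_0,p]$ the inequality $$\left(\frac{1}{|Q_r|}\int_{Q_r}\left|\frac{u}{r}\right|^p\mu^p\,dx\right)^{\frac1p}\le C\left(\frac{1}{|Q_r|}\int_{Q_r}|\nabla u|^q\mu^q\,dx\right)^{\frac1q}$$ holds for all $u\in C^\infty(\overline{Q}_r)$ with $\operatorname{dist}(\operatorname{supp}u,K)>0$, with a constant $C$ satisfying $$C\le\frac{c_4}{r}\left(\frac{\mu^q(Q_{2r})}{\mathrm{Cap}_{q,\mu^q}(K,Q_{2r})}\right)^{\frac1q}$$ for some $c_4=c_4(n,p,[\mu^p]_{\mathcal{A}_p})$. (b) Let $q\in[p_0,p]$ and assume that, for some constant $C$, $$\left(\frac{1}{|Q_{r/2}|}\int_{Q_{r/2}}\left|\frac{u}{r}\right|^p\mu^p\,dx\right)^{\frac1p}\le C\left(\frac{1}{|Q_r|}\int_{Q_r}|\nabla u|^q\mu^q\,dx\right)^{\frac1q}$$ holds for every $u\in C^\infty(\overline{Q}_r)$ with $\operatorname{dist}(\operatorname{supp}u,K)>0$. Then there exists a small $\gamma=\gamma(n,p,[\mu^p]_{\mathcal{A}_p})\in(0,\frac12)$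 such that if $K\in\mathcal{N}_{\mu^q;\gamma,q}(Q_r)$, then $$C\ge\frac{c_5}{r}\left(\frac{\mu^q(Q_{2r})}{\mathrm{Cap}_{q,\mu^q}(K,Q_{2r})}\right)^{\frac1q}$$ with a constant $c_5=c_5(n,p,[\mu^p]_{\mathcal{A}_p})>0$.
   Context: Cubes: $Q_r(x_0)=\{x\in\mathbb{R}^n:|x_i-x_{0,i}|<r\text{ for each }i\}$; the center is omitted when unimportant, and cubes with different radii in the same statement are concentric. A weight is a locally integrable function on $\mathbb{R}^n$ that is positive a.e.; for a weight $\rho$, $\rho(E)=\int_E\rho\,dx$, so $\mu^q(Q_{2r})=\int_{Q_{2r}}\mu^q\,dx$. For $1<p<\infty$, $\rho\in\mathcal{A}_p(\mathbb{R}^n)$ means $$[\rho]_{\mathcal{A}_p}=\sup_{Q}\left(\frac1{|Q|}\int_{Q}\rho\,dx\right)\left(\frac1{|Q|}\int_{Q}\rho^{-\frac1{p-1}}\,dx\right)^{p-1}<\infty,$$ the supremum over all cubes $Q\subset\mathbb{R}^n$. Weighted capacity: for an open set $U\subset\mathbb{R}^n$ and $K_0\subset U$ closed, $$\mathrm{Cap}_{q,\rho}(K_0,U)=\inf\left\{\int_U|\nabla\phi|^q\rho\,dx:\phi\in C_0^\infty(U),\ \phi\ge1\text{ on }K_0\right\}.$$ For $\gamma\in(0,\frac12)$ and $q>1$, $\mathcal{N}_{\rho;\gamma,q}(Q_r)$ is the collection of closed subsets $K$ of $\overline{Q}_r$ satisfying $$\frac{\mathrm{Cap}_{q,\rho}(K,Q_{2r})}{\rho(Q_{2r})}\le\gamma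 r^{-q}.$$ Convention: if the capacity in a denominator is $0$, the quotient is read as $+\infty$. The notation $c=c(a,b,\dots)$ means that the constant depends only on the listed quantities. *)

theory Defs
  imports "HOL-Analysis.Analysis"
begin

definition cube :: "real^'n \<Rightarrow> real \<Rightarrow> (real^'n) set" where
  "cube x0 r = {x. \<forall>i. \<bar>x $ i - x0 $ i\<bar> < r}"

text \<open>Real powers on \<^typ>\<open>ennreal\<close>; only used with a positive exponent, so that
  infinity is mapped to infinity.\<close>

definition epowr :: "ennreal \<Rightarrow> real \<Rightarrow> ennreal" where
  "epowr x a = (if x = top then top else ennreal (enn2real x powr a))"

text \<open>Integrals of nonnegative functions are taken in \<^typ>\<open>ennreal\<close>, so that no
  integrability has to be presupposed. Integrands involving a weight may be negative
  on a null set, where \<^const>\<open>ennreal\<close> truncates them to 0.\<close>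

definition eavg :: "(real^'n) set \<Rightarrow> (real^'n \<Rightarrow> real) \<Rightarrow> ennreal" where
  "eavg S f = (\<integral>\<^sup>+x\<in>S. ennreal (f x) \<partial>lebesgue) / emeasure lebesgue S"

definition wmass :: "(real^'n \<Rightarrow> real) \<Rightarrow> (real^'n) set \<Rightarrow> ennreal" where
  "wmass \<rho> E = (\<integral>\<^sup>+x\<in>E. ennreal (\<rho> x) \<partial>lebesgue)"

definition weight :: "(real^'n \<Rightarrow> real) \<Rightarrow> bool" where
  "weight \<rho> \<longleftrightarrow> (\<forall>S. compact S \<longrightarrow> \<rho> absolutely_integrable_on S) \<and> (AE x in lebesgue. 0 < \<rho> x)"

definition Ap_const :: "real \<Rightarrow> (real^'n \<Rightarrow> real) \<Rightarrow> ennreal" where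
  "Ap_const p \<rho> = (SUP (x0, r)\<in>UNIV \<times> {0<..}.
     eavg (cube x0 r) \<rho> * epowr (eavg (cube x0 r) (\<lambda>x. \<rho> x powr (- 1 / (p - 1)))) (p - 1))"

definition Ap :: "real \<Rightarrow> (real^'n \<Rightarrow> real) set" where
  "Ap p = {\<rho>. weight \<rho> \<and> Ap_const p \<rho> < top}"

definition partial_deriv :: "(real^'n \<Rightarrow> real) \<Rightarrow> 'n \<Rightarrow> real^'n \<Rightarrow> real" where
  "partial_deriv f i x = frechet_derivative f (at x) (axis i 1)"

definition grad :: "(real^'n \<Rightarrow> real) \<Rightarrow> real^'n \<Rightarrow> real^'n" where
  "grad f x = (\<chi> i. partial_deriv f i x)"

fun C_k :: "nat \<Rightarrow> (real^'n \<Rightarrow> real) \<Rightarrow> bool" where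
  "C_k 0 f \<longleftrightarrow> continuous_on UNIV f"
| "C_k (Suc k) f \<longleftrightarrow> (\<forall>x. f differentiable (at x)) \<and> (\<forall>i. C_k k (partial_deriv f i))"

definition smooth :: "(real^'n \<Rightarrow> real) \<Rightarrow> bool" where
  "smooth f \<longleftrightarrow> (\<forall>k. C_k k f)"

definition Cinf_c :: "(real^'n) set \<Rightarrow> (real^'n \<Rightarrow> real) set" where
  "Cinf_c U = {\<phi>. smooth \<phi> \<and> compact (closure {x. \<phi> x \<noteq> 0}) \<and> closure {x. \<phi> x \<noteq> 0} \<subseteq> U}"

text \<open>For a closed set \<open>S\<close>: functions that coincide on \<open>S\<close> with a smooth function on the
  whole space. The values outside \<open>S\<close> are irrelevant, hence the support is taken
  relative to \<open>S\<close>.\<close>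

definition Cinf_closed :: "(real^'n) set \<Rightarrow> (real^'n \<Rightarrow> real) set" where
  "Cinf_closed S = {u. \<exists>v. smooth v \<and> (\<forall>x\<in>S. u x = v x)}"

definition supp_in :: "(real^'n) set \<Rightarrow> (real^'n \<Rightarrow> real) \<Rightarrow> (real^'n) set" where
  "supp_in S u = closure {x\<in>S. u x \<noteq> 0}"

text \<open>In contrast to \<^const>\<open>setdist\<close>, the distance to the empty set is infinite, as it must be
  for the zero function and for empty \<open>K\<close>.\<close>

definition esetdist :: "(real^'n) set \<Rightarrow> (real^'n) set \<Rightarrow> ennreal" where
  "esetdist S T = (INF x\<in>S. INF y\<in>T. ennreal (dist x y))"

text \<open>The functions \<open>u\<close> that are smooth on \<open>S\<close> with support at positive distance from \<open>K\<close>.\<close>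

definition test_funs :: "(real^'n) set \<Rightarrow> (real^'n) set \<Rightarrow> (real^'n \<Rightarrow> real) set" where
  "test_funs S K = {u \<in> Cinf_closed S. 0 < esetdist (supp_in S u) K}"

definition Cap :: "real \<Rightarrow> (real^'n \<Rightarrow> real) \<Rightarrow> (real^'n) set \<Rightarrow> (real^'n) set \<Rightarrow> ennreal" where
  "Cap q \<rho> K U = (INF \<phi>\<in>{\<phi>\<in>Cinf_c U. \<forall>x\<in>K. 1 \<le> \<phi> x}.
     \<integral>\<^sup>+x\<in>U. ennreal (norm (grad \<phi> x) powr q * \<rho> x) \<partial>lebesgue)"

text \<open>A quotient with a capacity in the denominator is infinite if the capacity is 0
  (the division of \<^typ>\<open>ennreal\<close> would give \<open>0 / 0 = 0\<close>).\<close>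

definition cap_quot :: "ennreal \<Rightarrow> ennreal \<Rightarrow> ennreal" where
  "cap_quot m c = (if c = 0 then top else m / c)"

definition negligible_sets :: "(real^'n \<Rightarrow> real) \<Rightarrow> real \<Rightarrow> real \<Rightarrow> real^'n \<Rightarrow> real \<Rightarrow> (real^'n) set set" where
  "negligible_sets \<rho> \<gamma> q x0 r = {K. closed K \<and> K \<subseteq> closure (cube x0 r) \<and>
     Cap q \<rho> K (cube x0 (2*r)) / wmass \<rho> (cube x0 (2*r)) \<le> ennreal (\<gamma> * r powr (- q))}"

end

theory Submission
  imports Defs
begin

text \<open>The self-improvement of the \<open>A\<^sub>p\<close> condition, by the reverse Hoelder inequality for the dual weight
  \<open>\<mu> powr - (p / (p - 1))\<close>, yields \<open>p0 < p\<close> such that \<open>\<mu>\<close> satisfies an \<open>A\<^bsub>q,p\<^esub>\<close> condition for all \<open>q \<in> {p0..p}\<close>.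
  Hoelder's inequality on cubes that move with the point then gives weighted bounds for averages of gradients, and
  integration along segments turns these into a \<open>(p, q)\<close>-Poincare inequality.

  In the upper estimate, if \<open>u\<close> vanishes near \<open>K\<close> and has mean \<open>a \<noteq> 0\<close>, then a cut-off Lipschitz extension of \<open>1 - u / a\<close> is
  admissible for the capacity after mollification. So the capacity times \<open>\<bar>a\<bar>\<^sup>q\<close> is bounded by the energy of \<open>u\<close>, and the Poincare
  inequality controls the rest of \<open>u\<close>.

  In the lower estimate, the test function is \<open>u = 1 - f\<close> with \<open>f\<close> almost extremal for the capacity. If the capacity
  is small, the Friedrichs inequality makes \<open>f\<close> small on average, so \<open>u\<close> has a fixed share of the mass of
  the half-size cube, while its energy is at most a multiple of the capacity.\<close>

section \<open>Powers of extended nonnegative reals\<close>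

text \<open>No maximal function and no covering argument enters. After Fubini a point y is counted
  by those x whose cube contains y; they lie in one cube of comparable size, so the normalised
  weights integrate to at most 1. The price at parameter t of a segment is a factor t to the power
  -n (p/q - 1), integrable at 0 only for q near p. Hence two conditions on p0: the conjugate
  exponent of p0 must not exceed the one gained from the reverse Hoelder inequality, and n (p/p0 -
  1) must be at most 1/2. The capacity lives in the double cube, but u is controlled only in the
  original one. A reflection would not respect the weight, so the extension averages u over inner
  cubes, of a size comparable with the distance from the boundary; the weight condition alone then
  carries the energy across. The constants must not depend on q or on the individual weight. So B is
  raised to at least 1, and exponents q in the constants are replaced by p. In (b) the constant C is
  a finite number, which rules out capacity 0: otherwise the energy of the test functions could tend
  to 0 while their mass in the half-size cube stays bounded below.\<close>

lemma epowr_ennreal: "0 \<le> x \<Longrightarrow> epowr (ennreal x) a = ennreal (x powr a)"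
  by (simp add: epowr_def)

lemma epowr_0 [simp]: "epowr 0 a = 0"
  by (simp add: epowr_def)

lemma epowr_top [simp]: "epowr top a = top"
  by (simp add: epowr_def)

lemma epowr_1 [simp]: "epowr 1 a = 1"
  by (simp add: epowr_def)

lemma epowr_eq_0_iff [simp]: "epowr x a = 0 \<longleftrightarrow> x = 0"
  by (cases x) (auto simp: epowr_ennreal ennreal_eq_0_iff)

lemma epowr_one [simp]: "epowr x 1 = x"
  by (cases x) (auto simp: epowr_ennreal)

lemma epowr_mono: "0 \<le> a \<Longrightarrow> x \<le> y \<Longrightarrow> epowr x a \<le> epowr y a"
  by (cases x; cases y) (auto simp: epowr_ennreal top_unique intro!: ennreal_leI powr_mono2)

lemma epowr_mult: "epowr (x * y) a = epowr x a * epowr y a"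
proof (cases "x = top \<or> y = top")
  case True
  then show ?thesis by (auto simp: ennreal_mult_eq_top_iff ennreal_mult_top ennreal_top_mult)
next
  case False
  then show ?thesis
    by (cases x; cases y) (auto simp: epowr_ennreal ennreal_mult[symmetric] powr_mult)
qed

lemma epowr_add: "epowr x (a + b) = epowr x a * epowr x b"
  by (cases x) (auto simp: epowr_ennreal ennreal_mult[symmetric] powr_add ennreal_top_mult)

lemma epowr_epowr: "epowr (epowr x a) b = epowr x (a * b)"
  by (cases x) (auto simp: epowr_ennreal powr_powr)

lemma measurable_epowr [measurable]:
  assumes [measurable]: "f \<in> borel_measurable M"
  shows "(\<lambda>x. epowr (f x) a) \<in> borel_measurable M"
  unfolding epowr_def by measurable

section \<open>Hoelder and Jensen inequalities for extended nonnegative functions\<close>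

lemma ennreal_Youngs:
  assumes "1 < p" "1 < q" "1 / p + 1 / q = 1"
  shows "x * y \<le> ennreal (1 / p) * epowr x p + ennreal (1 / q) * epowr y q"
proof (cases "x = top \<or> y = top")
  case True
  then show ?thesis using assms by (auto simp: ennreal_mult_top)
next
  case False
  with assms Youngs_inequality[of p q "enn2real x" "enn2real y"] show ?thesis
    by (cases x; cases y)
      (auto simp: epowr_ennreal ennreal_mult[symmetric] ennreal_plus[symmetric] simp del: ennreal_plus intro!: ennreal_leI)
qed

text \<open>Young's inequality for the functions divided by their norms. Degenerate norms are
  treated apart: a zero norm makes the product vanish almost everywhere, and an infinite norm next
  to a nonzero one makes the right side infinite.\<close>

lemma nn_integral_Holder:
  fixes f g :: "'a \<Rightarrow> ennreal"
  assumes [measurable]: "f \<in> borel_measurable M" "g \<in> borel_measurable M"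
    and p: "1 < p" "1 < q" "1 / p + 1 / q = 1"
  shows "(\<integral>\<^sup>+x. f x * g x \<partial>M) \<le>
    epowr (\<integral>\<^sup>+x. epowr (f x) p \<partial>M) (1 / p) * epowr (\<integral>\<^sup>+x. epowr (g x) q \<partial>M) (1 / q)"
    (is "_ \<le> epowr ?F _ * epowr ?G _")
proof (cases "?F = 0 \<or> ?G = 0")
  case True
  then have "AE x in M. f x * g x = 0"
    by (auto simp: nn_integral_0_iff_AE)
  then have "(\<integral>\<^sup>+x. f x * g x \<partial>M) = (\<integral>\<^sup>+x. 0 \<partial>M)"
    by (intro nn_integral_cong_AE) auto
  then show ?thesis by simp
next
  case nz: False
  show ?thesis
  proof (cases "?F = top \<or> ?G = top")
    case True
    with nz show ?thesis by (auto simp: ennreal_mult_top ennreal_top_mult)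
  next
    case False
    with nz obtain F G where FG: "?F = ennreal F" "?G = ennreal G" "0 < F" "0 < G"
      by (metis ennreal_cases ennreal_eq_0_iff not_le)
    define a where "a = F powr (1 / p)"
    define b where "b = G powr (1 / q)"
    have ab: "0 < a" "0 < b" "a powr p = F" "b powr q = G"
      using FG p by (auto simp: a_def b_def powr_powr)
    have pw: "f x * g x \<le> ennreal (a * b) * (ennreal (1 / p / F) * epowr (f x) p + ennreal (1 / q / G) * epowr (g x) q)" for x
    proof -
      have 1: "f x = ennreal a * (ennreal (1 / a) * f x)" "g x = ennreal b * (ennreal (1 / b) * g x)"
        using ab by (simp_all add: mult.assoc[symmetric] ennreal_mult[symmetric])
      have "f x * g x = ennreal (a * b) * ((ennreal (1 / a) * f x) * (ennreal (1 / b) * g x))"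
        using ab by (subst 1(1), subst 1(2)) (simp add: ennreal_mult mult_ac)
      also have "\<dots> \<le> ennreal (a * b) * (ennreal (1 / p) * epowr (ennreal (1 / a) * f x) p + ennreal (1 / q) * epowr (ennreal (1 / b) * g x) q)"
        by (intro mult_left_mono ennreal_Youngs p) simp
      also have "\<dots> = ennreal (a * b) * (ennreal (1 / p / F) * epowr (f x) p + ennreal (1 / q / G) * epowr (g x) q)"
        using ab p FG
        by (simp add: epowr_mult epowr_ennreal mult.assoc[symmetric] ennreal_mult''[symmetric] powr_divide)
      finally show ?thesis .
    qed
    have "(\<integral>\<^sup>+x. f x * g x \<partial>M) \<le> (\<integral>\<^sup>+x. ennreal (a * b) * (ennreal (1 / p / F) * epowr (f x) p + ennreal (1 / q / G) * epowr (g x) q) \<partial>M)"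
      by (intro nn_integral_mono pw)
    also have "\<dots> = ennreal (a * b) * (ennreal (1 / p / F) * ?F + ennreal (1 / q / G) * ?G)"
      by (simp add: nn_integral_cmult nn_integral_add)
    also have "\<dots> = ennreal (a * b) * ennreal (1 / p + 1 / q)"
      using FG p by (simp add: ennreal_mult[symmetric] ennreal_plus[symmetric] del: ennreal_plus)
    also have "\<dots> = epowr ?F (1 / p) * epowr ?G (1 / q)"
      using FG p ab by (simp add: epowr_ennreal a_def b_def ennreal_mult)
    finally show ?thesis .
  qed
qed

text \<open>Hoelder's inequality against the indicator of \<open>S\<close>, raised to the power
  \<open>p\<close>; with the conjugate exponent \<open>q\<close> the volume receives the power
  \<open>p / q = p - 1\<close>.\<close>

lemma nn_integral_Jensen:
  fixes f :: "'a \<Rightarrow> ennreal"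
  assumes [measurable]: "f \<in> borel_measurable M" "S \<in> sets M"
    and p: "1 < p" and M: "emeasure M S = ennreal V" "0 \<le> V"
  shows "epowr (\<integral>\<^sup>+x\<in>S. f x \<partial>M) p \<le> ennreal (V powr (p - 1)) * (\<integral>\<^sup>+x\<in>S. epowr (f x) p \<partial>M)"
proof -
  define q where "q = p / (p - 1)"
  have q: "1 < q" "1 / p + 1 / q = 1" using p by (auto simp: q_def field_simps)
  have "(\<integral>\<^sup>+x. (f x * indicator S x) * indicator S x \<partial>M)
     \<le> epowr (\<integral>\<^sup>+x. epowr (f x * indicator S x) p \<partial>M) (1 / p) * epowr (\<integral>\<^sup>+x. epowr (indicator S x) q \<partial>M) (1 / q)"
    by (intro nn_integral_Holder) (use p q in auto)
  also have "(\<integral>\<^sup>+x. (f x * indicator S x) * indicator S x \<partial>M) = (\<integral>\<^sup>+x\<in>S. f x \<partial>M)"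
    by (intro nn_integral_cong) (auto simp: indicator_def)
  also have "(\<integral>\<^sup>+x. epowr (f x * indicator S x) p \<partial>M) = (\<integral>\<^sup>+x\<in>S. epowr (f x) p \<partial>M)"
    by (intro nn_integral_cong) (auto simp: indicator_def)
  also have "(\<integral>\<^sup>+x. epowr (indicator S x) q \<partial>M) = (\<integral>\<^sup>+x. indicator S x \<partial>M)"
    by (intro nn_integral_cong) (auto simp: indicator_def)
  also have "\<dots> = ennreal V" using M by simp
  finally have "epowr (\<integral>\<^sup>+x\<in>S. f x \<partial>M) p \<le>
     epowr (epowr (\<integral>\<^sup>+x\<in>S. epowr (f x) p \<partial>M) (1 / p) * epowr (ennreal V) (1 / q)) p"
    using p by (intro epowr_mono) auto
  also have "\<dots> = (\<integral>\<^sup>+x\<in>S. epowr (f x) p \<partial>M) * epowr (ennreal V) (p / q)"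
    using p by (simp add: epowr_mult epowr_epowr)
  also have "p / q = p - 1" using p by (simp add: q_def)
  finally show ?thesis using M by (simp add: epowr_ennreal mult.commute)
qed

text \<open>The factor \<open>T\<close> is split off before the rest is bounded, because \<^const>\<open>epowr\<close> with exponent
  \<open>0\<close> maps \<open>0\<close> to \<open>0\<close>.\<close>

lemma nn_integral_epowr_le:
  fixes T :: "'a \<Rightarrow> ennreal"
  assumes [measurable]: "T \<in> borel_measurable M"
    and "\<And>x. x \<in> space M \<Longrightarrow> T x \<le> G" "(\<integral>\<^sup>+x. T x \<partial>M) \<le> G" "1 \<le> k"
  shows "(\<integral>\<^sup>+x. epowr (T x) k \<partial>M) \<le> epowr G k"
proof (cases "k = 1")
  case True
  then show ?thesis using assms by simp
next
  case False
  have "(\<integral>\<^sup>+x. epowr (T x) k \<partial>M) \<le> (\<integral>\<^sup>+x. epowr G (k - 1) * T x \<partial>M)"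
  proof (intro nn_integral_mono)
    fix x assume "x \<in> space M"
    have "epowr (T x) k = epowr (T x) (k - 1) * T x"
      using epowr_add[of "T x" "k - 1" 1] by simp
    also have "\<dots> \<le> epowr G (k - 1) * T x"
      using assms False \<open>x \<in> space M\<close> by (intro mult_right_mono epowr_mono) auto
    finally show "epowr (T x) k \<le> epowr G (k - 1) * T x" .
  qed
  also have "\<dots> = epowr G (k - 1) * (\<integral>\<^sup>+x. T x \<partial>M)"
    by (simp add: nn_integral_cmult)
  also have "\<dots> \<le> epowr G (k - 1) * epowr G 1"
    using assms by (intro mult_left_mono) auto
  also have "\<dots> = epowr G k" using epowr_add[of G "k - 1" 1] by simp
  finally show ?thesis .
qed

section \<open>Cubes: volume, scaling, measurability\<close>

lemma cube_eq_box: "cube x0 r = box (x0 - (\<chi> i. r)) (x0 + (\<chi> i. r))"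
  by (auto simp: cube_def mem_box_cart abs_less_iff algebra_simps)

lemma open_cube [simp, intro]: "open (cube x0 r)"
  by (simp add: cube_eq_box open_box)

lemma cube_borel [measurable, simp]: "cube x0 r \<in> sets borel"
  by (simp add: borel_open)

lemma emeasure_cube:
  fixes x0 :: "real^'n"
  assumes "0 < r"
  shows "emeasure lborel (cube x0 r) = ennreal ((2 * r) powr real CARD('n))"
proof -
  have "emeasure lborel (cube x0 r) = (\<Prod>b\<in>Basis. ((x0 + (\<chi> i. r)) - (x0 - (\<chi> i. r))) \<bullet> (b :: real^'n))"
    unfolding cube_eq_box using assms
    by (intro emeasure_lborel_box) (auto simp: Basis_vec_def inner_axis)
  also have "(\<Prod>b\<in>Basis. ((x0 + (\<chi> i. r)) - (x0 - (\<chi> i. r))) \<bullet> (b :: real^'n)) = (\<Prod>b\<in>(Basis :: (real^'n) set). 2 * r)"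
    by (intro prod.cong) (auto simp: Basis_vec_def inner_axis)
  also have "\<dots> = (2 * r) powr real CARD('n)"
    using assms by (simp add: powr_realpow)
  finally show ?thesis .
qed

lemma nn_integral_lborel_affine:
  fixes f :: "real^'n \<Rightarrow> ennreal"
  assumes [measurable]: "f \<in> borel_measurable borel" and c: "0 < c"
  shows "(\<integral>\<^sup>+x. f (t + c *\<^sub>R x) \<partial>lborel) = ennreal (c powr - real CARD('n)) * (\<integral>\<^sup>+x. f x \<partial>lborel)"
proof -
  have "(\<integral>\<^sup>+x. f x \<partial>lborel) = ennreal (c ^ CARD('n)) * (\<integral>\<^sup>+x. f (t + c *\<^sub>R x) \<partial>lborel)"
    using c by (subst lborel_affine[of c t]) (simp_all add: nn_integral_density nn_integral_distr nn_integral_cmult)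
  moreover have "c powr - real CARD('n) * c ^ CARD('n) = 1"
    using c by (simp add: powr_minus powr_realpow)
  ultimately show ?thesis
    using c by (simp add: mult.assoc[symmetric] ennreal_mult[symmetric])
qed

lemma cube_center [simp]: "0 < r \<Longrightarrow> x0 \<in> cube x0 r"
  by (simp add: cube_def)

lemma cube_mono: "r \<le> s \<Longrightarrow> cube x0 r \<subseteq> cube x0 s"
  by (auto simp: cube_def intro: less_le_trans)

lemma measurable_vec_nth [measurable]: "(\<lambda>x::real^'n. x $ i) \<in> borel_measurable borel"
  by (intro borel_measurable_continuous_onI continuous_intros)

text \<open>Joint measurability in centre, point and radius, so that Fubini's theorem applies to
  integrals over cubes that vary with the point.\<close>

lemma measurable_in_cube [measurable]:
  fixes c y :: "'a \<Rightarrow> real^'n"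
  assumes [measurable]: "c \<in> borel_measurable M" "y \<in> borel_measurable M" "s \<in> borel_measurable M"
  shows "Measurable.pred M (\<lambda>x. y x \<in> cube (c x) (s x))"
proof -
  have "{x \<in> space M. y x \<in> cube (c x) (s x)} = space M \<inter> (\<Inter>i\<in>UNIV. {x \<in> space M. \<bar>y x $ i - c x $ i\<bar> < s x})"
    by (auto simp: cube_def)
  also have "\<dots> \<in> sets M"
    by (intro sets.Int sets.top sets.finite_INT) (auto intro: measurable)
  finally show ?thesis by (simp add: pred_def)
qed

section \<open>Averages over moving cubes\<close>

text \<open>The \<open>A\<^bsub>q,p\<^esub>\<close> condition of Muckenhoupt and Wheeden, with \<open>n * (1 / p + (q - 1) / q)\<close> as power
  of the side length since integrals rather than averages occur.\<close>

definition Apq :: "(real^'n \<Rightarrow> real) \<Rightarrow> real \<Rightarrow> real \<Rightarrow> real \<Rightarrow> bool" where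
  "Apq m p q B \<longleftrightarrow> (\<forall>x0 r. 0 < r \<longrightarrow>
     epowr (\<integral>\<^sup>+x\<in>cube x0 r. ennreal (m x powr p) \<partial>lborel) (1 / p) *
     epowr (\<integral>\<^sup>+x\<in>cube x0 r. ennreal (m x powr - (q / (q - 1))) \<partial>lborel) ((q - 1) / q)
     \<le> ennreal (B * (2 * r) powr (CARD('n) * (1 / p + (q - 1) / q))))"

lemma nn_integral_pos:
  fixes f :: "real^'n \<Rightarrow> real"
  assumes [measurable]: "f \<in> borel_measurable borel" and f: "\<And>x. 0 < f x" and r: "0 < r"
  shows "0 < (\<integral>\<^sup>+x\<in>cube x0 r. ennreal (f x) \<partial>lborel)"
proof (rule ccontr)
  assume "\<not> ?thesis"
  then have "AE x in lborel. ennreal (f x) * indicator (cube x0 r) x = 0"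
    by (simp add: nn_integral_0_iff_AE)
  then have "AE x in lborel. indicator (cube x0 r) x = (0::ennreal)"
    by eventually_elim (use f in \<open>auto simp: ennreal_eq_0_iff dest: leD\<close>)
  then have "(\<integral>\<^sup>+x. indicator (cube x0 r) x \<partial>lborel) = (\<integral>\<^sup>+x. 0 \<partial>(lborel :: (real^'n) measure))"
    by (intro nn_integral_cong_AE)
  then have "emeasure lborel (cube x0 r) = 0" by simp
  then show False using r by (simp add: emeasure_cube)
qed

text \<open>A bound for a product bounds one factor only if the other does not vanish; both
  integrals are positive because \<open>m\<close> is positive everywhere.\<close>

lemma Apq_finite:
  fixes m :: "real^'n \<Rightarrow> real"
  assumes A: "Apq m p q B" and [measurable]: "m \<in> borel_measurable borel" and m: "\<And>x. 0 < m x"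
    and pq: "0 < p" "1 < q" and r: "0 < r"
  shows "(\<integral>\<^sup>+x\<in>cube x0 r. ennreal (m x powr p) \<partial>lborel) < top"
    and "(\<integral>\<^sup>+x\<in>cube x0 r. ennreal (m x powr - (q / (q - 1))) \<partial>lborel) < top"
proof -
  let ?F = "\<integral>\<^sup>+x\<in>cube x0 r. ennreal (m x powr p) \<partial>lborel"
  let ?G = "\<integral>\<^sup>+x\<in>cube x0 r. ennreal (m x powr - (q / (q - 1))) \<partial>lborel"
  have nz: "0 < ?F" "0 < ?G"
    using r by (auto intro!: nn_integral_pos simp: m less_imp_neq[OF m, symmetric])
  have "epowr ?F (1 / p) * epowr ?G ((q - 1) / q) < top"
    using A r unfolding Apq_def by (meson ennreal_less_top le_less_trans)
  then show "?F < top" "?G < top"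
    using nz pq by (auto simp: less_top[symmetric] ennreal_mult_eq_top_iff)
qed

text \<open>Hoelder's inequality for \<open>g = (g * m) * (1 / m)\<close> on \<open>S\<close>. The
  dual norm of \<open>1 / m\<close>, enlarged to the whole cube, pairs with the weight of that cube
  in the \<open>Apq\<close> condition. Since \<open>S\<close> may be smaller than the cube, the case
  \<open>g = 1\<close> compares masses of different sets; doubling and the A-infinity property come
  from it.\<close>

lemma single_cube_estimate:
  fixes m :: "real^'n \<Rightarrow> real" and g :: "real^'n \<Rightarrow> ennreal"
  assumes A: "Apq m p q B" and [measurable]: "m \<in> borel_measurable borel" and m: "\<And>x. 0 < m x"
    and pq: "1 < q" "q \<le> p" and r: "0 < r" and B: "0 \<le> B"
    and [measurable]: "g \<in> borel_measurable borel" "S \<in> sets borel" and S: "S \<subseteq> cube x0 r"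
  shows "epowr (\<integral>\<^sup>+y\<in>S. g y \<partial>lborel) p * (\<integral>\<^sup>+x\<in>cube x0 r. ennreal (m x powr p) \<partial>lborel)
    \<le> ennreal (B powr p * (2 * r) powr (CARD('n) * (1 + p - p / q))) *
       epowr (\<integral>\<^sup>+y\<in>S. epowr (g y) q * ennreal (m y powr q) \<partial>lborel) (p / q)"
proof -
  define q' where "q' = q / (q - 1)"
  have q': "1 < q'" "1 / q + 1 / q' = 1" "(q - 1) / q = 1 / q'"
    using pq by (auto simp: q'_def field_simps)
  let ?W = "\<integral>\<^sup>+x\<in>cube x0 r. ennreal (m x powr p) \<partial>lborel"
  let ?I = "\<integral>\<^sup>+y\<in>S. epowr (g y) q * ennreal (m y powr q) \<partial>lborel"
  let ?G = "\<integral>\<^sup>+x\<in>cube x0 r. ennreal (m x powr - q') \<partial>lborel"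
  have mm: "ennreal (m y) * ennreal (1 / m y) = 1" for y
    using m[of y] by (simp add: ennreal_mult[symmetric])
  have "(\<integral>\<^sup>+y\<in>S. g y \<partial>lborel) = (\<integral>\<^sup>+y. (g y * ennreal (m y) * indicator S y) * (ennreal (1 / m y) * indicator S y) \<partial>lborel)"
  proof (intro nn_integral_cong)
    fix y
    have "(g y * ennreal (m y) * indicator S y) * (ennreal (1 / m y) * indicator S y)
      = g y * (ennreal (m y) * ennreal (1 / m y)) * indicator S y"
      by (simp add: indicator_def mult_ac)
    then show "g y * indicator S y = (g y * ennreal (m y) * indicator S y) * (ennreal (1 / m y) * indicator S y)"
      by (simp add: mm)
  qed
  also have "\<dots> \<le> epowr (\<integral>\<^sup>+y. epowr (g y * ennreal (m y) * indicator S y) q \<partial>lborel) (1 / q)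
      * epowr (\<integral>\<^sup>+y. epowr (ennreal (1 / m y) * indicator S y) q' \<partial>lborel) (1 / q')"
    by (intro nn_integral_Holder) (use pq q' in auto)
  also have "(\<integral>\<^sup>+y. epowr (g y * ennreal (m y) * indicator S y) q \<partial>lborel) = ?I"
    by (intro nn_integral_cong) (use m in \<open>auto simp: epowr_mult epowr_ennreal less_imp_le indicator_def\<close>)
  finally have 1: "(\<integral>\<^sup>+y\<in>S. g y \<partial>lborel) \<le> epowr ?I (1 / q)
      * epowr (\<integral>\<^sup>+y. epowr (ennreal (1 / m y) * indicator S y) q' \<partial>lborel) (1 / q')" .
  have 2: "(\<integral>\<^sup>+y. epowr (ennreal (1 / m y) * indicator S y) q' \<partial>lborel) \<le> ?G"
  proof (intro nn_integral_mono)
    fix y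
    have "(1 / m y) powr q' = m y powr - q'"
      using m[of y] by (simp add: powr_divide powr_minus inverse_eq_divide)
    then show "epowr (ennreal (1 / m y) * indicator S y) q' \<le> ennreal (m y powr - q') * indicator (cube x0 r) y"
      using S m[of y] by (auto simp: epowr_mult epowr_ennreal indicator_def)
  qed
  have "(\<integral>\<^sup>+y\<in>S. g y \<partial>lborel) \<le> epowr ?I (1 / q) * epowr ?G (1 / q')"
    by (rule order_trans[OF 1]) (use q' 2 in \<open>auto intro!: mult_left_mono epowr_mono\<close>)
  then have "epowr (\<integral>\<^sup>+y\<in>S. g y \<partial>lborel) p * ?W \<le> epowr (epowr ?I (1 / q) * epowr ?G (1 / q')) p * epowr (epowr ?W (1 / p)) p"
    using pq by (intro mult_mono epowr_mono) (auto simp: epowr_epowr)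
  also have "\<dots> = epowr (epowr ?W (1 / p) * epowr ?G (1 / q')) p * epowr ?I (p / q)"
    using pq by (simp add: epowr_mult epowr_epowr mult_ac)
  also have "epowr (epowr ?W (1 / p) * epowr ?G (1 / q')) p \<le> epowr (ennreal (B * (2 * r) powr (CARD('n) * (1 / p + (q - 1) / q)))) p"
    using A r pq unfolding Apq_def q'_def[symmetric] q'(3)[symmetric] by (intro epowr_mono) auto
  also have "\<dots> = ennreal (B powr p * (2 * r) powr (CARD('n) * (1 + p - p / q)))"
  proof -
    have "(CARD('n) * (1 / p + (q - 1) / q)) * p = CARD('n) * (1 + p - p / q)"
      using pq by (simp add: field_simps)
    then show ?thesis using B r pq
      by (simp only: epowr_ennreal powr_mult powr_powr mult_nonneg_nonneg powr_ge_zero)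
  qed
  finally show ?thesis by (simp add: mult_right_mono)
qed

lemma ennreal_one_divide_antimono: "x \<le> y \<Longrightarrow> 1 / y \<le> 1 / (x :: ennreal)"
proof (cases "x = 0 \<or> y = top")
  case False
  assume "x \<le> y"
  with False show ?thesis
    by (cases x; cases y) (auto simp: top_unique divide_ennreal ennreal_1[symmetric] simp del: ennreal_1 intro!: ennreal_leI divide_left_mono)
qed (auto simp: divide_ennreal_def top_unique)

text \<open>Each \<open>y\<close> lies in \<open>S x\<close> only for \<open>x\<close> in a set contained in \<open>cube x (s x)\<close>, so that the weights
  \<open>m\<^sup>p(x) / m\<^sup>p(cube x (s x))\<close> of the single cube estimates integrate to at most \<open>1\<close>.\<close>

lemma moving_cubes_estimate:
  fixes m :: "real^'n \<Rightarrow> real" and g :: "real^'n \<Rightarrow> ennreal"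
  assumes A: "Apq m p q B" and [measurable]: "m \<in> borel_measurable borel" and m: "\<And>x. 0 < m x"
    and pq: "1 < q" "q \<le> p" and B: "0 \<le> B"
    and g [measurable]: "g \<in> borel_measurable borel"
    and X [measurable]: "X \<in> sets borel" "Y \<in> sets borel" and s [measurable]: "s \<in> borel_measurable borel"
    and R [measurable]: "{(x, y). y \<in> S x} \<in> sets (borel \<Otimes>\<^sub>M borel)"
    and s_pos: "\<And>x. x \<in> X \<Longrightarrow> 0 < s x"
    and S: "\<And>x. x \<in> X \<Longrightarrow> S x \<subseteq> cube x (s x)" "\<And>x. x \<in> X \<Longrightarrow> S x \<subseteq> Y"
    and H: "\<And>x x' y. x \<in> X \<Longrightarrow> x' \<in> X \<Longrightarrow> y \<in> S x \<Longrightarrow> y \<in> S x' \<Longrightarrow> x' \<in> cube x (s x)"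
  shows "(\<integral>\<^sup>+x\<in>X. epowr (\<integral>\<^sup>+y\<in>S x. g y \<partial>lborel) p * ennreal ((2 * s x) powr - (CARD('n) * (1 + p - p / q)))
       * ennreal (m x powr p) \<partial>lborel)
    \<le> ennreal (B powr p) * epowr (\<integral>\<^sup>+y\<in>Y. epowr (g y) q * ennreal (m y powr q) \<partial>lborel) (p / q)"
proof -
  define W where "W x = (\<integral>\<^sup>+z\<in>cube x (s x). ennreal (m z powr p) \<partial>lborel)" for x
  define T where "T x = (\<integral>\<^sup>+y\<in>S x. epowr (g y) q * ennreal (m y powr q) \<partial>lborel)" for x
  define G where "G = (\<integral>\<^sup>+y\<in>Y. epowr (g y) q * ennreal (m y powr q) \<partial>lborel)"
  define k where "k = CARD('n) * (1 + p - p / q)"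
  have Wm [measurable]: "W \<in> borel_measurable borel"
  proof -
    have [measurable]: "(\<lambda>(x, z). indicator (cube x (s x)) z :: ennreal) \<in> borel_measurable (borel \<Otimes>\<^sub>M borel)"
    proof -
      have "Measurable.pred (borel \<Otimes>\<^sub>M borel) (\<lambda>xz :: (real^'n) \<times> (real^'n). snd xz \<in> cube (fst xz) (s (fst xz)))"
        by measurable
      then have "{xz :: (real^'n) \<times> (real^'n). snd xz \<in> cube (fst xz) (s (fst xz))} \<in> sets (borel \<Otimes>\<^sub>M borel)"
        by (simp add: pred_def space_pair_measure)
      then show ?thesis
        by (auto simp: case_prod_beta intro!: borel_measurable_indicator' )
    qed
    show ?thesis unfolding W_def by measurable
  qed
  have [measurable]: "(\<lambda>(x, y). indicator (S x) y :: ennreal) \<in> borel_measurable (borel \<Otimes>\<^sub>M borel)"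
    using R by (auto simp: case_prod_beta' space_pair_measure intro!: borel_measurable_indicator')
  have Sx [measurable]: "S x \<in> sets borel" for x
    using measurable_sets[OF _ R, of "\<lambda>y. (x, y)" borel] by (simp add: vimage_def)
  have Tm [measurable]: "T \<in> borel_measurable borel"
    unfolding T_def by measurable
  have Wp: "0 < W x" "W x < top" if "x \<in> X" for x
    using s_pos[OF that] Apq_finite[OF A _ m, of "s x" x] pq
    by (auto simp: W_def m less_imp_neq[OF m, symmetric] intro!: nn_integral_pos)
  have [simp]: "0 < x \<Longrightarrow> x < top \<Longrightarrow> x * (1 / x) = 1" for x :: ennreal
    by (metis ennreal_divide_self ennreal_times_divide mult.right_neutral not_gr_zero less_irrefl)
  have pw: "epowr (\<integral>\<^sup>+y\<in>S x. g y \<partial>lborel) p * ennreal ((2 * s x) powr - k) * ennreal (m x powr p) * indicator X x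
     \<le> ennreal (B powr p) * (epowr (T x) (p / q) * (ennreal (m x powr p) * (1 / W x) * indicator X x))" for x
  proof (cases "x \<in> X")
    case True
    note W = Wp[OF True]
    have "epowr (\<integral>\<^sup>+y\<in>S x. g y \<partial>lborel) p * W x \<le> ennreal (B powr p * (2 * s x) powr k) * epowr (T x) (p / q)"
      unfolding W_def T_def k_def
      by (rule single_cube_estimate[OF A _ m]) (use True pq s_pos B S in auto)
    then have "epowr (\<integral>\<^sup>+y\<in>S x. g y \<partial>lborel) p * W x * (1 / W x) * ennreal ((2 * s x) powr - k)
      \<le> ennreal (B powr p * (2 * s x) powr k) * epowr (T x) (p / q) * (1 / W x) * ennreal ((2 * s x) powr - k)"
      by (intro mult_right_mono) auto
    moreover have "epowr (\<integral>\<^sup>+y\<in>S x. g y \<partial>lborel) p * W x * (1 / W x) = epowr (\<integral>\<^sup>+y\<in>S x. g y \<partial>lborel) p"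
      using W by (simp add: mult.assoc)
    moreover have "ennreal (B powr p * (2 * s x) powr k) * epowr (T x) (p / q) * (1 / W x) * ennreal ((2 * s x) powr - k)
      = ennreal (B powr p) * (epowr (T x) (p / q) * (1 / W x))"
    proof -
      have "ennreal (B powr p * (2 * s x) powr k) * ennreal ((2 * s x) powr - k) = ennreal (B powr p)"
        using s_pos[OF True] by (simp add: ennreal_mult[symmetric] mult.assoc powr_add[symmetric])
      then show ?thesis by (metis mult.assoc mult.commute)
    qed
    ultimately have "epowr (\<integral>\<^sup>+y\<in>S x. g y \<partial>lborel) p * ennreal ((2 * s x) powr - k)
      \<le> ennreal (B powr p) * (epowr (T x) (p / q) * (1 / W x))"
      by simp
    from mult_right_mono[OF this, of "ennreal (m x powr p)"] True show ?thesis
      by (simp add: mult_ac)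
  qed simp
  \<comment> \<open>\<open>N\<close> has density \<open>m powr p / W\<close> on \<open>X\<close>.
    Once \<open>T\<close> is bounded by \<open>G\<close> pointwise and also in its integral against
    \<open>N\<close>, its power with exponent \<open>p / q \<ge> 1\<close> is controlled as
    well.\<close>
  define N where "N = density lborel (\<lambda>x. ennreal (m x powr p) * (1 / W x) * indicator X x)"
  have N_int: "(\<integral>\<^sup>+x. h x \<partial>N) = (\<integral>\<^sup>+x. (ennreal (m x powr p) * (1 / W x) * indicator X x) * h x \<partial>lborel)"
    if [measurable]: "h \<in> borel_measurable borel" for h
    unfolding N_def by (subst nn_integral_density) simp_all
  have T_int: "(\<integral>\<^sup>+x. T x * indicator X x \<partial>N) \<le> G"
  proof -
    have "(\<integral>\<^sup>+x. T x * indicator X x \<partial>N) = (\<integral>\<^sup>+x. (\<integral>\<^sup>+y. (ennreal (m x powr p) * (1 / W x) * indicator X x)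
        * (epowr (g y) q * ennreal (m y powr q) * indicator (S x) y) \<partial>lborel) \<partial>lborel)"
      by (subst N_int, measurable, intro nn_integral_cong, subst nn_integral_cmult, measurable)
        (auto simp: T_def indicator_def)
    also have "\<dots> = (\<integral>\<^sup>+y. (\<integral>\<^sup>+x. (ennreal (m x powr p) * (1 / W x) * indicator X x)
        * (epowr (g y) q * ennreal (m y powr q) * indicator (S x) y) \<partial>lborel) \<partial>lborel)"
      by (rule lborel_pair.Fubini'[symmetric]) measurable
    also have "\<dots> \<le> (\<integral>\<^sup>+y. epowr (g y) q * ennreal (m y powr q) * indicator Y y \<partial>lborel)"
    proof (intro nn_integral_mono)
      fix y
      define E where "E = {x\<in>X. y \<in> S x}"
      have E [measurable]: "E \<in> sets borel"
      proof -
        have "{x. y \<in> S x} \<in> sets borel"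
          using measurable_sets[OF _ R, of "\<lambda>x. (x, y)" borel] by (simp add: vimage_def)
        moreover have "E = X \<inter> {x. y \<in> S x}" by (auto simp: E_def)
        ultimately show ?thesis using X by auto
      qed
      let ?WE = "\<integral>\<^sup>+z\<in>E. ennreal (m z powr p) \<partial>lborel"
      \<comment> \<open>By \<open>H\<close> the points whose sets contain \<open>y\<close> all lie
        in the cube of any one of them, so none of these cubes weighs less than
        \<open>E\<close>.\<close>
      have le: "?WE \<le> W x" if "x \<in> E" for x
        unfolding W_def by (intro nn_integral_mono) (use H that in \<open>auto simp: E_def indicator_def\<close>)
      have "(\<integral>\<^sup>+x. ennreal (m x powr p) * (1 / W x) * indicator E x \<partial>lborel) \<le> 1"
      proof (cases "?WE = 0")
        case True
        then have "AE x in lborel. ennreal (m x powr p) * indicator E x = 0"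
          by (simp add: nn_integral_0_iff_AE)
        then have "AE x in lborel. ennreal (m x powr p) * (1 / W x) * indicator E x = 0"
          by eventually_elim auto
        then have "(\<integral>\<^sup>+x. ennreal (m x powr p) * (1 / W x) * indicator E x \<partial>lborel) = 0"
          by (subst nn_integral_0_iff_AE) auto
        then show ?thesis by simp
      next
        case False
        then obtain x0 where x0: "x0 \<in> E"
          by (cases "E = {}") auto
        have fin: "?WE < top" using le[OF x0] Wp(2)[of x0] x0 by (auto simp: E_def)
        have "(\<integral>\<^sup>+x. ennreal (m x powr p) * (1 / W x) * indicator E x \<partial>lborel)
           \<le> (\<integral>\<^sup>+x. (1 / ?WE) * (ennreal (m x powr p) * indicator E x) \<partial>lborel)"
        proof (intro nn_integral_mono)
          fix x
          show "ennreal (m x powr p) * (1 / W x) * indicator E x \<le> (1 / ?WE) * (ennreal (m x powr p) * indicator E x)"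
            using mult_right_mono[OF ennreal_one_divide_antimono[OF le], of x "ennreal (m x powr p)"]
            by (cases "x \<in> E") (auto simp: mult.commute)
        qed
        also have "\<dots> = (1 / ?WE) * ?WE" by (simp add: nn_integral_cmult)
        also have "\<dots> = 1" using False fin by (simp add: mult.commute zero_less_iff_neq_zero)
        finally show ?thesis .
      qed
      note le1 = this
      have "(\<integral>\<^sup>+x. (ennreal (m x powr p) * (1 / W x) * indicator X x)
        * (epowr (g y) q * ennreal (m y powr q) * indicator (S x) y) \<partial>lborel)
        = (\<integral>\<^sup>+x. (epowr (g y) q * ennreal (m y powr q) * indicator Y y) * (ennreal (m x powr p) * (1 / W x) * indicator E x) \<partial>lborel)"
        by (intro nn_integral_cong) (use S in \<open>auto simp: E_def indicator_def mult_ac\<close>)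
      also have "\<dots> = (epowr (g y) q * ennreal (m y powr q) * indicator Y y) * (\<integral>\<^sup>+x. ennreal (m x powr p) * (1 / W x) * indicator E x \<partial>lborel)"
        by (rule nn_integral_cmult) measurable
      also have "\<dots> \<le> (epowr (g y) q * ennreal (m y powr q) * indicator Y y) * 1"
        by (intro mult_left_mono le1) auto
      finally show "(\<integral>\<^sup>+x. (ennreal (m x powr p) * (1 / W x) * indicator X x)
        * (epowr (g y) q * ennreal (m y powr q) * indicator (S x) y) \<partial>lborel) \<le> epowr (g y) q * ennreal (m y powr q) * indicator Y y"
        by simp
    qed
    finally show ?thesis by (simp add: G_def)
  qed
  have T_le: "T x * indicator X x \<le> G" for x
    unfolding T_def G_def
    by (cases "x \<in> X") (use S(2)[of x] in \<open>auto simp: indicator_def intro!: nn_integral_mono dest: subsetD\<close>)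
  have "(\<integral>\<^sup>+x. epowr (\<integral>\<^sup>+y\<in>S x. g y \<partial>lborel) p * ennreal ((2 * s x) powr - k) * ennreal (m x powr p) * indicator X x \<partial>lborel)
    \<le> (\<integral>\<^sup>+x. ennreal (B powr p) * (epowr (T x) (p / q) * (ennreal (m x powr p) * (1 / W x) * indicator X x)) \<partial>lborel)"
    by (intro nn_integral_mono pw)
  also have "\<dots> = ennreal (B powr p) * (\<integral>\<^sup>+x. epowr (T x * indicator X x) (p / q) \<partial>N)"
    by (subst N_int, measurable, subst nn_integral_cmult[symmetric], measurable, intro nn_integral_cong)
      (auto simp: indicator_def mult_ac)
  also have "(\<integral>\<^sup>+x. epowr (T x * indicator X x) (p / q) \<partial>N) \<le> epowr G (p / q)"
    by (rule nn_integral_epowr_le) (use T_int T_le pq in \<open>auto simp: N_def\<close>)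
  finally show ?thesis by (auto simp: k_def G_def mult_left_mono)
qed

section \<open>The reverse Hoelder inequality\<close>

text \<open>Half-open and given by the lower corner, so that the dyadic children partition the
  parent exactly; open cubes do so only up to null sets.\<close>

definition hbox :: "real^'n \<Rightarrow> real \<Rightarrow> (real^'n) set" where
  "hbox a h = {x. \<forall>i. a $ i \<le> x $ i \<and> x $ i < a $ i + h}"

definition corners :: "(real^'n) set" where
  "corners = {s. \<forall>i. s $ i = 0 \<or> s $ i = 1}"

lemma finite_corners: "finite (corners :: (real^'n) set)"
proof -
  have "corners \<subseteq> range (\<lambda>f :: 'n \<Rightarrow> bool. (\<chi> i. if f i then 1 else 0) :: real^'n)"
  proof
    fix s :: "real^'n" assume "s \<in> corners"
    then have "s = (\<chi> i. if s $ i = 1 then 1 else 0)"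
      by (auto simp: corners_def vec_eq_iff)
    then show "s \<in> range (\<lambda>f :: 'n \<Rightarrow> bool. (\<chi> i. if f i then 1 else 0) :: real^'n)"
      by (intro range_eqI[of _ _ "\<lambda>i. s $ i = 1"])
  qed
  then show ?thesis by (rule finite_subset) simp
qed

text \<open>The two cubes differ only on the hyperplanes through the lower faces.\<close>

lemma hbox_eq_cube:
  "AE x :: real^'n in lborel. (x \<in> hbox a h) = (x \<in> cube (a + (\<chi> i. h / 2)) (h / 2))" 
proof -
  have "(\<Union>i. {x :: real^'n. x $ i = a $ i}) \<in> null_sets lborel"
  proof (intro null_sets_UN')
    show "countable (UNIV :: 'n set)" by (simp add: countable_finite)
    fix i :: 'n
    have "negligible {x :: real^'n. x $ i = a $ i}"
      using negligible_hyperplane[of "axis i (1::real)" "a $ i"]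
      by (simp add: inner_axis')
    moreover have "closed {x :: real^'n. x $ i = a $ i}"
      by (intro closed_Collect_eq continuous_intros)
    ultimately show "{x :: real^'n. x $ i = a $ i} \<in> null_sets lborel"
      by (metis borel_closed negligible_iff_null_sets null_sets_completion_iff sets_lborel)
  qed
  then have "AE x in lborel. x \<notin> (\<Union>i. {x :: real^'n. x $ i = a $ i})"
    by (rule AE_not_in)
  then show ?thesis
  proof eventually_elim
    case (elim x)
    have "\<bar>x $ i - (a $ i + h / 2)\<bar> < h / 2 \<longleftrightarrow> a $ i \<le> x $ i \<and> x $ i < a $ i + h" for i
      using elim by (auto simp: abs_less_iff field_simps) (smt (verit))?
    then show ?case by (simp add: hbox_def cube_def)
  qed
qed

lemma hbox_borel [measurable, simp]: "hbox (a :: real^'n) h \<in> sets borel"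
proof -
  have "hbox a h = (\<Inter>i\<in>UNIV. {x. a $ i \<le> x $ i} \<inter> {x. x $ i < a $ i + h})"
    by (auto simp: hbox_def)
  also have "\<dots> \<in> sets borel"
    by (intro sets.finite_INT sets.Int borel_closed borel_open closed_Collect_le open_Collect_less continuous_intros) auto
  finally show ?thesis .
qed

lemma emeasure_hbox: "0 < h \<Longrightarrow> emeasure lborel (hbox (a :: real^'n) h) = ennreal (h ^ CARD('n))"
  using emeasure_cube[of "h / 2" "a + (\<chi> i. h / 2)"] emeasure_eq_AE[OF hbox_eq_cube[of a h]]
  by (simp add: powr_realpow)

lemma measure_hbox: "0 < h \<Longrightarrow> measure lborel (hbox (a :: real^'n) h) = h ^ CARD('n)"
  by (simp add: measure_def emeasure_hbox)

lemma hbox_subset_child: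
  assumes "s \<in> corners" "0 < h"
  shows "hbox (a + (h / 2) *\<^sub>R s) (h / 2) \<subseteq> hbox (a :: real^'n) h"
proof
  fix x :: "real^'n" assume x: "x \<in> hbox (a + (h / 2) *\<^sub>R s) (h / 2)"
  have "a $ i \<le> x $ i \<and> x $ i < a $ i + h" for i
    using x assms unfolding hbox_def corners_def
    by (cases "s $ i = 0") (auto dest!: spec[of _ i])
  then show "x \<in> hbox a h" by (simp add: hbox_def)
qed

lemma hbox_children:
  assumes "0 < h"
  shows "hbox (a :: real^'n) h = (\<Union>s\<in>corners. hbox (a + (h / 2) *\<^sub>R s) (h / 2))"
proof
  show "hbox a h \<subseteq> (\<Union>s\<in>corners. hbox (a + (h / 2) *\<^sub>R s) (h / 2))"
  proof
    fix x assume x: "x \<in> hbox a h"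
    define s :: "real^'n" where "s = (\<chi> i. if x $ i < a $ i + h / 2 then 0 else 1)"
    have "s \<in> corners" by (simp add: s_def corners_def)
    moreover have "x \<in> hbox (a + (h / 2) *\<^sub>R s) (h / 2)"
      using x by (auto simp: hbox_def s_def add.commute)
    ultimately show "x \<in> (\<Union>s\<in>corners. hbox (a + (h / 2) *\<^sub>R s) (h / 2))" by blast
  qed
qed (use hbox_subset_child assms in blast)

lemma disjoint_children:
  assumes "0 < h"
  shows "disjoint_family_on (\<lambda>s. hbox ((a :: real^'n) + (h / 2) *\<^sub>R s) (h / 2)) corners"
  unfolding disjoint_family_on_def
proof (intro ballI impI)
  fix s t :: "real^'n" assume st: "s \<in> corners" "t \<in> corners" "s \<noteq> t"
  then obtain i where "s $ i \<noteq> t $ i" by (auto simp: vec_eq_iff)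
  then have i: "s $ i = 0 \<and> t $ i = 1 \<or> s $ i = 1 \<and> t $ i = 0"
    using st unfolding corners_def mem_Collect_eq by metis
  show "hbox (a + (h / 2) *\<^sub>R s) (h / 2) \<inter> hbox (a + (h / 2) *\<^sub>R t) (h / 2) = {}"
    using i assms by (auto simp: hbox_def dest!: spec[of _ i])
qed

text \<open>A quantitative A-infinity condition: a subset filling a fixed part of a cube carries a
  fixed part of its mass. The weight is abstract because the intended instance is not
  \<open>m\<close> but the dual weight \<open>m powr - (p / (p - 1))\<close>.\<close>

locale A_infinity_weight =
  fixes \<sigma> :: "real^'n \<Rightarrow> real" and d K :: real
  assumes \<sigma>_borel [measurable]: "\<sigma> \<in> borel_measurable borel"
    and \<sigma>_pos: "\<And>x. 0 < \<sigma> x"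
    and K: "1 \<le> K" and d: "0 < d"
    and \<sigma>_finite: "\<And>a h. (\<integral>\<^sup>+x\<in>hbox a h. ennreal (\<sigma> x) \<partial>lborel) < top"
    and A_infinity: "\<And>a h F. 0 < h \<Longrightarrow> F \<in> sets borel \<Longrightarrow> F \<subseteq> hbox a h \<Longrightarrow>
      (measure lborel F / h ^ CARD('n)) powr d * measure (density lborel (\<lambda>x. ennreal (\<sigma> x))) (hbox a h)
      \<le> K * measure (density lborel (\<lambda>x. ennreal (\<sigma> x))) F"
begin

definition nu :: "(real^'n) measure" where "nu = density lborel (\<lambda>x. ennreal (\<sigma> x))"

lemma sets_nu [simp, measurable_cong]: "sets nu = sets borel" by (simp add: nu_def)

lemma emeasure_nu: "E \<in> sets borel \<Longrightarrow> emeasure nu E = (\<integral>\<^sup>+x\<in>E. ennreal (\<sigma> x) \<partial>lborel)"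
  unfolding nu_def by (subst emeasure_density) auto

lemma nu_finite: "E \<subseteq> hbox a h \<Longrightarrow> emeasure nu E < top"
  using emeasure_mono[of E "hbox a h" nu] \<sigma>_finite[of a h] by (auto simp: emeasure_nu less_top)

lemma nu_mono: "E \<subseteq> F \<Longrightarrow> F \<subseteq> hbox a h \<Longrightarrow> E \<in> sets borel \<Longrightarrow> F \<in> sets borel \<Longrightarrow> measure nu E \<le> measure nu F"
  by (intro measure_mono_fmeasurable) (auto simp: fmeasurable_def nu_finite)

lemma lborel_finite: "E \<subseteq> hbox (a :: real^'n) h \<Longrightarrow> 0 < h \<Longrightarrow> emeasure lborel E < top"
  using emeasure_mono[of E "hbox a h" lborel] by (auto simp: emeasure_hbox intro: le_less_trans)

lemma measure_children:
  assumes h: "0 < h" and E: "\<And>s. s \<in> corners \<Longrightarrow> E s \<subseteq> hbox (a + (h / 2) *\<^sub>R s) (h / 2)"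
    and borel: "\<And>s. s \<in> corners \<Longrightarrow> E s \<in> sets borel"
  shows "measure nu (\<Union>s\<in>corners. E s) = (\<Sum>s\<in>corners. measure nu (E s))"
    and "measure lborel (\<Union>s\<in>corners. E s) = (\<Sum>s\<in>corners. measure lborel (E s))"
proof -
  have dj: "disjoint_family_on E corners"
    using disjoint_children[OF h, of a] E unfolding disjoint_family_on_def by blast
  show "measure nu (\<Union>s\<in>corners. E s) = (\<Sum>s\<in>corners. measure nu (E s))"
    using borel nu_finite[OF E] by (intro measure_finite_Union finite_corners dj) (auto simp: less_top)
  show "measure lborel (\<Union>s\<in>corners. E s) = (\<Sum>s\<in>corners. measure lborel (E s))"
    using borel lborel_finite[OF E] h by (intro measure_finite_Union finite_corners dj) (auto simp: less_top)
qed

lemma nu_children: "0 < h \<Longrightarrow> measure nu (hbox a h) = (\<Sum>s\<in>corners. measure nu (hbox (a + (h / 2) *\<^sub>R s) (h / 2)))"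
  using measure_children(1)[of h "\<lambda>s. hbox (a + (h / 2) *\<^sub>R s) (h / 2)" a]
  by (simp add: hbox_children[symmetric])

lemma vol_children:
  fixes h :: real
  assumes "0 < h"
  shows "h ^ CARD('n) = (\<Sum>s\<in>(corners :: (real^'n) set). (h / 2) ^ CARD('n))"
proof -
  have "h ^ CARD('n) = measure lborel (\<Union>s\<in>corners. hbox (0 + (h / 2) *\<^sub>R (s :: real^'n)) (h / 2))"
    using assms by (subst hbox_children[symmetric]) (simp_all add: measure_hbox)
  also have "\<dots> = (\<Sum>s\<in>(corners :: (real^'n) set). (h / 2) ^ CARD('n))"
    using assms by (subst measure_children(2)[of h _ 0]) (simp_all add: measure_hbox)
  finally show ?thesis .
qed

definition av :: "real^'n \<Rightarrow> real \<Rightarrow> real" where "av a h = measure nu (hbox a h) / h ^ CARD('n)"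

lemma av_nonneg: "0 < h \<Longrightarrow> 0 \<le> av a h" by (simp add: av_def)

text \<open>The integral of the \<open>e\<close>-th power of the average of \<open>\<sigma>\<close> over the dyadic cubes of the \<open>k\<close>-th
  generation.\<close>

fun G :: "real \<Rightarrow> nat \<Rightarrow> real^'n \<Rightarrow> real \<Rightarrow> real" where
  "G e 0 a h = h ^ CARD('n) * av a h powr e"
| "G e (Suc k) a h = (\<Sum>s\<in>corners. G e k (a + (h / 2) *\<^sub>R s) (h / 2))"

text \<open>The union of the maximal dyadic cubes, up to the \<open>k\<close>-th generation, on which the average of
  \<open>\<sigma>\<close> exceeds \<open>l\<close>.\<close>

fun stopped :: "real \<Rightarrow> nat \<Rightarrow> real^'n \<Rightarrow> real \<Rightarrow> (real^'n) set" where
  "stopped l 0 a h = (if l < av a h then hbox a h else {})"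
| "stopped l (Suc k) a h = (if l < av a h then hbox a h
     else (\<Union>s\<in>corners. stopped l k (a + (h / 2) *\<^sub>R s) (h / 2)))"

lemma stopped_subset: "0 < h \<Longrightarrow> stopped l k a h \<subseteq> hbox a h"
proof (induction k arbitrary: a h)
  case (Suc k)
  have "stopped l k (a + (h / 2) *\<^sub>R s) (h / 2) \<subseteq> hbox a h" if "s \<in> corners" for s
    using Suc.IH[of "h / 2" "a + (h / 2) *\<^sub>R s"] hbox_subset_child[OF that Suc.prems, of a] Suc.prems by auto
  then show ?case by auto
qed auto

lemma stopped_borel [measurable, simp]: "stopped l k a h \<in> sets borel"
  by (induction k arbitrary: a h) (auto intro!: sets.finite_UN finite_corners)

lemma measure_stopped_children:
  assumes "0 < h"
  shows "measure nu (\<Union>s\<in>corners. stopped l k (a + (h / 2) *\<^sub>R s) (h / 2)) = (\<Sum>s\<in>corners. measure nu (stopped l k (a + (h / 2) *\<^sub>R s) (h / 2)))"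
    "measure lborel (\<Union>s\<in>corners. stopped l k (a + (h / 2) *\<^sub>R s) (h / 2)) = (\<Sum>s\<in>corners. measure lborel (stopped l k (a + (h / 2) *\<^sub>R s) (h / 2)))"
  using assms by (auto intro!: measure_children[where a=a and h=h] stopped_subset)

text \<open>Chebyshev's inequality: each stopped cube has mass at least \<open>l\<close> times its
  volume, and the stopped cubes are disjoint.\<close>

lemma vol_stopped: "0 < h \<Longrightarrow> l * measure lborel (stopped l k a h) \<le> measure nu (hbox a h)"
proof (induction k arbitrary: a h)
  case 0
  then show ?case by (auto simp: av_def measure_hbox field_simps)
next
  case (Suc k)
  show ?case
  proof (cases "l < av a h")
    case True
    then show ?thesis using Suc.prems by (auto simp: av_def measure_hbox field_simps)
  next
    case False
    then show ?thesis using Suc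
      by (simp add: measure_stopped_children nu_children[of h a] sum_distrib_left sum_mono)
  qed
qed

lemma av_child: "0 < h \<Longrightarrow> s \<in> corners \<Longrightarrow> av (a + (h / 2) *\<^sub>R s) (h / 2) \<le> 2 ^ CARD('n) * av a h"
  using nu_mono[OF hbox_subset_child order.refl, of s h a]
  by (simp add: av_def power_divide field_simps)

text \<open>The cubes of generation \<open>k\<close> either lie in a stopped cube or have average at
  most \<open>l\<close>. The latter contribute at most \<open>l powr e\<close> times their volume.
  On a stopped cube \<open>H\<close> bounds \<open>G\<close> by volume times
  \<open>av powr e\<close>, that is mass times \<open>av powr (e - 1)\<close>, and the average there
  is at most \<open>2 ^ CARD('n) * l\<close> because the parent was not stopped. For the top cube
  this last fact is a hypothesis.\<close>

lemma G_stopped: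
  assumes C: "0 \<le> C" and e: "1 < e" and l: "0 \<le> l"
    and H: "\<And>j a h. j \<le> k \<Longrightarrow> 0 < h \<Longrightarrow> G e j a h \<le> C * (h ^ CARD('n) * av a h powr e)"
  shows "0 < h \<Longrightarrow> av a h \<le> 2 ^ CARD('n) * l \<Longrightarrow>
    G e k a h \<le> C * (2 ^ CARD('n) * l) powr (e - 1) * measure nu (stopped l k a h) + l powr e * h ^ CARD('n)"
  using H
proof (induction k arbitrary: a h)
  case (0 a h)
  note stop = 0
  show ?case
  proof (cases "l < av a h")
    case True
    have "G e 0 a h \<le> C * (h ^ CARD('n) * av a h powr e)" using 0 by blast
    also have "av a h powr e = av a h powr (e - 1) * av a h"
      using True l by (simp add: powr_mult_base[symmetric] powr_diff)
    also have "C * (h ^ CARD('n) * (av a h powr (e - 1) * av a h)) = C * av a h powr (e - 1) * measure nu (hbox a h)"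
      using 0 by (simp add: av_def)
    also have "\<dots> \<le> C * (2 ^ CARD('n) * l) powr (e - 1) * measure nu (hbox a h)"
      using 0 C e av_nonneg[of h a] by (intro mult_right_mono mult_left_mono powr_mono2) auto
    also have "\<dots> \<le> C * (2 ^ CARD('n) * l) powr (e - 1) * measure nu (hbox a h) + l powr e * h ^ CARD('n)"
      using 0 by simp
    finally show ?thesis using True by simp
  next
    case False
    then have "av a h powr e \<le> l powr e" using e av_nonneg[of h a] 0 by (intro powr_mono2) auto
    then show ?thesis using False 0 by (simp add: mult.commute mult_right_mono)
  qed
next
  case (Suc k a h)
  show ?case
  proof (cases "l < av a h")
    case True
    have "G e (Suc k) a h \<le> C * (h ^ CARD('n) * av a h powr e)" using Suc.prems by blast
    also have "av a h powr e = av a h powr (e - 1) * av a h"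
      using True l by (simp add: powr_mult_base[symmetric] powr_diff)
    also have "C * (h ^ CARD('n) * (av a h powr (e - 1) * av a h)) = C * av a h powr (e - 1) * measure nu (hbox a h)"
      using Suc.prems by (simp add: av_def)
    also have "\<dots> \<le> C * (2 ^ CARD('n) * l) powr (e - 1) * measure nu (hbox a h)"
      using Suc.prems C e av_nonneg[of h a] by (intro mult_right_mono mult_left_mono powr_mono2) auto
    also have "\<dots> \<le> C * (2 ^ CARD('n) * l) powr (e - 1) * measure nu (hbox a h) + l powr e * h ^ CARD('n)"
      using Suc.prems by simp
    finally show ?thesis using True by simp
  next
    case False
    have "G e (Suc k) a h = (\<Sum>s\<in>corners. G e k (a + (h / 2) *\<^sub>R s) (h / 2))" by simp
    also have "\<dots> \<le> (\<Sum>s\<in>corners. C * (2 ^ CARD('n) * l) powr (e - 1) * measure nu (stopped l k (a + (h / 2) *\<^sub>R s) (h / 2)) + l powr e * (h / 2) ^ CARD('n))"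
    proof (intro sum_mono Suc.IH)
      fix s :: "real^'n" assume s: "s \<in> corners"
      show "av (a + (h / 2) *\<^sub>R s) (h / 2) \<le> 2 ^ CARD('n) * l"
        using av_child[OF Suc.prems(1) s, of a] False by (smt (verit) mult_left_mono zero_le_power)
    qed (use Suc.prems in auto)
    also have "\<dots> = C * (2 ^ CARD('n) * l) powr (e - 1) * measure nu (stopped l (Suc k) a h) + l powr e * h ^ CARD('n)"
      using False Suc.prems
      by (simp only: stopped.simps if_False sum.distrib sum_distrib_left[symmetric] measure_stopped_children vol_children[symmetric])
    finally show ?thesis .
  qed
qed

text \<open>The largest share of the mass left for a set of at most half the volume, once its
  complement has taken what the A-infinity condition grants it.\<close>

definition \<beta> :: real where "\<beta> = 1 - (1 / 2) powr d / K"

lemma \<beta>: "0 \<le> \<beta>" "\<beta> < 1"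
proof -
  have "(1 / 2) powr d \<le> (1::real)" using d by (intro powr_le1) auto
  then show "0 \<le> \<beta>" using K by (simp add: \<beta>_def divide_simps)
  show "\<beta> < 1" using K by (simp add: \<beta>_def)
qed

text \<open>At the level of twice the average, Chebyshev's inequality leaves the stopped set at most
  half of the volume, so the A-infinity condition applies to its complement. A vanishing average is
  treated apart because the argument divides by it.\<close>

lemma nu_stopped:
  assumes h: "0 < h"
  shows "measure nu (stopped (2 * av a h) k a h) \<le> \<beta> * measure nu (hbox a h)"
proof (cases "av a h = 0")
  case True
  then have "measure nu (hbox a h) = 0" using h by (simp add: av_def)
  moreover have "measure nu (stopped (2 * av a h) k a h) \<le> measure nu (hbox a h)"
    by (intro nu_mono stopped_subset h order.refl) auto
  ultimately show ?thesis by (simp add: order_antisym)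
next
  case False
  then have av: "0 < av a h" using av_nonneg[OF h, of a] by simp
  let ?O = "stopped (2 * av a h) k a h"
  let ?F = "hbox a h - ?O"
  have sub: "?O \<subseteq> hbox a h" by (intro stopped_subset h)
  have "2 * av a h * measure lborel ?O \<le> measure nu (hbox a h)" by (rule vol_stopped[OF h])
  then have "2 * av a h * measure lborel ?O \<le> av a h * h ^ CARD('n)" using h by (simp add: av_def)
  then have O: "measure lborel ?O \<le> h ^ CARD('n) / 2" using av by simp
  have "measure lborel ?F = measure lborel (hbox a h) - measure lborel ?O"
    using lborel_finite[OF order.refl h, of a] sub by (intro measure_Diff) auto
  then have "1 / 2 \<le> measure lborel ?F / h ^ CARD('n)"
    using O h by (simp add: measure_hbox field_simps)
  then have "(1 / 2) powr d \<le> (measure lborel ?F / h ^ CARD('n)) powr d"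
    using d by (intro powr_mono2) auto
  then have "(1 / 2) powr d * measure nu (hbox a h) \<le> (measure lborel ?F / h ^ CARD('n)) powr d * measure nu (hbox a h)"
    by (intro mult_right_mono) auto
  also have "\<dots> \<le> K * measure nu ?F"
    unfolding nu_def by (intro A_infinity h) auto
  also have "measure nu ?F = measure nu (hbox a h) - measure nu ?O"
    using nu_finite[OF order.refl, of a h] sub by (intro measure_Diff) auto
  finally show ?thesis using K by (simp add: \<beta>_def field_simps)
qed

text \<open>Strong induction with stopping at twice the average. By induction the stopped cubes
  contribute at most \<open>C * b\<close> times the target, because they carry only the share
  \<open>\<beta>\<close> of the mass and \<open>e\<close> is close to 1; the other cubes contribute
  at most \<open>2 powr e\<close>. The constant \<open>C = 2 powr e / (1 - b)\<close> is the
  solution of \<open>C * b + 2 powr e = C\<close>.\<close>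

lemma G_bound:
  assumes e: "1 < e" and eps: "(2 ^ CARD('n) * 2) powr (e - 1) * \<beta> \<le> b" "b < 1"
    and h: "0 < h"
  shows "G e k a h \<le> (2 powr e / (1 - b)) * (h ^ CARD('n) * av a h powr e)"
  using h
proof (induction k arbitrary: a h rule: less_induct)
  case (less k)
  define C where "C = 2 powr e / (1 - b)"
  have b: "0 \<le> b" using eps(1) \<beta>(1) by (meson mult_nonneg_nonneg order_trans powr_ge_zero)
  have "1 \<le> 2 powr e" using e by (simp add: ge_one_powr_ge_zero)
  then have C: "1 \<le> C" using b eps(2) by (simp add: C_def le_divide_eq)
  have Cb: "C * b + 2 powr e = C" using eps(2) by (simp add: C_def field_simps)
  show ?case unfolding C_def[symmetric]
  proof (cases k)
    case 0
    have "0 \<le> h ^ CARD('n) * av a h powr e" using less.prems by simp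
    then show "G e k a h \<le> C * (h ^ CARD('n) * av a h powr e)"
      using C mult_right_mono[OF C] by (simp add: 0)
  next
    case (Suc j)
    note h = less.prems
    define l where "l = 2 * av a h"
    \<comment> \<open>The top cube itself is not stopped, so the induction hypothesis is needed only
      for the fewer generations below its children.\<close>
    have l: "0 \<le> l" "\<not> l < av a h" using av_nonneg[OF h, of a] by (auto simp: l_def)
    have "G e k a h = (\<Sum>s\<in>corners. G e j (a + (h / 2) *\<^sub>R s) (h / 2))" by (simp add: Suc)
    also have "\<dots> \<le> (\<Sum>s\<in>corners. C * (2 ^ CARD('n) * l) powr (e - 1) * measure nu (stopped l j (a + (h / 2) *\<^sub>R s) (h / 2)) + l powr e * (h / 2) ^ CARD('n))"
    proof (intro sum_mono G_stopped)
      fix s :: "real^'n" assume s: "s \<in> corners"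
      show "av (a + (h / 2) *\<^sub>R s) (h / 2) \<le> 2 ^ CARD('n) * l"
        using av_child[OF h s, of a] l by (smt (verit) mult_left_mono zero_le_power)
    next
      fix i :: nat and a' :: "real^'n" and h' :: real assume "i \<le> j" "0 < h'"
      then show "G e i a' h' \<le> C * (h' ^ CARD('n) * av a' h' powr e)"
        using less.IH[of i h' a'] Suc by (simp add: C_def)
    qed (use h C e l in auto)
    also have "\<dots> = C * (2 ^ CARD('n) * l) powr (e - 1) * measure nu (stopped l k a h) + l powr e * h ^ CARD('n)"
      using l h
      by (simp only: Suc stopped.simps if_False sum.distrib sum_distrib_left[symmetric] measure_stopped_children vol_children[symmetric])
    also have "\<dots> \<le> C * (2 ^ CARD('n) * l) powr (e - 1) * (\<beta> * measure nu (hbox a h)) + l powr e * h ^ CARD('n)"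
      using nu_stopped[OF h, of a k] C by (intro add_right_mono mult_left_mono) (auto simp: l_def)
    also have "measure nu (hbox a h) = h ^ CARD('n) * av a h" using h by (simp add: av_def)
    also have "C * (2 ^ CARD('n) * l) powr (e - 1) * (\<beta> * (h ^ CARD('n) * av a h)) + l powr e * h ^ CARD('n)
      = (C * ((2 ^ CARD('n) * 2) powr (e - 1) * \<beta>) + 2 powr e) * (h ^ CARD('n) * av a h powr e)"
    proof -
      have "(2 ^ CARD('n) * l) powr (e - 1) * av a h = (2 ^ CARD('n) * 2) powr (e - 1) * av a h powr e"
      proof (cases "av a h = 0")
        case False
        then have "av a h powr (e - 1) * av a h = av a h powr e"
          using av_nonneg[OF h, of a] by (simp add: powr_diff)
        moreover have "(2 ^ CARD('n) * l) powr (e - 1) = (2 ^ CARD('n) * 2) powr (e - 1) * av a h powr (e - 1)"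
          using av_nonneg[OF h, of a] by (simp add: l_def powr_mult[symmetric] mult.assoc)
        ultimately show ?thesis by simp
      qed (simp add: l_def)
      moreover have "l powr e = 2 powr e * av a h powr e"
        using av_nonneg[OF h, of a] by (simp add: l_def powr_mult)
      ultimately show ?thesis by (simp add: algebra_simps)
    qed
    also have "\<dots> \<le> (C * b + 2 powr e) * (h ^ CARD('n) * av a h powr e)"
      using eps C h by (intro mult_right_mono add_right_mono mult_left_mono) auto
    finally show "G e k a h \<le> C * (h ^ CARD('n) * av a h powr e)" by (simp add: Cb)
  qed
qed

section \<open>Doubling and passage from dyadic averages to the weight\<close>

definition D :: real where "D = K * (2 ^ CARD('n)) powr d"

lemma D_pos: "0 < D" using K by (simp add: D_def)

text \<open>The A-infinity condition for the corner cube, which fills the fraction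
  \<open>1 / 2 ^ CARD('n)\<close> of the double one.\<close>

lemma nu_double:
  assumes h: "0 < h" shows "measure nu (hbox a (2 * h)) \<le> D * measure nu (hbox a h)"
proof -
  have "(measure lborel (hbox a h) / (2 * h) ^ CARD('n)) powr d * measure nu (hbox a (2 * h)) \<le> K * measure nu (hbox a h)"
    unfolding nu_def using h by (intro A_infinity) (auto simp: hbox_def, smt (verit))
  moreover have "measure lborel (hbox a h) / (2 * h) ^ CARD('n) = 1 / 2 ^ CARD('n)"
    using h by (simp add: measure_hbox power_mult_distrib)
  ultimately have "(1 / 2 ^ CARD('n)) powr d * measure nu (hbox a (2 * h)) \<le> K * measure nu (hbox a h)"
    by (simp only:)
  then show ?thesis by (simp add: powr_divide D_def field_simps)
qed

text \<open>Averages over cubes with lower corner \<open>x\<close> are the ones in the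
  differentiation theorem used below; doubling compares them with the dyadic averages that occur in
  \<open>G\<close>.\<close>

definition corner_av :: "real \<Rightarrow> real^'n \<Rightarrow> real" where
  "corner_av h x = measure nu (cbox x (x + (\<chi> i. h))) / h ^ CARD('n)"

lemma scaleR_One: "h *\<^sub>R One = ((\<chi> i. h) :: real^'n)"
proof -
  have "One = ((\<chi> i. 1) :: real^'n)"
  proof (rule euclidean_eqI)
    fix b :: "real^'n" assume b: "b \<in> Basis"
    then obtain i where "b = axis i 1" by (auto simp: Basis_vec_def)
    then show "One \<bullet> b = (\<chi> i. 1) \<bullet> b"
      using inner_sum_Basis[OF b] by (simp only: inner_axis) simp
  qed
  then show ?thesis by (simp only:) (simp add: vec_eq_iff)
qed

lemma corner_av_le:
  assumes h: "0 < h" and x: "x \<in> hbox a h" shows "corner_av h x \<le> D * av a h"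
proof -
  have "cbox x (x + (\<chi> i. h)) \<subseteq> hbox a (2 * h)"
    using x by (auto simp: hbox_def mem_box_cart) (smt (verit))+
  then have "measure nu (cbox x (x + (\<chi> i. h))) \<le> measure nu (hbox a (2 * h))"
    by (intro nu_mono) auto
  also note nu_double[OF h]
  finally show ?thesis using h by (simp add: corner_av_def av_def divide_right_mono)
qed

lemma corner_av_measurable [measurable]: "corner_av h \<in> borel_measurable borel"
proof -
  have "{xy :: (real^'n) \<times> (real^'n). snd xy \<in> cbox (fst xy) (fst xy + (\<chi> i. h))}
      = (\<Inter>i\<in>UNIV. {xy. fst xy $ i \<le> snd xy $ i} \<inter> {xy. snd xy $ i \<le> fst xy $ i + h})"
    by (auto simp: mem_box_cart)
  also have "\<dots> \<in> sets borel"
    by (intro sets.finite_INT sets.Int borel_closed closed_Collect_le continuous_intros) auto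
  finally have "{xy :: (real^'n) \<times> (real^'n). snd xy \<in> cbox (fst xy) (fst xy + (\<chi> i. h))} \<in> sets (borel \<Otimes>\<^sub>M borel)"
    by (subst borel_prod)
  then have [measurable]: "(\<lambda>(x :: real^'n, y). indicator (cbox x (x + (\<chi> i. h))) y :: ennreal) \<in> borel_measurable (borel \<Otimes>\<^sub>M borel)"
    by (auto simp: case_prod_beta' space_pair_measure intro!: borel_measurable_indicator')
  have "corner_av h = (\<lambda>x. enn2real (\<integral>\<^sup>+y. ennreal (\<sigma> y) * indicator (cbox x (x + (\<chi> i. h))) y \<partial>lborel) / h ^ CARD('n))"
    by (simp add: fun_eq_iff corner_av_def measure_def emeasure_nu borel_closed)
  also have "\<dots> \<in> borel_measurable borel" by measurable
  finally show ?thesis .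
qed

text \<open>On each dyadic cube of generation \<open>k\<close> the corner average at the same scale
  is at most \<open>D\<close> times the dyadic average; \<open>G\<close> adds these contributions
  up.\<close>

lemma nn_integral_corner_av:
  assumes e: "1 < e"
  shows "0 < h \<Longrightarrow> (\<integral>\<^sup>+x\<in>hbox a h. ennreal (corner_av (h / 2 ^ k) x powr e) \<partial>lborel) \<le> ennreal (D powr e * G e k a h)"
proof (induction k arbitrary: a h)
  case 0
  have "(\<integral>\<^sup>+x\<in>hbox a h. ennreal (corner_av (h / 2 ^ 0) x powr e) \<partial>lborel)
     \<le> (\<integral>\<^sup>+x. ennreal ((D * av a h) powr e) * indicator (hbox a h) x \<partial>lborel)"
  proof (intro nn_integral_mono)
    fix x
    have "0 \<le> corner_av h x" using 0 by (simp add: corner_av_def)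
    then show "ennreal (corner_av (h / 2 ^ 0) x powr e) * indicator (hbox a h) x \<le> ennreal ((D * av a h) powr e) * indicator (hbox a h) x"
      using corner_av_le[of h x a] 0 e by (auto simp: indicator_def intro!: ennreal_leI powr_mono2)
  qed
  also have "\<dots> = ennreal ((D * av a h) powr e) * ennreal (h ^ CARD('n))"
    using 0 by (simp add: nn_integral_cmult emeasure_hbox)
  also have "\<dots> = ennreal (D powr e * G e 0 a h)"
    using D_pos av_nonneg[OF 0, of a] 0 by (simp add: ennreal_mult[symmetric] powr_mult mult_ac)
  finally show ?case .
next
  case (Suc k)
  have "(\<integral>\<^sup>+x\<in>hbox a h. ennreal (corner_av (h / 2 ^ Suc k) x powr e) \<partial>lborel)
     = (\<integral>\<^sup>+x. (\<Sum>s\<in>corners. ennreal (corner_av (h / 2 / 2 ^ k) x powr e) * indicator (hbox (a + (h / 2) *\<^sub>R s) (h / 2)) x) \<partial>lborel)"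
  proof (intro nn_integral_cong)
    fix x
    have "indicator (hbox a h) x = (\<Sum>s\<in>corners. indicator (hbox (a + (h / 2) *\<^sub>R s) (h / 2)) x :: ennreal)"
      unfolding hbox_children[OF Suc.prems, of a]
      by (rule indicator_UN_disjoint[OF finite_corners disjoint_children[OF Suc.prems]])
    then show "ennreal (corner_av (h / 2 ^ Suc k) x powr e) * indicator (hbox a h) x
      = (\<Sum>s\<in>corners. ennreal (corner_av (h / 2 / 2 ^ k) x powr e) * indicator (hbox (a + (h / 2) *\<^sub>R s) (h / 2)) x)"
      by (simp add: sum_distrib_left)
  qed
  also have "\<dots> = (\<Sum>s\<in>corners. \<integral>\<^sup>+x\<in>hbox (a + (h / 2) *\<^sub>R s) (h / 2). ennreal (corner_av (h / 2 / 2 ^ k) x powr e) \<partial>lborel)"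
    by (rule nn_integral_sum) measurable
  also have "\<dots> \<le> (\<Sum>s\<in>corners. ennreal (D powr e * G e k (a + (h / 2) *\<^sub>R s) (h / 2)))"
    using Suc.prems by (intro sum_mono Suc.IH) simp
  also have "\<dots> = ennreal (\<Sum>s\<in>corners. D powr e * G e k (a + (h / 2) *\<^sub>R s) (h / 2))"
  proof (rule sum_ennreal)
    have "0 \<le> G e k b l" if "0 < l" for b l
      using that by (induction k arbitrary: b l) (auto intro!: sum_nonneg)
    then show "0 \<le> D powr e * G e k (a + (h / 2) *\<^sub>R s) (h / 2)" for s
      using Suc.prems by simp
  qed
  finally show ?case by (simp add: sum_distrib_left)
qed

lemma cbox_subset_hbox: "cbox a b \<subseteq> hbox a (1 + (\<Sum>i\<in>UNIV. \<bar>b $ i - a $ i\<bar>))"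
proof
  fix x assume x: "x \<in> cbox a b"
  have "\<bar>b $ i - a $ i\<bar> \<le> (\<Sum>i\<in>UNIV. \<bar>b $ i - a $ i\<bar>)" for i
    by (rule member_le_sum) auto
  then show "x \<in> hbox a (1 + (\<Sum>i\<in>UNIV. \<bar>b $ i - a $ i\<bar>))"
    using x unfolding hbox_def mem_box_cart mem_Collect_eq by (smt (verit))
qed

lemma has_integral_nu: "(\<sigma> has_integral measure nu (cbox a b)) (cbox a b)"
proof -
  have "((\<lambda>x. if x \<in> cbox a b then \<sigma> x else 0) has_integral measure nu (cbox a b)) UNIV"
  proof (rule nn_integral_has_integral)
    have "(\<integral>\<^sup>+x. ennreal (if x \<in> cbox a b then \<sigma> x else 0) \<partial>lborel) = emeasure nu (cbox a b)"
      unfolding emeasure_nu[OF borel_closed[OF closed_cbox]]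
      by (intro nn_integral_cong) (auto simp: indicator_def)
    also have "\<dots> = ennreal (measure nu (cbox a b))"
      using nu_finite[OF cbox_subset_hbox, of a b] by (simp add: emeasure_eq_ennreal_measure less_top)
    finally show "(\<integral>\<^sup>+x. ennreal (if x \<in> cbox a b then \<sigma> x else 0) \<partial>lborel) = ennreal (measure nu (cbox a b))" .
  qed (use \<sigma>_pos in \<open>auto simp: less_imp_le\<close>)
  then show ?thesis by (simp add: has_integral_restrict_UNIV)
qed

text \<open>Lebesgue's differentiation theorem in its one-sided version for cubes with a corner at
  the point, applied along the scales \<open>h / 2 ^ k\<close>.\<close>

lemma corner_av_tendsto: "AE x in lborel. ((\<lambda>k. corner_av (h / 2 ^ k) x) \<longlongrightarrow> \<sigma> x) sequentially" if h: "0 < h"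
proof -
  obtain N where N: "negligible N"
    "\<And>x e. \<lbrakk>x \<notin> N; 0 < e\<rbrakk> \<Longrightarrow> \<exists>d>0. \<forall>h. 0 < h \<and> h < d \<longrightarrow>
      norm (integral (cbox x (x + h *\<^sub>R One)) \<sigma> /\<^sub>R h ^ DIM(real^'n) - \<sigma> x) < e"
    by (rule integrable_ccontinuous_explicit[of \<sigma>]) (use has_integral_nu in blast)+
  have "AE x in lebesgue. x \<notin> N"
    using N(1) by (intro AE_not_in) (simp add: negligible_iff_null_sets)
  then have "AE x in lebesgue. ((\<lambda>k. corner_av (h / 2 ^ k) x) \<longlongrightarrow> \<sigma> x) sequentially"
  proof eventually_elim
    case (elim x)
    show ?case
    proof (rule tendstoI)
      fix e :: real assume "0 < e"
      from N(2)[OF elim this] obtain d where d: "0 < d"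
        "\<And>h. 0 < h \<Longrightarrow> h < d \<Longrightarrow> norm (integral (cbox x (x + h *\<^sub>R One)) \<sigma> /\<^sub>R h ^ DIM(real^'n) - \<sigma> x) < e"
        by blast
      have "((\<lambda>k. h / 2 ^ k) \<longlongrightarrow> 0) sequentially"
        by (rule LIMSEQ_divide_realpow_zero) simp
      then have "eventually (\<lambda>k. h / 2 ^ k < d) sequentially"
        using d(1) by (rule order_tendstoD)
      then show "eventually (\<lambda>k. dist (corner_av (h / 2 ^ k) x) (\<sigma> x) < e) sequentially"
      proof eventually_elim
        case (elim k)
        then show ?case
          using d(2)[of "h / 2 ^ k"] h integral_unique[OF has_integral_nu]
          by (simp add: corner_av_def dist_real_def scaleR_One divide_inverse mult.commute)
      qed
    qed
  qed
  then show ?thesis by (simp add: AE_completion_iff)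
qed

text \<open>The bound for \<open>G\<close> does not depend on the generation, so Fatou's lemma
  carries it from the corner averages to their limit \<open>\<sigma>\<close>.\<close>

theorem reverse_Hoelder:
  assumes e: "1 < e" and eps: "(2 ^ CARD('n) * 2) powr (e - 1) * \<beta> \<le> b" "b < 1"
    and h: "0 < h"
  shows "(\<integral>\<^sup>+x\<in>hbox a h. ennreal (\<sigma> x powr e) \<partial>lborel)
    \<le> ennreal (D powr e * (2 powr e / (1 - b)) * (h ^ CARD('n) * av a h powr e))"
proof -
  let ?f = "\<lambda>k x. ennreal (corner_av (h / 2 ^ k) x powr e) * indicator (hbox a h) x"
  have "(\<integral>\<^sup>+x\<in>hbox a h. ennreal (\<sigma> x powr e) \<partial>lborel) = (\<integral>\<^sup>+x. liminf (\<lambda>k. ?f k x) \<partial>lborel)"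
  proof (rule nn_integral_cong_AE)
    show "AE x in lborel. ennreal (\<sigma> x powr e) * indicator (hbox a h) x = liminf (\<lambda>k. ?f k x)"
      using corner_av_tendsto[OF h]
    proof eventually_elim
      case (elim x)
      have "((\<lambda>k. corner_av (h / 2 ^ k) x powr e) \<longlongrightarrow> \<sigma> x powr e) sequentially"
        using \<sigma>_pos[of x] by (intro tendsto_powr elim tendsto_const) simp
      then have "((\<lambda>k. ?f k x) \<longlongrightarrow> ennreal (\<sigma> x powr e) * indicator (hbox a h) x) sequentially"
        by (cases "x \<in> hbox a h") (auto intro!: tendsto_ennrealI)
      then show ?case
        by (simp add: lim_imp_Liminf)
    qed
  qed
  also have "\<dots> \<le> liminf (\<lambda>k. \<integral>\<^sup>+x. ?f k x \<partial>lborel)"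
    by (rule nn_integral_liminf) measurable
  also have "\<dots> \<le> liminf (\<lambda>k. ennreal (D powr e * (2 powr e / (1 - b)) * (h ^ CARD('n) * av a h powr e)))"
  proof (intro Liminf_mono always_eventually allI)
    fix k
    have "D powr e * G e k a h \<le> D powr e * ((2 powr e / (1 - b)) * (h ^ CARD('n) * av a h powr e))"
      by (intro mult_left_mono G_bound assms) auto
    then show "(\<integral>\<^sup>+x. ?f k x \<partial>lborel) \<le> ennreal (D powr e * (2 powr e / (1 - b)) * (h ^ CARD('n) * av a h powr e))"
      using nn_integral_corner_av[OF e h, where a = a and k = k] by (auto simp: mult_ac intro: order_trans ennreal_leI)
  qed
  finally show ?thesis by (simp add: Liminf_const)
qed

end

section \<open>Openness of the Muckenhoupt condition\<close>

lemma nn_integral_hbox_cube: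
  "(\<integral>\<^sup>+x\<in>hbox a h. f x \<partial>lborel) = (\<integral>\<^sup>+x\<in>cube (a + (\<chi> i. h / 2)) (h / 2). f x \<partial>lborel)"
  by (rule nn_integral_cong_AE)
    (use hbox_eq_cube[of a h] in \<open>eventually_elim, auto simp: indicator_def\<close>)

text \<open>The condition is symmetric under exchanging \<open>m\<close> with \<open>1 / m\<close>
  and \<open>p\<close> with its conjugate exponent, so results for \<open>m\<close> also serve the
  dual weight.\<close>

lemma Apq_dual:
  assumes A: "Apq m p p B" and p: "1 < p" and m: "\<And>x. 0 < m x"
  shows "Apq (\<lambda>x. 1 / m x) (p / (p - 1)) (p / (p - 1)) B"
proof -
  define p' where "p' = p / (p - 1)"
  have p': "1 / p' = (p - 1) / p" "(p' - 1) / p' = 1 / p" "p' / (p' - 1) = p"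
    using p by (auto simp: p'_def field_simps)
  have 1: "(1 / m x) powr p' = m x powr - p'" "(1 / m x) powr - p = m x powr p" for x
    using m[of x] by (auto simp: powr_divide powr_minus inverse_eq_divide)
  show ?thesis
    using A unfolding Apq_def p'_def[symmetric] p' 1
    by (auto simp: add.commute mult.commute)
qed

text \<open>\<open>single_cube_estimate\<close> for the dual weight with \<open>g = 1\<close> and
  \<open>S = F\<close> bounds the mass of the cube, times the power of the volume fraction of
  \<open>F\<close>, by the mass of \<open>F\<close>. The maximum with 1 provides the locale
  assumption \<open>1 \<le> K\<close>.\<close>

lemma A_infinity_weight_dual:
  fixes m :: "real^'n \<Rightarrow> real"
  assumes A: "Apq m p p B" and p: "1 < p" and m: "\<And>x. 0 < m x"
    and [measurable]: "m \<in> borel_measurable borel" and B: "0 \<le> B"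
  shows "A_infinity_weight (\<lambda>x. m x powr - (p / (p - 1))) (p / (p - 1)) (max 1 (B powr (p / (p - 1))))"
proof
  define p' where "p' = p / (p - 1)"
  have p': "1 < p'" using p by (simp add: p'_def)
  have fin: "(\<integral>\<^sup>+x\<in>hbox a h. ennreal (m x powr - p') \<partial>lborel) < top" if "0 < h" for a h
    unfolding nn_integral_hbox_cube p'_def using that p by (intro Apq_finite[OF A _ m]) auto
  show "(\<integral>\<^sup>+x\<in>hbox a h. ennreal (m x powr - (p / (p - 1))) \<partial>lborel) < top" for a h
  proof (cases "0 < h")
    case False
    then have "hbox a h = {}" by (auto simp: hbox_def)
    then show ?thesis by simp
  qed (use fin in \<open>simp add: p'_def\<close>)
  show "0 < m x powr - (p / (p - 1))" for x using m[of x] by simp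
  show "0 < p / (p - 1)" using p by simp
  fix a :: "real^'n" and h :: real and F :: "(real^'n) set"
  assume h: "0 < h" and F [measurable]: "F \<in> sets borel" and sub: "F \<subseteq> hbox a h"
  define N where "N = density lborel (\<lambda>x. ennreal (m x powr - p'))"
  define c where "c = a + (\<chi> i. h / 2)"
  define V where "V = h ^ CARD('n)"
  have V: "0 < V" using h by (simp add: V_def)
  have N: "emeasure N E = (\<integral>\<^sup>+x\<in>E. ennreal (m x powr - p') \<partial>lborel)" if "E \<in> sets borel" for E
    unfolding N_def using that by (subst emeasure_density) auto
  \<comment> \<open>The estimate concerns open cubes, so a null part of \<open>F\<close> on the
    lower faces is cut off.\<close>
  let ?F' = "F \<inter> cube c (h / 2)"
  have AE: "AE x in lborel. (x \<in> F) = (x \<in> ?F')"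
    using hbox_eq_cube[of a h] by eventually_elim (use sub in \<open>auto simp: c_def\<close>)
  have volF: "emeasure lborel ?F' = ennreal (measure lborel F)"
  proof -
    have "emeasure lborel ?F' = emeasure lborel F"
      by (rule emeasure_eq_AE) (use AE in \<open>auto elim: eventually_mono\<close>)
    also have "emeasure lborel F \<le> emeasure lborel (hbox a h)" by (intro emeasure_mono sub) simp
    then have "emeasure lborel F = ennreal (measure lborel F)"
      by (intro emeasure_eq_ennreal_measure) (use h in \<open>auto simp: emeasure_hbox top_unique\<close>)
    finally show ?thesis .
  qed
  have NF: "(\<integral>\<^sup>+x\<in>?F'. ennreal (m x powr - p') \<partial>lborel) = emeasure N F"
    unfolding N[OF F] by (rule nn_integral_cong_AE) (use AE in \<open>auto elim!: eventually_mono simp: indicator_def\<close>)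
  have NQ: "(\<integral>\<^sup>+x\<in>cube c (h / 2). ennreal (m x powr - p') \<partial>lborel) = emeasure N (hbox a h)"
    by (simp add: N nn_integral_hbox_cube c_def)
  have 1: "(1 / m x) powr p' = m x powr - p'" for x
    using m[of x] by (auto simp: powr_divide powr_minus inverse_eq_divide)
  have "epowr (\<integral>\<^sup>+y\<in>?F'. 1 \<partial>lborel) p' * (\<integral>\<^sup>+x\<in>cube c (h / 2). ennreal ((1 / m x) powr p') \<partial>lborel)
    \<le> ennreal (B powr p' * (2 * (h / 2)) powr (CARD('n) * (1 + p' - p' / p'))) *
       epowr (\<integral>\<^sup>+y\<in>?F'. epowr 1 p' * ennreal ((1 / m y) powr p') \<partial>lborel) (p' / p')"
    by (rule single_cube_estimate[OF Apq_dual[OF A p m, folded p'_def]])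
      (use m p' h B in auto)
  also have "(\<integral>\<^sup>+y\<in>?F'. 1 \<partial>lborel) = emeasure lborel ?F'" by simp
  finally have main: "ennreal (measure lborel F powr p') * emeasure N (hbox a h) \<le> ennreal (B powr p' * V powr p') * emeasure N F"
    using p' h by (simp add: 1 volF NF NQ epowr_ennreal V_def powr_powr powr_realpow[symmetric])
  have fin': "emeasure N E = ennreal (measure N E)" if "E \<subseteq> hbox a h" "E \<in> sets borel" for E
  proof (intro emeasure_eq_ennreal_measure)
    have "emeasure N E \<le> emeasure N (hbox a h)" by (intro emeasure_mono that) (simp add: N_def)
    then show "emeasure N E \<noteq> top" using fin[OF h, of a] by (auto simp: N top_unique)
  qed
  have "measure lborel F powr p' * measure N (hbox a h) \<le> B powr p' * V powr p' * measure N F"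
    using main fin'[of F] fin'[of "hbox a h"] sub by (simp add: ennreal_mult[symmetric])
  then have "(measure lborel F / V) powr p' * measure N (hbox a h) \<le> B powr p' * measure N F"
    using V by (simp add: powr_divide field_simps)
  also have "\<dots> \<le> max 1 (B powr p') * measure N F" by (intro mult_right_mono) auto
  finally show "(measure lborel F / h ^ CARD('n)) powr (p / (p - 1)) *
      measure (density lborel (\<lambda>x. ennreal (m x powr - (p / (p - 1))))) (hbox a h)
    \<le> max 1 (B powr (p / (p - 1))) * measure (density lborel (\<lambda>x. ennreal (m x powr - (p / (p - 1))))) F"
    unfolding N_def V_def p'_def .
qed auto

text \<open>The order of quantifiers is the point: \<open>e\<close> and \<open>C\<close> are fixed
  before the weight and depend on the dimension, \<open>p\<close> and \<open>B\<close> only.\<close>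

lemma Apq_reverse_Hoelder:
  fixes p B :: real
  assumes p: "1 < p" and B: "0 \<le> B"
  shows "\<exists>e>1. \<exists>C>0. \<forall>(m :: real^'n \<Rightarrow> real) x0 r.
      Apq m p p B \<and> m \<in> borel_measurable borel \<and> (\<forall>x. 0 < m x) \<and> 0 < r \<longrightarrow>
      epowr (\<integral>\<^sup>+x\<in>cube x0 r. ennreal (m x powr - (p / (p - 1) * e)) \<partial>lborel) (1 / e)
      \<le> ennreal (C * (2 * r) powr (CARD('n) * (1 / e - 1))) * (\<integral>\<^sup>+x\<in>cube x0 r. ennreal (m x powr - (p / (p - 1))) \<partial>lborel)"
proof -
  define p' where "p' = p / (p - 1)"
  have p': "1 < p'" using p by (simp add: p'_def)
  define K where "K = max 1 (B powr p')"
  define \<beta> where "\<beta> = 1 - (1 / 2) powr p' / K"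
  have \<beta>: "\<beta> < 1" by (simp add: \<beta>_def K_def less_max_iff_disj)
  \<comment> \<open>Any number strictly between \<open>\<beta>\<close> and 1 would do. The factor in
    front of \<open>\<beta>\<close> tends to 1 as the exponent tends to 0, so it can be chosen with
    the product still below \<open>b\<close>.\<close>
  define b where "b = (1 + \<beta>) / 2"
  have b: "\<beta> < b" "b < 1" using \<beta> by (auto simp: b_def)
  have "((\<lambda>t. (2 ^ CARD('n) * 2) powr t * \<beta>) \<longlongrightarrow> (2 ^ CARD('n) * 2) powr 0 * \<beta>) (at_right (0::real))"
    by (intro tendsto_intros) auto
  then have "eventually (\<lambda>t. (2 ^ CARD('n) * 2) powr t * \<beta> < b) (at_right (0::real))"
    using b by (intro order_tendstoD) auto
  then obtain t0 where t0: "0 < t0" "\<And>t. 0 < t \<Longrightarrow> t < t0 \<Longrightarrow> (2 ^ CARD('n) * 2) powr t * \<beta> < (b :: real)"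
    by (auto simp: eventually_at_right_field)
  define e where "e = 1 + t0 / 2"
  have e: "1 < e" "(2 ^ CARD('n) * 2) powr (e - 1) * \<beta> \<le> b"
    using t0(1) t0(2)[of "t0 / 2"] by (auto simp: e_def)
  define D where "D = K * (2 ^ CARD('n)) powr p'"
  define C where "C = (D powr e * (2 powr e / (1 - b)))"
  have C: "0 < C" using b by (simp add: C_def D_def K_def)
  show ?thesis
  proof (rule exI[of _ e], rule conjI[OF e(1)], rule exI[of _ "C powr (1 / e)"], intro conjI allI impI)
    show "0 < C powr (1 / e)" using C by simp
    fix m :: "real^'n \<Rightarrow> real" and x0 :: "real^'n" and r :: real
    assume "Apq m p p B \<and> m \<in> borel_measurable borel \<and> (\<forall>x. 0 < m x) \<and> 0 < r"
    then have A: "Apq m p p B" and mm [measurable]: "m \<in> borel_measurable borel" and m: "\<And>x. 0 < m x" and r: "0 < r"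
      by auto
    interpret W: A_infinity_weight "\<lambda>x. m x powr - p'" p' K
      using A_infinity_weight_dual[OF A p m mm B] unfolding p'_def K_def .
    have \<beta>': "W.\<beta> = \<beta>" by (simp only: W.\<beta>_def \<beta>_def)
    have D': "W.D = D" by (simp only: W.D_def D_def)
    define a where "a = x0 - (\<chi> i. r)"
    have a: "a + (\<chi> i. r) = x0" by (simp add: a_def)
    have Q: "(\<integral>\<^sup>+x\<in>hbox a (2 * r). f x \<partial>lborel) = (\<integral>\<^sup>+x\<in>cube x0 r. f x \<partial>lborel)" for f
      using nn_integral_hbox_cube[where a = a and h = "2 * r" and f = f] by (simp add: a)
    define t where "t = measure W.nu (hbox a (2 * r))"
    have t: "(\<integral>\<^sup>+x\<in>cube x0 r. ennreal (m x powr - p') \<partial>lborel) = ennreal t" "0 \<le> t"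
    proof -
      have "emeasure W.nu (hbox a (2 * r)) = ennreal t"
        unfolding t_def using W.nu_finite[OF order.refl, of a "2 * r"]
        by (intro emeasure_eq_ennreal_measure) auto
      then show "(\<integral>\<^sup>+x\<in>cube x0 r. ennreal (m x powr - p') \<partial>lborel) = ennreal t"
        by (simp add: W.emeasure_nu Q)
      show "0 \<le> t" by (simp add: t_def)
    qed
    define R where "R = 2 * r"
    have R: "0 < R" using r by (simp add: R_def)
    have "(\<integral>\<^sup>+x\<in>cube x0 r. ennreal (m x powr - (p' * e)) \<partial>lborel) = (\<integral>\<^sup>+x\<in>hbox a (2 * r). ennreal ((m x powr - p') powr e) \<partial>lborel)"
      unfolding Q by (simp add: powr_powr)
    also have "\<dots> \<le> ennreal (C * (R powr CARD('n) * (t / R powr CARD('n)) powr e))"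
      using W.reverse_Hoelder[OF e(1), of b "2 * r" a] e b r
      by (simp add: \<beta>' D' C_def W.av_def t_def R_def powr_realpow)
    finally have "epowr (\<integral>\<^sup>+x\<in>cube x0 r. ennreal (m x powr - (p' * e)) \<partial>lborel) (1 / e)
      \<le> epowr (ennreal (C * (R powr CARD('n) * (t / R powr CARD('n)) powr e))) (1 / e)"
      using e by (intro epowr_mono) auto
    also have "\<dots> = ennreal ((C * (R powr CARD('n) * (t / R powr CARD('n)) powr e)) powr (1 / e))"
      using C R by (intro epowr_ennreal) auto
    also have "(C * (R powr CARD('n) * (t / R powr CARD('n)) powr e)) powr (1 / e)
      = C powr (1 / e) * R powr (CARD('n) * (1 / e - 1)) * t"
      using C R e t(2) by (simp add: powr_mult powr_powr powr_diff right_diff_distrib)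
    finally show "epowr (\<integral>\<^sup>+x\<in>cube x0 r. ennreal (m x powr - (p / (p - 1) * e)) \<partial>lborel) (1 / e)
      \<le> ennreal (C powr (1 / e) * (2 * r) powr (CARD('n) * (1 / e - 1))) * (\<integral>\<^sup>+x\<in>cube x0 r. ennreal (m x powr - (p / (p - 1))) \<partial>lborel)"
      using t C by (simp add: p'_def[symmetric] R_def[symmetric] ennreal_mult)
  qed
qed

text \<open>For \<open>q \<ge> p0\<close> the conjugate exponent of \<open>q\<close> is at most
  \<open>p' * e\<close>. Jensen's inequality raises the dual integral to the exponent
  \<open>p' * e\<close>, the reverse Hoelder inequality brings it down to \<open>p'\<close>, and
  there the original condition applies. The powers of the side length cancel along the way.\<close>

lemma Apq_open:
  fixes p B :: real
  assumes p: "1 < p" and B: "0 \<le> B"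
  shows "\<exists>p0 B'. 1 < p0 \<and> p0 < p \<and> CARD('n) * (p / p0 - 1) \<le> 1 / 2 \<and> 0 \<le> B' \<and>
    (\<forall>(m :: real^'n \<Rightarrow> real) q. Apq m p p B \<and> m \<in> borel_measurable borel \<and> (\<forall>x. 0 < m x) \<and> q \<in> {p0..p} \<longrightarrow> Apq m p q B')"
proof -
  define p' where "p' = p / (p - 1)"
  have p': "1 < p'" "1 / p + 1 / p' = 1" using p by (auto simp: p'_def field_simps)
  obtain e C where e: "1 < e" and C: "0 < C" and rh: "\<forall>(m :: real^'n \<Rightarrow> real) x0 r.
      Apq m p p B \<and> m \<in> borel_measurable borel \<and> (\<forall>x. 0 < m x) \<and> 0 < r \<longrightarrow>
      epowr (\<integral>\<^sup>+x\<in>cube x0 r. ennreal (m x powr - (p' * e)) \<partial>lborel) (1 / e)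
      \<le> ennreal (C * (2 * r) powr (CARD('n) * (1 / e - 1))) * (\<integral>\<^sup>+x\<in>cube x0 r. ennreal (m x powr - p') \<partial>lborel)"
    using Apq_reverse_Hoelder[OF p B, where 'n = 'n] unfolding p'_def by blast
  have pe: "p' < p' * e" "1 < p' * e" using p' e by (auto simp: less_1_mult)
  \<comment> \<open>The conjugate exponent of \<open>p' * e\<close>, the exponent gained for the
    dual weight.\<close>
  define q0 where "q0 = p' * e / (p' * e - 1)"
  \<comment> \<open>The solution of \<open>CARD('n) * (p / q1 - 1) = 1 / 2\<close>; this smallness
    makes the integral over the segment parameter converge in the Poincare inequality.\<close>
  define q1 where "q1 = p / (1 + 1 / (2 * CARD('n)))"
  define p0 where "p0 = max q0 q1"
  have q0: "1 < q0" using pe by (simp add: q0_def)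
  have "1 / p = 1 - 1 / p'" using p' by simp
  also have "\<dots> < 1 - 1 / (p' * e)" using pe p' by (simp add: frac_less2)
  also have "\<dots> = 1 / q0" using pe p' e by (simp add: q0_def diff_divide_distrib)
  finally have q0p: "q0 < p" using p q0 by (simp add: field_simps)
  have q1: "0 < q1" "q1 < p" using p by (auto simp: q1_def field_simps)
  have p0: "1 < p0" "p0 < p" using q0 q0p q1 by (auto simp: p0_def)
  have "p / p0 \<le> p / q1" using p0 q1 p by (intro divide_left_mono) (auto simp: p0_def)
  also have "\<dots> = 1 + 1 / (2 * CARD('n))" using p unfolding q1_def by simp
  finally have np: "CARD('n) * (p / p0 - 1) \<le> 1 / 2" by (simp add: field_simps)
  show ?thesis
  proof (rule exI[of _ p0], rule exI[of _ "C powr (1 / p') * B"], intro conjI allI impI)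
    show "0 \<le> C powr (1 / p') * B" using B by simp
    fix m :: "real^'n \<Rightarrow> real" and q
    assume "Apq m p p B \<and> m \<in> borel_measurable borel \<and> (\<forall>x. 0 < m x) \<and> q \<in> {p0..p}"
    then have A: "Apq m p p B" and mm [measurable]: "m \<in> borel_measurable borel" and m: "\<And>x. 0 < m x" and q: "q \<in> {p0..p}"
      by auto
    define q' where "q' = q / (q - 1)"
    have q1': "1 < q" "q0 \<le> q" using q p0 by (auto simp: p0_def)
    have q': "1 < q'" "1 / q' = 1 - 1 / q" "(q - 1) / q = 1 / q'" using q1' by (auto simp: q'_def field_simps)
    have "1 - 1 / q0 \<le> 1 / q'" using q' q1' q0 by (simp add: frac_le)
    moreover have "1 - 1 / q0 = 1 / (p' * e)" using pe p' e by (simp add: q0_def diff_divide_distrib)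
    ultimately have q'le: "q' \<le> p' * e"
      using frac_less2[of 1 1 "p' * e" q'] pe q'(1) by (cases "p' * e < q'") auto
    show "Apq m p q (C powr (1 / p') * B)"
      unfolding Apq_def q'_def[symmetric] q'(3)
    proof (intro allI impI)
      fix x0 :: "real^'n" and r :: real assume r: "0 < r"
      let ?X = "\<integral>\<^sup>+x\<in>cube x0 r. ennreal (m x powr - q') \<partial>lborel"
      let ?Y = "\<integral>\<^sup>+x\<in>cube x0 r. ennreal (m x powr - (p' * e)) \<partial>lborel"
      let ?S = "\<integral>\<^sup>+x\<in>cube x0 r. ennreal (m x powr - p') \<partial>lborel"
      let ?W = "\<integral>\<^sup>+x\<in>cube x0 r. ennreal (m x powr p) \<partial>lborel"
      define N where "N = real CARD('n)"
      define R where "R = 2 * r"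
      have R: "0 < R" using r by (simp add: R_def)
      \<comment> \<open>The case of equal exponents is separate because
        \<open>nn_integral_Jensen\<close> asks for a power strictly above 1.\<close>
      have 1: "epowr ?X (1 / q') \<le> ennreal (R powr (N * (1 / q' - 1 / (p' * e)))) * epowr ?Y (1 / (p' * e))"
      proof (cases "q' = p' * e")
        case True
        then show ?thesis using R by simp
      next
        case False
        define \<theta> where "\<theta> = p' * e / q'"
        have \<theta>: "1 < \<theta>" using False q'le q' by (simp add: \<theta>_def)
        have "epowr ?X \<theta> \<le> ennreal ((R powr N) powr (\<theta> - 1)) * (\<integral>\<^sup>+x\<in>cube x0 r. epowr (ennreal (m x powr - q')) \<theta> \<partial>lborel)"
          by (rule nn_integral_Jensen) (use \<theta> r in \<open>auto simp: emeasure_cube R_def N_def\<close>)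
        also have "(\<integral>\<^sup>+x\<in>cube x0 r. epowr (ennreal (m x powr - q')) \<theta> \<partial>lborel) = ?Y"
        proof -
          have "- q' * \<theta> = - (p' * e)" using q' by (simp add: \<theta>_def)
          then show ?thesis by (simp add: epowr_ennreal powr_powr)
        qed
        finally have "epowr (epowr ?X \<theta>) (1 / (p' * e)) \<le> epowr (ennreal ((R powr N) powr (\<theta> - 1)) * ?Y) (1 / (p' * e))"
          using pe by (intro epowr_mono) auto
        moreover have "\<theta> * (1 / (p' * e)) = 1 / q'" using pe p' e q' by (simp add: \<theta>_def)
        moreover have "(\<theta> - 1) * (1 / (p' * e)) = 1 / q' - 1 / (p' * e)" using pe p' e q' by (simp add: \<theta>_def diff_divide_distrib)
        ultimately show ?thesis
          by (simp only: epowr_mult epowr_epowr epowr_ennreal powr_ge_zero powr_powr mult.assoc)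
      qed
      have "epowr (epowr ?Y (1 / e)) (1 / p') \<le> epowr (ennreal (C * R powr (N * (1 / e - 1))) * ?S) (1 / p')"
        using rh[rule_format, of m r x0] A mm m r p' by (intro epowr_mono) (auto simp: N_def R_def)
      then have 2: "epowr ?Y (1 / (p' * e)) \<le> ennreal (C powr (1 / p') * R powr (N * (1 / e - 1) * (1 / p'))) * epowr ?S (1 / p')"
        using C R by (simp add: epowr_mult epowr_epowr epowr_ennreal powr_mult powr_powr mult.commute)
      have "epowr ?W (1 / p) * epowr ?X (1 / q')
        \<le> epowr ?W (1 / p) * (ennreal (R powr (N * (1 / q' - 1 / (p' * e)))) *
           (ennreal (C powr (1 / p') * R powr (N * (1 / e - 1) * (1 / p'))) * epowr ?S (1 / p')))"
        by (intro mult_left_mono order_trans[OF 1] 2) auto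
      also have "\<dots> = ennreal (C powr (1 / p') * R powr (N * (1 / q' - 1 / p'))) * (epowr ?W (1 / p) * epowr ?S (1 / p'))"
      proof -
        have "N * (1 / q' - 1 / (p' * e)) + N * (1 / e - 1) * (1 / p') = N * (1 / q' - 1 / p')"
          using p' e by (simp add: field_simps)
        then have "R powr (N * (1 / q' - 1 / (p' * e))) * R powr (N * (1 / e - 1) * (1 / p')) = R powr (N * (1 / q' - 1 / p'))"
          by (simp only: powr_add[symmetric])
        then have eq: "ennreal (C powr (1 / p') * R powr (N * (1 / q' - 1 / p')))
          = ennreal (R powr (N * (1 / q' - 1 / (p' * e)))) * ennreal (C powr (1 / p') * R powr (N * (1 / e - 1) * (1 / p')))"
          by (subst ennreal_mult[symmetric]) (simp_all only: mult.left_commute powr_ge_zero mult_nonneg_nonneg)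
        show ?thesis unfolding eq by (simp only: mult_ac)
      qed
      also have "epowr ?W (1 / p) * epowr ?S (1 / p') \<le> ennreal (B * R powr (N * (1 / p + 1 / p')))"
      proof -
        have "(p - 1) / p = 1 / p'" by (simp add: p'_def)
        then show ?thesis using A r unfolding Apq_def p'_def[symmetric] R_def N_def by simp
      qed
      also have "ennreal (C powr (1 / p') * R powr (N * (1 / q' - 1 / p'))) * ennreal (B * R powr (N * (1 / p + 1 / p')))
         = ennreal (C powr (1 / p') * B * R powr (N * (1 / p + 1 / q')))"
      proof -
        have "R powr (N * (1 / q' - 1 / p')) * R powr (N * (1 / p + 1 / p')) = R powr (N * (1 / p + 1 / q'))"
          by (simp add: powr_add[symmetric] algebra_simps)
        then have "C powr (1 / p') * R powr (N * (1 / q' - 1 / p')) * (B * R powr (N * (1 / p + 1 / p'))) = C powr (1 / p') * B * R powr (N * (1 / p + 1 / q'))"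
          by (simp only: mult_ac)
        then show ?thesis using B by (simp add: ennreal_mult[symmetric])
      qed
      finally show "epowr ?W (1 / p) * epowr ?X (1 / q') \<le> ennreal (C powr (1 / p') * B * (2 * r) powr (CARD('n) * (1 / p + 1 / q')))"
        by (simp add: R_def N_def mult_left_mono)
    qed
  qed (use p0 np in auto)
qed

section \<open>Mollification\<close>

fun C1_k :: "nat \<Rightarrow> (real \<Rightarrow> real) \<Rightarrow> bool" where
  "C1_k 0 f \<longleftrightarrow> continuous_on UNIV f"
| "C1_k (Suc k) f \<longleftrightarrow> (\<exists>f'. (\<forall>x. (f has_real_derivative f' x) (at x)) \<and> C1_k k f')"

lemma C1_k_SucD: "C1_k (Suc k) f \<Longrightarrow> C1_k k f"
proof (induction k arbitrary: f)
  case 0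
  then show ?case
    by (auto intro!: continuous_at_imp_continuous_on dest: DERIV_isCont)
next
  case (Suc k)
  from Suc.prems obtain f' where "\<forall>x. (f has_real_derivative f' x) (at x)" "C1_k (Suc k) f'"
    by (auto simp del: C1_k.simps simp: C1_k.simps(2)[of "Suc k"])
  with Suc.IH show ?case by (auto simp del: C1_k.simps simp: C1_k.simps(2)[of k])
qed

lemma C1_k_add: "C1_k k f \<Longrightarrow> C1_k k g \<Longrightarrow> C1_k k (\<lambda>x. f x + g x)"
proof (induction k arbitrary: f g)
  case (Suc k)
  then obtain f' g' where "\<forall>x. (f has_real_derivative f' x) (at x)" "C1_k k f'"
    "\<forall>x. (g has_real_derivative g' x) (at x)" "C1_k k g'" by auto
  then show ?case using Suc.IH[of f' g']
    by (auto intro!: exI[of _ "\<lambda>x. f' x + g' x"] derivative_eq_intros)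
qed (auto intro: continuous_intros)

lemma C1_k_mult: "C1_k k f \<Longrightarrow> C1_k k g \<Longrightarrow> C1_k k (\<lambda>x. f x * g x)"
proof (induction k arbitrary: f g)
  case (Suc k)
  then obtain f' g' where d: "\<forall>x. (f has_real_derivative f' x) (at x)" "C1_k k f'"
    "\<forall>x. (g has_real_derivative g' x) (at x)" "C1_k k g'" by auto
  have "C1_k k (\<lambda>x. f' x * g x + f x * g' x)"
    using Suc d by (intro C1_k_add Suc.IH) (auto intro: C1_k_SucD simp del: C1_k.simps)
  with d show ?case
    by (auto intro!: exI[of _ "\<lambda>x. f' x * g x + f x * g' x"] derivative_eq_intros)
qed (auto intro: continuous_intros)

lemma C1_k_const: "C1_k k (\<lambda>x. c)"
  by (induction k arbitrary: c) (auto intro!: exI[of _ "\<lambda>x. 0"])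

lemma C1_k_affine: "C1_k k f \<Longrightarrow> C1_k k (\<lambda>x. f (a * x + b))"
proof (induction k arbitrary: f)
  case 0
  then show ?case
    by (auto intro!: continuous_on_compose2[where f = "\<lambda>x. a * x + b" and g = f and t = UNIV] continuous_intros)
next
  case (Suc k)
  then obtain f' where d: "\<forall>x. (f has_real_derivative f' x) (at x)" "C1_k k f'" by auto
  have "((\<lambda>x. f (a * x + b)) has_real_derivative f' (a * x + b) * a) (at x)" for x
    by (rule DERIV_chain2[where g = "\<lambda>x. a * x + b"]) (use d in \<open>auto intro!: derivative_eq_intros\<close>)
  moreover have "C1_k k (\<lambda>x. f' (a * x + b) * a)"
    using d Suc.IH by (intro C1_k_mult C1_k_const)
  ultimately show ?case by (auto intro!: exI[of _ "\<lambda>x. f' (a * x + b) * a"])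
qed

text \<open>The classical function \<open>exp (- 1 / t)\<close>, flat at 0. The extra powers of
  \<open>t\<close> make the family closed under differentiation up to linear combinations, so
  smoothness follows by induction for all \<open>m\<close> at once.\<close>

definition flat :: "nat \<Rightarrow> real \<Rightarrow> real" where
  "flat m t = (if 0 < t then exp (- 1 / t) / t ^ m else 0)"

lemma flat_tendsto: "((\<lambda>t. exp (- 1 / t) / t ^ m) \<longlongrightarrow> 0) (at_right (0::real))"
proof -
  have "((\<lambda>t. inverse t ^ m / exp (inverse t)) \<longlongrightarrow> 0) (at_right (0::real))"
    by (rule filterlim_compose[OF tendsto_power_div_exp_0 filterlim_inverse_at_top_right])
  then show ?thesis
    by (simp add: exp_minus field_simps)
qed

lemma flat_deriv: "(flat m has_real_derivative flat (m + 2) t + (- m) * flat (m + 1) t) (at t)"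
proof (cases "t = 0")
  case True
  \<comment> \<open>From the right the difference quotient at 0 is the formula of
    \<open>flat (Suc m)\<close>, which tends to 0; from the left it vanishes.\<close>
  have "((\<lambda>h. (flat m (0 + h) - flat m 0) / h) \<longlongrightarrow> 0) (at_right 0)"
    by (rule Lim_transform_eventually[OF flat_tendsto[of "Suc m"]])
      (auto simp: flat_def eventually_at_right_field intro!: exI[of _ 1])
  moreover have "((\<lambda>h. (flat m (0 + h) - flat m 0) / h) \<longlongrightarrow> 0) (at_left 0)"
    by (rule Lim_transform_eventually[OF tendsto_const])
      (auto simp: flat_def eventually_at_left_field intro!: exI[of _ "-1"])
  ultimately have "((\<lambda>h. (flat m (0 + h) - flat m 0) / h) \<longlongrightarrow> 0) (at 0)"
    by (simp add: filterlim_at_split)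
  then show ?thesis using True by (simp add: DERIV_def) (simp add: flat_def)
next
  case False
  then consider "0 < t" | "t < 0" by linarith
  then show ?thesis
  proof cases
    case 1
    have "((\<lambda>t. exp (- 1 / t) / t ^ m) has_real_derivative flat (m + 2) t + (- m) * flat (m + 1) t) (at t)"
      using 1 unfolding flat_def
      by (auto intro!: derivative_eq_intros simp: field_simps power2_eq_square)
        (cases m; simp add: field_simps)
    then show ?thesis
      by (rule DERIV_cong_ev[THEN iffD1, rotated -1])
        (use 1 in \<open>auto simp: flat_def eventually_nhds_metric dist_real_def intro!: exI[of _ t]\<close>)
  next
    case 2
    have "((\<lambda>t. 0) has_real_derivative flat (m + 2) t + (- m) * flat (m + 1) t) (at t)"
      using 2 by (simp add: flat_def)
    then show ?thesis
      by (rule DERIV_cong_ev[THEN iffD1, rotated -1])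
        (use 2 in \<open>auto simp: flat_def eventually_nhds_metric dist_real_def intro!: exI[of _ "-t"]\<close>)
  qed
qed

lemma flat_C1_k: "C1_k k (flat m)"
proof (induction k arbitrary: m)
  case 0
  show ?case by (auto intro!: continuous_at_imp_continuous_on DERIV_isCont flat_deriv)
next
  case (Suc k)
  have "C1_k k (\<lambda>t. flat (m + 2) t + (- real m) * flat (m + 1) t)"
    by (intro C1_k_add C1_k_mult C1_k_const Suc)
  then show ?case unfolding C1_k.simps using flat_deriv[of m]
    by (intro exI[of _ "\<lambda>t. flat (m + 2) t + (- real m) * flat (m + 1) t"]) auto
qed

section \<open>Gradients and smooth functions of several variables\<close>

lemma C_k_continuous: "C_k k f \<Longrightarrow> continuous_on UNIV f"
  by (cases k) (auto intro!: continuous_at_imp_continuous_on differentiable_imp_continuous_within)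

lemma has_derivative_grad:
  assumes "f differentiable (at x)"
  shows "(f has_derivative (\<lambda>h. h \<bullet> grad f x)) (at x)"
proof -
  let ?D = "frechet_derivative f (at x)"
  have D: "(f has_derivative ?D) (at x)"
    using assms frechet_derivative_works by blast
  interpret D: linear ?D using D by (rule has_derivative_linear)
  have "?D = (\<lambda>h. h \<bullet> grad f x)"
  proof
    fix h
    have "?D h = ?D (\<Sum>i\<in>UNIV. (h $ i) *\<^sub>R axis i 1)"
      using basis_expansion[of h] by (simp add: scalar_mult_eq_scaleR)
    also have "\<dots> = h \<bullet> grad f x"
      by (simp add: D.sum D.scale inner_vec_def grad_def partial_deriv_def)
    finally show "?D h = h \<bullet> grad f x" .
  qed
  with D show ?thesis by simp
qed

lemma grad_eqI:
  assumes "(f has_derivative (\<lambda>h. h \<bullet> v)) (at x)"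
  shows "grad f x = v"
  using frechet_derivative_at[OF assms, symmetric]
  by (simp add: grad_def partial_deriv_def vec_eq_iff inner_axis')

lemma C_k_grad_continuous:
  assumes "C_k (Suc k) f" shows "continuous_on UNIV (grad f)"
  unfolding grad_def using assms by (intro continuous_on_vec_lambda) (auto intro: C_k_continuous)

lemma C_k_affine: "C_k k f \<Longrightarrow> C_k k (\<lambda>x. a * f x + c)"
proof (induction k arbitrary: f c)
  case (Suc k)
  have d: "((\<lambda>x. a * f x + c) has_derivative (\<lambda>h. h \<bullet> (a *\<^sub>R grad f x))) (at x)" for x
    using Suc.prems by (auto intro!: derivative_eq_intros has_derivative_grad)
  have "partial_deriv (\<lambda>x. a * f x + c) i = (\<lambda>x. a * partial_deriv f i x + 0)" for i
    using grad_eqI[OF d] by (auto simp: grad_def vec_eq_iff)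
  moreover have "C_k k (\<lambda>x. a * partial_deriv f i x + 0)" for i
    using Suc.IH[of "partial_deriv f i" 0] Suc.prems by simp
  moreover have "(\<lambda>x. a * f x + c) differentiable (at x)" for x
    using d unfolding differentiable_def by blast
  ultimately show ?case by simp
qed (auto intro!: continuous_intros)

text \<open>A partial derivative replaces one factor by its derivative and leaves the product form
  intact, so the induction closes once the factors may differ from coordinate to coordinate.\<close>

lemma C_k_prod: "(\<And>i. C1_k k (F i)) \<Longrightarrow> C_k k (\<lambda>x::real^'n. \<Prod>i\<in>UNIV. F i (x $ i))"
proof (induction k arbitrary: F)
  case 0
  show ?case using 0
    by (auto intro!: continuous_on_prod continuous_on_compose2[where t = UNIV and f = "\<lambda>x. x $ _"] continuous_intros)
next
  case (Suc k)
  then have "\<forall>i. \<exists>f'. (\<forall>x. (F i has_real_derivative f' x) (at x)) \<and> C1_k k f'" by auto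
  then obtain F' where F': "\<And>i x. (F i has_real_derivative F' i x) (at x)" "\<And>i. C1_k k (F' i)"
    by metis
  let ?v = "\<lambda>x::real^'n. \<chi> j. \<Prod>i\<in>UNIV. (if i = j then F' i else F i) (x $ i)"
  have d: "((\<lambda>x::real^'n. \<Prod>i\<in>UNIV. F i (x $ i)) has_derivative (\<lambda>h. h \<bullet> ?v x)) (at x)" for x
  proof -
    have d1: "((\<lambda>x. F i (x $ i)) has_derivative (\<lambda>h. h $ i * F' i (x $ i))) (at x)" for i
    proof (rule has_derivative_compose[where f = "\<lambda>x. x $ i" and f' = "\<lambda>h. h $ i" and g = "F i" and g' = "\<lambda>h. h * F' i (x $ i)"])
      show "((\<lambda>x. x $ i) has_derivative (\<lambda>h. h $ i)) (at x)"
        by (rule bounded_linear_imp_has_derivative) (rule bounded_linear_vec_nth)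
      show "(F i has_derivative (\<lambda>h. h * F' i (x $ i))) (at (x $ i))"
        using F'(1)[of i "x $ i"] by (simp add: has_field_derivative_def mult_commute_abs)
    qed
    have "((\<lambda>x. \<Prod>i\<in>UNIV. F i (x $ i)) has_derivative (\<lambda>h. \<Sum>i\<in>UNIV. h $ i * F' i (x $ i) * (\<Prod>j\<in>UNIV - {i}. F j (x $ j)))) (at x)"
      by (rule has_derivative_prod[where I = UNIV and f = "\<lambda>i x. F i (x $ i)"]) (rule d1)
    moreover have "F' i (x $ i) * (\<Prod>j\<in>UNIV - {i}. F j (x $ j)) = (\<Prod>j\<in>UNIV. (if j = i then F' j else F j) (x $ j))" for i
      by (subst prod.remove[of UNIV i]) (auto intro!: prod.cong)
    ultimately show ?thesis by (simp add: inner_vec_def mult.assoc)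
  qed
  have "partial_deriv (\<lambda>x. \<Prod>i\<in>UNIV. F i (x $ i)) j = (\<lambda>x. \<Prod>i\<in>UNIV. (if i = j then F' i else F i) (x $ i))" for j
    using grad_eqI[OF d] by (auto simp: grad_def vec_eq_iff)
  moreover have "C_k k (\<lambda>x::real^'n. \<Prod>i\<in>UNIV. (if i = j then F' i else F i) (x $ i))" for j
    using F'(2) Suc.prems C1_k_SucD by (intro Suc.IH) (auto simp del: C1_k.simps)
  moreover have "(\<lambda>x. \<Prod>i\<in>UNIV. F i (x $ i)) differentiable (at x)" for x :: "real^'n"
    using d unfolding differentiable_def by blast
  ultimately show ?case by simp
qed

text \<open>Every derivative falls on \<open>\<psi>\<close>, so continuity of \<open>f\<close> is
  enough. Integrating over a fixed compact box makes differentiation under the integral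
  available.\<close>

lemma C_k_convolution:
  fixes f \<psi> :: "real^'n \<Rightarrow> real"
  assumes f: "continuous_on UNIV f"
  shows "C_k k \<psi> \<Longrightarrow> C_k k (\<lambda>x. integral (cbox a b) (\<lambda>y. f y * \<psi> (x - y)))"
proof (induction k arbitrary: \<psi>)
  case 0
  then have c0: "continuous_on UNIV \<psi>" by simp
  have "continuous_on UNIV (\<lambda>z. f (snd z) * \<psi> (fst z - snd z))"
    by (intro continuous_on_mult continuous_on_compose2[OF f] continuous_on_compose2[OF c0] continuous_intros) auto
  then have "continuous_on (UNIV \<times> cbox a b) (\<lambda>(x, y). f y * \<psi> (x - y))"
    by (auto simp: case_prod_beta' intro: continuous_on_subset)
  then show ?case by (simp add: integral_continuous_on_param)
next
  case (Suc k)
  have \<psi>: "\<psi> differentiable (at x)" for x using Suc.prems by simp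
  define fx where "fx x y = blinfun_inner_left (f y *\<^sub>R grad \<psi> (x - y))" for x y
  have "continuous_on UNIV (\<lambda>z. f (snd z) *\<^sub>R grad \<psi> (fst z - snd z))"
    by (intro continuous_on_scaleR continuous_on_compose2[OF f] continuous_on_compose2[OF C_k_grad_continuous[OF Suc.prems]] continuous_intros) auto
  then have cfx: "continuous_on UNIV (\<lambda>z. fx (fst z) (snd z))"
    unfolding fx_def by (intro bounded_linear.continuous_on[OF bounded_linear_blinfun_inner_left])
  have c\<psi>: "continuous_on UNIV \<psi>" using Suc.prems by (rule C_k_continuous)
  have D: "((\<lambda>x. integral (cbox a b) (\<lambda>y. f y * \<psi> (x - y))) has_derivative blinfun_apply (integral (cbox a b) (fx x))) (at x)" for x
  proof (rule leibniz_rule[where U = UNIV and f = "\<lambda>x y. f y * \<psi> (x - y)"])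
    fix x t
    have "((\<lambda>x. \<psi> (x - t)) has_derivative (\<lambda>h. h \<bullet> grad \<psi> (x - t))) (at x)"
      by (rule has_derivative_compose[where f = "\<lambda>x. x - t" and g = \<psi> and f' = "\<lambda>h. h" and g' = "\<lambda>h. h \<bullet> grad \<psi> (x - t)"])
        (auto intro!: derivative_eq_intros has_derivative_grad \<psi>)
    then show "((\<lambda>x. f t * \<psi> (x - t)) has_derivative blinfun_apply (fx x t)) (at x)"
      by (auto simp: fx_def intro!: derivative_eq_intros)
  next
    fix x
    show "(\<lambda>y. f y * \<psi> (x - y)) integrable_on cbox a b"
      by (intro integrable_continuous continuous_on_mult continuous_on_subset[OF f] continuous_on_compose2[OF c\<psi>] continuous_intros) auto
  next
    show "continuous_on (UNIV \<times> cbox a b) (\<lambda>(x, t). fx x t)"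
      using cfx by (auto simp: case_prod_beta' intro: continuous_on_subset)
  qed auto
  have "partial_deriv (\<lambda>x. integral (cbox a b) (\<lambda>y. f y * \<psi> (x - y))) j = (\<lambda>x. integral (cbox a b) (\<lambda>y. f y * partial_deriv \<psi> j (x - y)))" for j
  proof
    fix x
    have "fx x integrable_on cbox a b"
      using continuous_on_compose2[OF cfx continuous_on_Pair[OF continuous_on_const continuous_on_id], of x "cbox a b"]
      by (intro integrable_continuous) simp
    from integral_linear[OF this, of "\<lambda>L. blinfun_apply L (axis j 1)"]
    have "blinfun_apply (integral (cbox a b) (fx x)) (axis j 1) = integral (cbox a b) (\<lambda>y. blinfun_apply (fx x y) (axis j 1))"
      by (simp add: blinfun.bounded_linear_left o_def)
    then show "partial_deriv (\<lambda>x. integral (cbox a b) (\<lambda>y. f y * \<psi> (x - y))) j x = integral (cbox a b) (\<lambda>y. f y * partial_deriv \<psi> j (x - y))"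
      unfolding partial_deriv_def[of "\<lambda>x. integral (cbox a b) (\<lambda>y. f y * \<psi> (x - y))"] frechet_derivative_at[OF D, symmetric]
      by (simp add: fx_def inner_axis' grad_def)
  qed
  moreover have "(\<lambda>x. integral (cbox a b) (\<lambda>y. f y * \<psi> (x - y))) differentiable (at x)" for x
    using D unfolding differentiable_def by blast
  ultimately show ?case using Suc by simp
qed

lemma exists_mollifier:
  assumes "0 < d"
  obtains \<psi> :: "real^'n \<Rightarrow> real" where "smooth \<psi>" "\<And>x. 0 \<le> \<psi> x" "\<And>x. x \<notin> cube 0 d \<Longrightarrow> \<psi> x = 0"
    "integrable lborel \<psi>" "(LINT x|lborel. \<psi> x) = 1"
proof -
  \<comment> \<open>Positive exactly on the interval from \<open>- d\<close> to \<open>d\<close>;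
    the product over the coordinates is then positive exactly on the cube.\<close>
  define F where "F t = flat 0 (1 + t / d) * flat 0 (1 - t / d)" for t
  define P where "P x = (\<Prod>i\<in>UNIV. F (x $ i))" for x :: "real^'n"
  have F: "C1_k k F" for k
    using C1_k_mult[OF C1_k_affine[OF flat_C1_k, of k 0 "1 / d" 1] C1_k_affine[OF flat_C1_k, of k 0 "- 1 / d" 1]]
    by (simp add: F_def[abs_def] add.commute)
  have P: "C_k k P" for k unfolding P_def[abs_def] by (intro C_k_prod F)
  have P_nonneg: "0 \<le> P x" for x by (auto simp: P_def F_def flat_def intro!: prod_nonneg)
  have P_pos: "0 < P x" if "x \<in> cube 0 d" for x
    unfolding P_def
  proof (intro prod_pos ballI)
    fix i
    have "\<bar>x $ i\<bar> < d" using that by (simp add: cube_def)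
    then show "0 < F (x $ i)" using assms by (auto simp: F_def flat_def abs_less_iff field_simps)
  qed
  have P_0: "P x = 0" if "x \<notin> cube 0 d" for x
  proof -
    from that obtain i where "d \<le> \<bar>x $ i\<bar>" by (auto simp: cube_def not_less)
    then have "F (x $ i) = 0" using assms by (auto simp: F_def flat_def abs_real_def field_simps split: if_splits)
    then show ?thesis unfolding P_def by (intro prod_zero) auto
  qed
  let ?S = "cbox (- (\<chi> i. d)) (\<chi> i. d) :: (real^'n) set"
  have "integrable lborel (\<lambda>x. indicator ?S x *\<^sub>R P x)"
    by (rule borel_integrable_compact) (auto intro: continuous_on_subset[OF C_k_continuous[OF P[of 0]]])
  also have "(\<lambda>x. indicator ?S x *\<^sub>R P x) = P"
  proof
    fix x show "indicator ?S x *\<^sub>R P x = P x"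
      by (cases "x \<in> cube 0 d") (auto simp: P_0 indicator_def cube_def mem_box_cart abs_less_iff, (smt (verit))+)
  qed
  finally have int: "integrable lborel P" .
  define I where "I = (LINT x|lborel. P x)"
  have "I \<noteq> 0"
  proof
    assume "I = 0"
    then have "AE x in lborel. P x = 0"
      using integral_nonneg_eq_0_iff_AE[OF int] P_nonneg by (simp add: I_def)
    then have "AE x in lborel. x \<notin> cube (0 :: real^'n) d"
      by eventually_elim (use P_pos in force)
    then have "emeasure lborel (cube (0 :: real^'n) d) = 0"
      by (subst (asm) AE_iff_measurable[OF _ refl]) auto
    then show False using assms by (simp add: emeasure_cube)
  qed
  moreover have "0 \<le> I" unfolding I_def using P_nonneg by (intro Bochner_Integration.integral_nonneg) auto
  ultimately have I: "0 < I" by simp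
  show thesis
  proof
    show "smooth (\<lambda>x. (1 / I) * P x)"
      using C_k_affine[OF P, of _ "1 / I" 0] by (simp add: smooth_def)
  qed (use P_nonneg P_0 int I in \<open>auto simp: I_def\<close>)
qed

lemma lborel_integral_reflect:
  fixes f :: "real^'n \<Rightarrow> real"
  assumes [measurable]: "f \<in> borel_measurable borel"
  shows "(LINT y|lborel. f y) = (LINT z|lborel. f (x - z))"
proof -
  have "(LINT y|lborel. f y) = (LINT y|density (distr lborel borel (\<lambda>z. x + (-1) *\<^sub>R z)) (\<lambda>_. 1). f y)"
    using lborel_affine[of "-1" x] by simp
  also have "\<dots> = (LINT z|lborel. f (x + (-1) *\<^sub>R z))"
    by (simp add: density_1 integral_distr)
  finally show ?thesis by simp
qed

text \<open>Both conclusions are local: the mollifier lives in \<open>cube 0 (d / 2)\<close>, so for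
  \<open>h\<close> in that cube the values at \<open>x\<close> and \<open>x + h\<close> involve
  \<open>f\<close> on \<open>cube x d\<close> only, and a Lipschitz constant of \<open>f\<close>
  there becomes a gradient bound at the single point \<open>x\<close>. A pointwise bound is needed
  because the later Lipschitz constants vary with \<open>x\<close>.\<close>

lemma mollification:
  fixes f :: "real^'n \<Rightarrow> real"
  assumes f: "continuous_on UNIV f" and supp: "bounded {x. f x \<noteq> 0}" and d: "0 < d"
  obtains \<phi> where "smooth \<phi>"
    "\<forall>x c. (\<forall>y\<in>cube x d. f y = c) \<longrightarrow> \<phi> x = c"
    "\<forall>x L. (\<forall>y\<in>cube x d. \<forall>z\<in>cube x d. \<bar>f y - f z\<bar> \<le> L * norm (y - z)) \<longrightarrow> norm (grad \<phi> x) \<le> L"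
proof -
  obtain \<psi> :: "real^'n \<Rightarrow> real" where \<psi>: "smooth \<psi>" "\<And>x. 0 \<le> \<psi> x" "\<And>x. x \<notin> cube 0 (d / 2) \<Longrightarrow> \<psi> x = 0"
    "integrable lborel \<psi>" "(LINT x|lborel. \<psi> x) = 1"
    using exists_mollifier[of "d / 2"] d by auto
  have c\<psi>: "continuous_on UNIV \<psi>" using \<psi>(1) C_k_continuous by (auto simp: smooth_def)
  have [measurable]: "f \<in> borel_measurable borel" "\<psi> \<in> borel_measurable borel"
    using f c\<psi> by (auto intro: borel_measurable_continuous_onI)
  obtain a b where ab: "{x. f x \<noteq> 0} \<subseteq> cbox a b"
    using supp bounded_subset_cbox_symmetric by metis
  define \<phi> where "\<phi> x = integral (cbox a b) (\<lambda>y. f y * \<psi> (x - y))" for x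
  obtain M where M: "\<And>x. \<bar>f x\<bar> \<le> M"
  proof -
    have "compact (f ` cbox a b)" by (intro compact_continuous_image continuous_on_subset[OF f]) auto
    then obtain M where "\<forall>x\<in>cbox a b. \<bar>f x\<bar> \<le> M"
      using compact_imp_bounded bounded_iff by (metis imageI real_norm_def)
    then have "\<bar>f x\<bar> \<le> max 0 M" for x using ab by (cases "f x = 0") force+
    then show ?thesis by (rule that)
  qed
  have int: "integrable lborel (\<lambda>z. f (x - z) * \<psi> z)" for x
    by (rule Bochner_Integration.integrable_bound[OF integrable_mult_right[OF \<psi>(4), of M]])
      (auto simp: abs_mult \<psi>(2) intro!: mult_right_mono order_trans[OF M])
  have \<phi>: "\<phi> x = (LINT z|lborel. f (x - z) * \<psi> z)" for x
  proof -
    have eq: "indicator (cbox a b) y *\<^sub>R (f y * \<psi> (x - y)) = f y * \<psi> (x - y)" for y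
      using ab by (cases "y \<in> cbox a b") auto
    have si: "set_integrable lborel (cbox a b) (\<lambda>y. f y * \<psi> (x - y))"
      unfolding set_integrable_def
      by (intro borel_integrable_compact continuous_on_mult continuous_on_subset[OF f] continuous_on_compose2[OF c\<psi>] continuous_intros) auto
    have "\<phi> x = (LINT y|lborel. f y * \<psi> (x - y))"
      using set_borel_integral_eq_integral(2)[OF si] by (simp add: \<phi>_def set_lebesgue_integral_def eq del: scaleR_conv_of_real real_scaleR_def)
    also have "\<dots> = (LINT z|lborel. f (x - z) * \<psi> z)"
      by (subst lborel_integral_reflect[of _ x]) simp_all
    finally show ?thesis .
  qed
  have near: "x - z \<in> cube x d" "h \<in> cube 0 (d / 2) \<Longrightarrow> x + h - z \<in> cube x d" if "\<psi> z \<noteq> 0" for x z h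
  proof -
    have z: "\<bar>z $ i\<bar> < d / 2" for i using \<psi>(3)[of z] that by (auto simp: cube_def)
    then show "x - z \<in> cube x d" using d by (auto simp: cube_def intro: less_trans[OF z])
    show "x + h - z \<in> cube x d" if "h \<in> cube 0 (d / 2)"
      unfolding cube_def mem_Collect_eq
    proof
      fix i show "\<bar>(x + h - z) $ i - x $ i\<bar> < d"
        using that z[of i] unfolding cube_def by (auto dest!: spec[of _ i])
    qed
  qed
  have smooth: "smooth \<phi>"
      unfolding \<phi>_def[abs_def] using \<psi>(1) C_k_convolution[OF f] by (simp add: smooth_def)
  have const: "\<phi> x = c" if "\<And>y. y \<in> cube x d \<Longrightarrow> f y = c" for x c
    proof -
      have "f (x - z) * \<psi> z = c * \<psi> z" for z
        using that near(1)[of z x] by (cases "\<psi> z = 0") auto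
      then have "\<phi> x = (LINT z|lborel. c * \<psi> z)" by (simp only: \<phi>)
      then show ?thesis using \<psi>(5) by simp
    qed
  have lip: "norm (grad \<phi> x) \<le> L"
      if L: "\<And>y z. y \<in> cube x d \<Longrightarrow> z \<in> cube x d \<Longrightarrow> \<bar>f y - f z\<bar> \<le> L * norm (y - z)" for x L
    proof -
      \<comment> \<open>The cube contains two distinct points, so the Lipschitz inequality itself
        excludes a negative \<open>L\<close>.\<close>
      have L0: "0 \<le> L"
      proof -
        have "x + (\<chi> i. d / 2) \<in> cube x d" using d by (simp add: cube_def)
        from L[OF this cube_center[OF d]] have "0 \<le> L * norm ((\<chi> i. d / 2) :: real^'n)" by simp
        moreover have "0 < norm ((\<chi> i. d / 2) :: real^'n)" using d by (simp add: vec_eq_iff)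
        ultimately show ?thesis by (simp add: zero_le_mult_iff)
      qed
      have lip: "\<bar>\<phi> (x + h) - \<phi> x\<bar> \<le> L * norm h" if h: "h \<in> cube 0 (d / 2)" for h
      proof -
        have "\<bar>\<phi> (x + h) - \<phi> x\<bar> = \<bar>LINT z|lborel. (f (x + h - z) - f (x - z)) * \<psi> z\<bar>"
          unfolding \<phi> by (subst Bochner_Integration.integral_diff[symmetric]) (auto intro: int simp: left_diff_distrib)
        also have "\<dots> \<le> (LINT z|lborel. \<bar>(f (x + h - z) - f (x - z)) * \<psi> z\<bar>)"
          by (rule integral_abs_bound)
        also have "\<dots> \<le> (LINT z|lborel. L * norm h * \<psi> z)"
        proof (rule integral_mono)
          show "integrable lborel (\<lambda>z. \<bar>(f (x + h - z) - f (x - z)) * \<psi> z\<bar>)"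
            using Bochner_Integration.integrable_diff[OF int[of "x + h"] int[of x]]
            by (intro integrable_abs) (simp add: left_diff_distrib)
          show "integrable lborel (\<lambda>z. L * norm h * \<psi> z)" using \<psi>(4) by simp
          fix z
          show "\<bar>(f (x + h - z) - f (x - z)) * \<psi> z\<bar> \<le> L * norm h * \<psi> z"
            using L[OF near(2)[OF _ h] near(1), of z z] \<psi>(2)[of z]
            by (cases "\<psi> z = 0") (auto simp: abs_mult intro!: mult_right_mono)
        qed
        also have "\<dots> = L * norm h" using \<psi>(5) by simp
        finally show ?thesis .
      qed
      \<comment> \<open>The derivative in the direction of the gradient is the square of its norm
        and is bounded by \<open>L * norm v\<close>.\<close>
      define v where "v = grad \<phi> x"
      have "\<phi> differentiable (at x)" using smooth unfolding smooth_def by (auto dest: spec[of _ "Suc 0"])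
      then have D: "(\<phi> has_derivative (\<lambda>h. h \<bullet> v)) (at x)" unfolding v_def by (rule has_derivative_grad)
      have "((\<lambda>t. \<phi> (x + t *\<^sub>R v)) has_derivative (\<lambda>t. (t *\<^sub>R v) \<bullet> v)) (at 0)"
      proof (rule has_derivative_compose[where g = \<phi> and f' = "\<lambda>t. t *\<^sub>R v" and f = "\<lambda>t. x + t *\<^sub>R v" and g' = "\<lambda>h. h \<bullet> v"])
        show "((\<lambda>t. x + t *\<^sub>R v) has_derivative (\<lambda>t. t *\<^sub>R v)) (at 0)"
          by (auto intro!: derivative_eq_intros)
      qed (use D in simp)
      then have "((\<lambda>t. \<phi> (x + t *\<^sub>R v)) has_real_derivative v \<bullet> v) (at 0)"
        by (simp add: has_field_derivative_def mult_commute_abs)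
      then have "((\<lambda>t. (\<phi> (x + t *\<^sub>R v) - \<phi> x) / t) \<longlongrightarrow> v \<bullet> v) (at_right 0)"
        by (simp add: DERIV_def filterlim_at_split)
      moreover have "eventually (\<lambda>t. (\<phi> (x + t *\<^sub>R v) - \<phi> x) / t \<le> L * norm v) (at_right 0)"
      proof -
        have "((\<lambda>t. t * norm v) \<longlongrightarrow> 0 * norm v) (at_right 0)" by (intro tendsto_intros)
        then have "eventually (\<lambda>t. t * norm v < d / 2) (at_right 0)"
          using d by (intro order_tendstoD) auto
        then show ?thesis using eventually_at_right_less[of 0]
        proof eventually_elim
          case (elim t)
          have "t *\<^sub>R v \<in> cube 0 (d / 2)"
            unfolding cube_def mem_Collect_eq
          proof
            fix i have "\<bar>(t *\<^sub>R v) $ i\<bar> \<le> norm (t *\<^sub>R v)" by (rule component_le_norm_cart)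
            then show "\<bar>(t *\<^sub>R v) $ i - 0 $ i\<bar> < d / 2" using elim by simp
          qed
          from lip[OF this] have "\<phi> (x + t *\<^sub>R v) - \<phi> x \<le> L * (t * norm v)" using elim by simp
          then show ?case using elim by (simp add: field_simps)
        qed
      qed
      ultimately have "v \<bullet> v \<le> L * norm v"
        by (intro tendsto_upperbound) auto
      then have "norm v * norm v \<le> L * norm v" by (simp add: dot_square_norm power2_eq_square)
      then show ?thesis using L0 unfolding v_def[symmetric] by (cases "norm v = 0") auto
    qed
  show thesis by (rule that[OF smooth]) (blast intro: const lip)+
qed

section \<open>The weighted Poincare inequality\<close>

lemma norm_diff_cube_le:
  fixes x y x0 :: "real^'n" and r :: real
  assumes "x \<in> cube x0 r" "y \<in> cube x0 r"
  shows "norm (y - x) \<le> 2 * real CARD('n) * r"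
proof -
  have "norm (y - x) \<le> (\<Sum>i\<in>UNIV. \<bar>(y - x) $ i\<bar>)" by (rule norm_le_l1_cart)
  also have "(\<Sum>i\<in>UNIV. \<bar>(y - x) $ i\<bar>) \<le> (\<Sum>i\<in>(UNIV :: 'n set). 2 * r)"
  proof (rule sum_mono)
    fix i
    have "\<bar>x $ i - x0 $ i\<bar> < r" "\<bar>y $ i - x0 $ i\<bar> < r" using assms by (auto simp: cube_def)
    then show "\<bar>(y - x) $ i\<bar> \<le> 2 * r" by simp
  qed
  finally show ?thesis by simp
qed

text \<open>The fundamental theorem of calculus along the segment from \<open>x\<close> to
  \<open>y\<close>, as an extended integral ready for Fubini's theorem.\<close>

lemma C1_segment_estimate:
  fixes v :: "real^'n \<Rightarrow> real"
  assumes v: "C_k (Suc 0) v"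
  shows "ennreal \<bar>v x - v y\<bar> \<le> ennreal (norm (y - x)) *
    (\<integral>\<^sup>+t\<in>{0..1}. ennreal (norm (grad v ((1 - t) *\<^sub>R x + t *\<^sub>R y))) \<partial>lborel)"
proof -
  define \<gamma> where "\<gamma> t = (1 - t) *\<^sub>R x + t *\<^sub>R y" for t :: real
  have d: "((\<lambda>t. v (\<gamma> t)) has_vector_derivative (y - x) \<bullet> grad v (\<gamma> t)) (at t within {0..1})" for t
  proof -
    have "(v has_derivative (\<lambda>h. h \<bullet> grad v (\<gamma> t))) (at (\<gamma> t))"
      using v unfolding C_k.simps by (intro has_derivative_grad) blast
    moreover have "(\<gamma> has_derivative (\<lambda>s. s *\<^sub>R (y - x))) (at t within {0..1})"
    proof -
      have "\<gamma> = (\<lambda>t. x + t *\<^sub>R (y - x))"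
        by (simp add: \<gamma>_def fun_eq_iff scaleR_left_diff_distrib scaleR_right_diff_distrib)
      then show ?thesis by (auto intro!: derivative_eq_intros)
    qed
    ultimately have "((\<lambda>t. v (\<gamma> t)) has_derivative (\<lambda>s. (s *\<^sub>R (y - x)) \<bullet> grad v (\<gamma> t))) (at t within {0..1})"
      by (rule has_derivative_compose[rotated])
    then show ?thesis by (simp add: has_vector_derivative_def)
  qed
  have c: "continuous_on {0..1} (\<lambda>t. norm (y - x) * norm (grad v (\<gamma> t)))"
    unfolding \<gamma>_def
    by (intro continuous_intros continuous_on_compose2[OF C_k_grad_continuous[OF v]]) auto
  let ?I = "integral {0..1} (\<lambda>t. norm (y - x) * norm (grad v (\<gamma> t)))"
  have I: "((\<lambda>t. norm (y - x) * norm (grad v (\<gamma> t))) has_integral ?I) {0..1}"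
    using c by (intro integrable_integral integrable_continuous_interval)
  have h: "((\<lambda>t. (y - x) \<bullet> grad v (\<gamma> t)) has_integral v (\<gamma> 1) - v (\<gamma> 0)) {0..1}"
    by (rule fundamental_theorem_of_calculus) (use d in auto)
  have "norm (integral {0..1} (\<lambda>t. (y - x) \<bullet> grad v (\<gamma> t))) \<le> ?I"
    using h I by (intro integral_norm_bound_integral) (auto simp: has_integral_integrable_integral Cauchy_Schwarz_ineq2)
  then have "\<bar>v x - v y\<bar> \<le> ?I"
    using integral_unique[OF h] by (simp add: \<gamma>_def abs_minus_commute)
  then have "ennreal \<bar>v x - v y\<bar> \<le> ennreal ?I" by (rule ennreal_leI)
  also have "\<dots> = (\<integral>\<^sup>+t. ennreal (norm (y - x) * norm (grad v (\<gamma> t))) * indicator {0..1} t \<partial>lborel)"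
    by (rule nn_integral_has_integral_lebesgue'[symmetric, OF _ I]) auto
  also have "\<dots> = ennreal (norm (y - x)) * (\<integral>\<^sup>+t\<in>{0..1}. ennreal (norm (grad v (\<gamma> t))) \<partial>lborel)"
  proof -
    have [measurable]: "grad v \<in> borel_measurable borel"
      using C_k_grad_continuous[OF v] by (rule borel_measurable_continuous_onI)
    show ?thesis unfolding \<gamma>_def
      by (subst nn_integral_cmult[symmetric]) (auto simp: ennreal_mult mult.assoc)
  qed
  finally show ?thesis by (simp add: \<gamma>_def)
qed

lemma nn_integral_rescaled_cube:
  fixes g :: "real^'n \<Rightarrow> ennreal"
  assumes [measurable]: "g \<in> borel_measurable borel" and t: "0 < t"
  shows "(\<integral>\<^sup>+y\<in>cube x0 r. g (c + t *\<^sub>R y) \<partial>lborel)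
    = ennreal (t powr - real CARD('n)) * (\<integral>\<^sup>+y\<in>cube (c + t *\<^sub>R x0) (t * r). g y \<partial>lborel)"
proof -
  have "c + t *\<^sub>R y \<in> cube (c + t *\<^sub>R x0) (t * r) \<longleftrightarrow> y \<in> cube x0 r" for y
    using t by (simp add: cube_def right_diff_distrib[symmetric] abs_mult)
  then have "(\<integral>\<^sup>+y\<in>cube x0 r. g (c + t *\<^sub>R y) \<partial>lborel) = (\<integral>\<^sup>+y. (\<lambda>z. g z * indicator (cube (c + t *\<^sub>R x0) (t * r)) z) (c + t *\<^sub>R y) \<partial>lborel)"
    by (simp add: indicator_def)
  also have "\<dots> = ennreal (t powr - real CARD('n)) * (\<integral>\<^sup>+y\<in>cube (c + t *\<^sub>R x0) (t * r). g y \<partial>lborel)"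
    by (rule nn_integral_lborel_affine) (use t in simp_all)
  finally show ?thesis .
qed

text \<open>For fixed \<open>t\<close> the substitution maps the cube onto \<open>S x\<close>, a
  cube of radius \<open>t * r\<close> that by convexity stays in \<open>cube x0 r\<close> and whose
  points differ from \<open>x\<close> by less than \<open>2 * (t * r)\<close> in each coordinate.
  Two points sharing a \<open>y\<close> are thus closer than \<open>4 * (t * r)\<close>, as the
  moving cubes estimate demands. The Jacobian costs \<open>t powr - (CARD('n) * p)\<close> and the
  cube size regains \<open>t powr (CARD('n) * (1 + p - p / q))\<close>; their product is the stated
  power of \<open>t\<close>.\<close>

lemma Poincare_fixed_scale:
  fixes m :: "real^'n \<Rightarrow> real" and g :: "real^'n \<Rightarrow> ennreal"
  assumes A: "Apq m p q B" and [measurable]: "m \<in> borel_measurable borel" and m: "\<And>x. 0 < m x"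
    and pq: "1 < q" "q \<le> p" and B: "0 \<le> B" and r: "0 < r"
    and g [measurable]: "g \<in> borel_measurable borel" and t: "0 < t" "t \<le> 1"
  shows "(\<integral>\<^sup>+x\<in>cube x0 r. epowr (\<integral>\<^sup>+y\<in>cube x0 r. g ((1 - t) *\<^sub>R x + t *\<^sub>R y) \<partial>lborel) p * ennreal (m x powr p) \<partial>lborel)
    \<le> ennreal (t powr (- (CARD('n) * (p / q - 1))) * ((8 * r) powr (CARD('n) * (1 + p - p / q)) * B powr p)) *
      epowr (\<integral>\<^sup>+y\<in>cube x0 r. epowr (g y) q * ennreal (m y powr q) \<partial>lborel) (p / q)"
    (is "?L \<le> _ * epowr ?G _")
proof -
  define k where "k = CARD('n) * (1 + p - p / q)"
  define c where "c x = (1 - t) *\<^sub>R x + t *\<^sub>R x0" for x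
  define S where "S x = cube (c x) (t * r)" for x
  have [measurable]: "c \<in> borel_measurable borel" unfolding c_def by measurable
  have L: "?L = (\<integral>\<^sup>+x. ennreal (t powr - (CARD('n) * p) * (8 * (t * r)) powr k) *
      (epowr (\<integral>\<^sup>+y\<in>S x. g y \<partial>lborel) p * ennreal ((2 * (4 * (t * r))) powr - k) * ennreal (m x powr p) * indicator (cube x0 r) x) \<partial>lborel)"
  proof (intro nn_integral_cong)
    fix x
    have "epowr (\<integral>\<^sup>+y\<in>cube x0 r. g ((1 - t) *\<^sub>R x + t *\<^sub>R y) \<partial>lborel) p
      = ennreal (t powr - (CARD('n) * p)) * epowr (\<integral>\<^sup>+y\<in>S x. g y \<partial>lborel) p"
      unfolding S_def c_def using t
      by (subst nn_integral_rescaled_cube) (simp_all add: epowr_mult epowr_ennreal powr_powr)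
    moreover have "ennreal (t powr - (CARD('n) * p) * (8 * (t * r)) powr k) * ennreal ((2 * (4 * (t * r))) powr - k) = ennreal (t powr - (CARD('n) * p))"
      using t r by (simp add: ennreal_mult[symmetric] mult.assoc powr_add[symmetric])
    moreover have "c1 * (X * c2 * M * I) = c1 * c2 * X * M * I" for c1 c2 X M I :: ennreal
      by (simp only: mult_ac)
    ultimately show "epowr (\<integral>\<^sup>+y\<in>cube x0 r. g ((1 - t) *\<^sub>R x + t *\<^sub>R y) \<partial>lborel) p * ennreal (m x powr p) * indicator (cube x0 r) x
      = ennreal (t powr - (CARD('n) * p) * (8 * (t * r)) powr k) *
      (epowr (\<integral>\<^sup>+y\<in>S x. g y \<partial>lborel) p * ennreal ((2 * (4 * (t * r))) powr - k) * ennreal (m x powr p) * indicator (cube x0 r) x)"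
      by (simp only:)
  qed
  have Rm: "{(x, y). y \<in> S x} \<in> sets (borel \<Otimes>\<^sub>M borel)"
  proof -
    have "Measurable.pred (borel \<Otimes>\<^sub>M borel) (\<lambda>z. snd z \<in> cube (c (fst z)) (t * r))" by measurable
    then show ?thesis by (simp add: pred_def space_pair_measure S_def case_prod_beta')
  qed
  have Sm [measurable]: "(\<lambda>(x, y). indicator (S x) y :: ennreal) \<in> borel_measurable (borel \<Otimes>\<^sub>M borel)"
    using Rm by (auto simp: case_prod_beta' space_pair_measure intro!: borel_measurable_indicator')
  have close: "\<bar>y $ i - x $ i\<bar> < 2 * (t * r)" if "x \<in> cube x0 r" "y \<in> S x" for x y i
  proof -
    have "\<bar>y $ i - c x $ i\<bar> < t * r" using that(2) by (simp add: S_def cube_def)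
    moreover have "c x $ i - x $ i = t * (x0 $ i - x $ i)" by (simp add: c_def algebra_simps)
    moreover have "\<bar>t * (x0 $ i - x $ i)\<bar> < t * r"
      using that(1) t by (simp add: cube_def abs_mult abs_minus_commute)
    ultimately show ?thesis by linarith
  qed
  have "?L = ennreal (t powr - (CARD('n) * p) * (8 * (t * r)) powr k) * (\<integral>\<^sup>+x\<in>cube x0 r. epowr (\<integral>\<^sup>+y\<in>S x. g y \<partial>lborel) p * ennreal ((2 * (4 * (t * r))) powr - k) * ennreal (m x powr p) \<partial>lborel)"
    unfolding L by (rule nn_integral_cmult) measurable
  also have "\<dots> \<le> ennreal (t powr - (CARD('n) * p) * (8 * (t * r)) powr k) * (ennreal (B powr p) * epowr ?G (p / q))"
    unfolding k_def
  proof (intro mult_left_mono moving_cubes_estimate[OF A _ m pq B, where s = "\<lambda>x. 4 * (t * r)" and S = S])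
    fix x assume x: "x \<in> cube x0 r"
    show "S x \<subseteq> cube x (4 * (t * r))"
    proof
      fix y assume y: "y \<in> S x"
      have "0 < t * r" using t r by simp
      then have "\<bar>y $ i - x $ i\<bar> < 4 * (t * r)" for i using close[OF x y, of i] by linarith
      then show "y \<in> cube x (4 * (t * r))" by (simp add: cube_def)
    qed
    show "S x \<subseteq> cube x0 r"
    proof
      fix y assume y: "y \<in> S x"
      have "\<bar>y $ i - x0 $ i\<bar> < r" for i
      proof -
        have "\<bar>y $ i - c x $ i\<bar> < t * r" using y by (simp add: S_def cube_def)
        moreover have "c x $ i - x0 $ i = (1 - t) * (x $ i - x0 $ i)" by (simp add: c_def algebra_simps)
        moreover have "\<bar>(1 - t) * (x $ i - x0 $ i)\<bar> \<le> (1 - t) * r"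
          using x t by (simp add: cube_def abs_mult mult_left_mono less_imp_le)
        moreover have "(1 - t) * r + t * r = r" by (simp add: algebra_simps)
        ultimately show ?thesis by linarith
      qed
      then show "y \<in> cube x0 r" by (simp add: cube_def)
    qed
  next
    fix x x' y assume "x \<in> cube x0 r" "x' \<in> cube x0 r" "y \<in> S x" "y \<in> S x'"
    then have "\<bar>x' $ i - x $ i\<bar> < 4 * (t * r)" for i
      using close[of x y i] close[of x' y i] by linarith
    then show "x' \<in> cube x (4 * (t * r))" by (simp add: cube_def)
  qed (use Rm t r in auto)
  also have "\<dots> = ennreal (t powr - (CARD('n) * p) * (8 * (t * r)) powr k * B powr p) * epowr ?G (p / q)"
    by (simp add: ennreal_mult mult.assoc)
  also have "t powr - (CARD('n) * p) * (8 * (t * r)) powr k * B powr p = t powr (- (CARD('n) * (p / q - 1))) * ((8 * r) powr k * B powr p)"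
  proof -
    have "(8 * (t * r)) powr k = t powr k * (8 * r) powr k"
      using t r by (simp add: powr_mult[symmetric] mult_ac)
    moreover have "t powr - (CARD('n) * p) * t powr k = t powr (- (CARD('n) * (p / q - 1)))"
      by (simp add: powr_add[symmetric] k_def algebra_simps)
    moreover have "a * (b * c) * d = a * b * (c * d)" for a b c d :: real
      by (simp only: mult_ac)
    ultimately show ?thesis by (simp only:)
  qed
  finally show ?thesis by (simp add: k_def)
qed

text \<open>The fixed-scale estimates are integrated over \<open>t\<close>. By \<open>np\<close> the
  power of \<open>t\<close> is at most \<open>t powr (- 1 / 2)\<close>, whose integral over the unit
  interval is the leading factor 2.\<close>

theorem weighted_Poincare:
  fixes m v :: "real^'n \<Rightarrow> real" and p q B r :: real
  assumes A: "Apq m p q B" and mm [measurable]: "m \<in> borel_measurable borel" and m: "\<And>x. 0 < m x"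
    and pq: "1 < q" "q \<le> p" and np: "CARD('n) * (p / q - 1) \<le> 1 / 2" and B: "0 \<le> B" and r: "0 < r"
    and v: "C_k (Suc 0) v"
  shows "(\<integral>\<^sup>+x\<in>cube x0 r. epowr (\<integral>\<^sup>+y\<in>cube x0 r. ennreal \<bar>v x - v y\<bar> \<partial>lborel) p * ennreal (m x powr p) \<partial>lborel)
    \<le> ennreal (2 * (2 * real CARD('n)) powr p * 8 powr (real CARD('n) * p) * B powr p * r powr (p + real CARD('n) * (1 + p - p / q))) *
      epowr (\<integral>\<^sup>+y\<in>cube x0 r. ennreal (norm (grad v y) powr q * m y powr q) \<partial>lborel) (p / q)"
proof -
  define N where "N = real CARD('n)"
  define k where "k = N * (1 + p - p / q)"
  define Q where "Q = cube x0 r"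
  define g where "g x = ennreal (norm (grad v x))" for x
  define G where "G = (\<integral>\<^sup>+y\<in>Q. epowr (g y) q * ennreal (m y powr q) \<partial>lborel)"
  define D where "D = 2 * N * r"
  have D: "0 < D" using r by (simp add: D_def N_def)
  have [measurable]: "grad v \<in> borel_measurable borel"
    using C_k_grad_continuous[OF v] by (rule borel_measurable_continuous_onI)
  have [measurable]: "v \<in> borel_measurable borel"
    using C_k_continuous[OF v] by (rule borel_measurable_continuous_onI)
  have gm [measurable]: "g \<in> borel_measurable borel" unfolding g_def by measurable
  have [measurable]: "Q \<in> sets borel" by (simp add: Q_def)
  have G: "G = (\<integral>\<^sup>+y\<in>cube x0 r. ennreal (norm (grad v y) powr q * m y powr q) \<partial>lborel)"
    by (simp add: G_def Q_def g_def epowr_ennreal ennreal_mult)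
  define J where "J t x = (\<integral>\<^sup>+y\<in>Q. g ((1 - t) *\<^sub>R x + t *\<^sub>R y) \<partial>lborel)" for t x
  have [measurable]: "(\<lambda>(t, x). J t x) \<in> borel_measurable (borel \<Otimes>\<^sub>M borel)"
    unfolding J_def by measurable
  have [measurable]: "J t \<in> borel_measurable borel" for t
    unfolding J_def[abs_def] by measurable
  have [measurable]: "(\<lambda>t. J t x) \<in> borel_measurable borel" for x
    unfolding J_def by measurable
  \<comment> \<open>Segment estimate and Fubini's theorem, then Jensen's inequality in
    \<open>t\<close>, which loses nothing on an interval of length 1.\<close>
  have pw: "epowr (\<integral>\<^sup>+y\<in>Q. ennreal \<bar>v x - v y\<bar> \<partial>lborel) p \<le> ennreal (D powr p) * (\<integral>\<^sup>+t\<in>{0..1}. epowr (J t x) p \<partial>lborel)"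
    if x: "x \<in> Q" for x
  proof -
    have "(\<integral>\<^sup>+y\<in>Q. ennreal \<bar>v x - v y\<bar> \<partial>lborel) \<le> (\<integral>\<^sup>+y. (\<integral>\<^sup>+t. ennreal D * (g ((1 - t) *\<^sub>R x + t *\<^sub>R y) * indicator Q y * indicator {0..1} t) \<partial>lborel) \<partial>lborel)"
    proof (intro nn_integral_mono)
      fix y
      show "ennreal \<bar>v x - v y\<bar> * indicator Q y \<le> (\<integral>\<^sup>+t. ennreal D * (g ((1 - t) *\<^sub>R x + t *\<^sub>R y) * indicator Q y * indicator {0..1} t) \<partial>lborel)"
      proof (cases "y \<in> Q")
        case True
        have "ennreal \<bar>v x - v y\<bar> \<le> ennreal (norm (y - x)) * (\<integral>\<^sup>+t\<in>{0..1}. g ((1 - t) *\<^sub>R x + t *\<^sub>R y) \<partial>lborel)"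
          unfolding g_def by (rule C1_segment_estimate[OF v])
        also have "\<dots> \<le> ennreal D * (\<integral>\<^sup>+t\<in>{0..1}. g ((1 - t) *\<^sub>R x + t *\<^sub>R y) \<partial>lborel)"
          using norm_diff_cube_le[of x x0 r y] x True
          by (intro mult_right_mono ennreal_leI) (auto simp: Q_def D_def N_def)
        also have "\<dots> = (\<integral>\<^sup>+t. ennreal D * (g ((1 - t) *\<^sub>R x + t *\<^sub>R y) * indicator {0..1} t) \<partial>lborel)"
          by (rule nn_integral_cmult[symmetric]) measurable
        finally show ?thesis using True by simp
      qed simp
    qed
    also have "\<dots> = (\<integral>\<^sup>+t. (\<integral>\<^sup>+y. ennreal D * (g ((1 - t) *\<^sub>R x + t *\<^sub>R y) * indicator Q y * indicator {0..1} t) \<partial>lborel) \<partial>lborel)"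
      by (rule lborel_pair.Fubini') measurable
    also have "\<dots> = (\<integral>\<^sup>+t. ennreal D * (J t x * indicator {0..1} t) \<partial>lborel)"
      unfolding J_def by (intro nn_integral_cong)
        (subst nn_integral_cmult, measurable, subst nn_integral_multc[symmetric], measurable)
    also have "\<dots> = ennreal D * (\<integral>\<^sup>+t\<in>{0..1}. J t x \<partial>lborel)"
      by (rule nn_integral_cmult) measurable
    finally have "epowr (\<integral>\<^sup>+y\<in>Q. ennreal \<bar>v x - v y\<bar> \<partial>lborel) p \<le> epowr (ennreal D * (\<integral>\<^sup>+t\<in>{0..1}. J t x \<partial>lborel)) p"
      using pq by (intro epowr_mono) auto
    also have "\<dots> = ennreal (D powr p) * epowr (\<integral>\<^sup>+t\<in>{0..1}. J t x \<partial>lborel) p"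
      using D by (simp add: epowr_mult epowr_ennreal)
    also have "epowr (\<integral>\<^sup>+t\<in>{0..1}. J t x \<partial>lborel) p \<le> ennreal (1 powr (p - 1)) * (\<integral>\<^sup>+t\<in>{0..1}. epowr (J t x) p \<partial>lborel)"
      by (rule nn_integral_Jensen) (use pq in auto)
    finally show ?thesis by (simp add: mult_left_mono)
  qed
  have "(\<integral>\<^sup>+x\<in>Q. epowr (\<integral>\<^sup>+y\<in>Q. ennreal \<bar>v x - v y\<bar> \<partial>lborel) p * ennreal (m x powr p) \<partial>lborel)
    \<le> (\<integral>\<^sup>+x. (\<integral>\<^sup>+t. ennreal (D powr p) * (epowr (J t x) p * ennreal (m x powr p) * indicator Q x * indicator {0..1} t) \<partial>lborel) \<partial>lborel)"
  proof (intro nn_integral_mono)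
    fix x
    show "epowr (\<integral>\<^sup>+y\<in>Q. ennreal \<bar>v x - v y\<bar> \<partial>lborel) p * ennreal (m x powr p) * indicator Q x
      \<le> (\<integral>\<^sup>+t. ennreal (D powr p) * (epowr (J t x) p * ennreal (m x powr p) * indicator Q x * indicator {0..1} t) \<partial>lborel)"
    proof (cases "x \<in> Q")
      case True
      have "epowr (\<integral>\<^sup>+y\<in>Q. ennreal \<bar>v x - v y\<bar> \<partial>lborel) p * ennreal (m x powr p)
        \<le> ennreal (D powr p) * (\<integral>\<^sup>+t\<in>{0..1}. epowr (J t x) p \<partial>lborel) * ennreal (m x powr p)"
        by (intro mult_right_mono pw True) auto
      also have "\<dots> = ennreal (D powr p) * (\<integral>\<^sup>+t. epowr (J t x) p * indicator {0..1} t * ennreal (m x powr p) \<partial>lborel)"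
        by (subst nn_integral_multc) (measurable, simp add: mult.assoc)
      also have "\<dots> = (\<integral>\<^sup>+t. ennreal (D powr p) * (epowr (J t x) p * indicator {0..1} t * ennreal (m x powr p)) \<partial>lborel)"
        by (rule nn_integral_cmult[symmetric]) measurable
      finally show ?thesis using True by (simp add: mult_ac)
    qed simp
  qed
  also have "\<dots> = (\<integral>\<^sup>+t. (\<integral>\<^sup>+x. ennreal (D powr p) * (epowr (J t x) p * ennreal (m x powr p) * indicator Q x * indicator {0..1} t) \<partial>lborel) \<partial>lborel)"
    by (rule lborel_pair.Fubini') measurable
  also have "\<dots> \<le> (\<integral>\<^sup>+t. ennreal (D powr p * ((8 * r) powr k * B powr p)) * epowr G (p / q) * (ennreal (t powr (- 1 / 2)) * indicator {0..1} t) \<partial>lborel)"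
  proof (intro nn_integral_mono_AE)
    \<comment> \<open>At \<open>t = 0\<close> the substitution degenerates, so this one value is
      discarded.\<close>
    have "AE t in lborel. t \<noteq> (0::real)" by (rule AE_lborel_singleton)
    then show "AE t in lborel. (\<integral>\<^sup>+x. ennreal (D powr p) * (epowr (J t x) p * ennreal (m x powr p) * indicator Q x * indicator {0..1} t) \<partial>lborel)
      \<le> ennreal (D powr p * ((8 * r) powr k * B powr p)) * epowr G (p / q) * (ennreal (t powr (- 1 / 2)) * indicator {0..1} t)"
    proof eventually_elim
      case (elim t)
      show ?case
      proof (cases "t \<in> {0..1}")
        case True
        with elim have t: "0 < t" "t \<le> 1" by auto
        have "(\<integral>\<^sup>+x. ennreal (D powr p) * (epowr (J t x) p * ennreal (m x powr p) * indicator Q x * indicator {0..1} t) \<partial>lborel)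
          = ennreal (D powr p) * (\<integral>\<^sup>+x\<in>Q. epowr (J t x) p * ennreal (m x powr p) \<partial>lborel)"
          using True by (simp add: nn_integral_cmult)
        also have "\<dots> \<le> ennreal (D powr p) * (ennreal (t powr (- (N * (p / q - 1))) * ((8 * r) powr k * B powr p)) * epowr G (p / q))"
          unfolding J_def N_def k_def Q_def G_def
          by (intro mult_left_mono Poincare_fixed_scale[OF A mm m pq B r gm t]) simp
        also have "\<dots> \<le> ennreal (D powr p) * (ennreal (t powr (- 1 / 2) * ((8 * r) powr k * B powr p)) * epowr G (p / q))"
        proof -
          have "t powr (- (N * (p / q - 1))) \<le> t powr (- 1 / 2)"
            using t np by (intro powr_mono') (auto simp: N_def)
          then show ?thesis by (intro mult_left_mono mult_right_mono ennreal_leI) auto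
        qed
        also have "\<dots> = ennreal (D powr p * ((8 * r) powr k * B powr p)) * epowr G (p / q) * ennreal (t powr (- 1 / 2))"
          by (simp add: ennreal_mult mult_ac)
        finally show ?thesis using True by simp
      qed simp
    qed
  qed
  also have "\<dots> = ennreal (D powr p * ((8 * r) powr k * B powr p)) * epowr G (p / q) * (\<integral>\<^sup>+t. ennreal (t powr (- 1 / 2)) * indicator {0..1} t \<partial>lborel)"
    by (rule nn_integral_cmult) measurable
  also have "(\<integral>\<^sup>+t. ennreal (t powr (- 1 / 2)) * indicator {0..1} t \<partial>lborel) = ennreal 2"
    using has_integral_powr_from_0[of "- 1 / 2" 1]
    by (intro nn_integral_has_integral_lebesgue') auto
  also have "ennreal (D powr p * ((8 * r) powr k * B powr p)) * epowr G (p / q) * ennreal 2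
    = ennreal (2 * (D powr p * ((8 * r) powr k * B powr p))) * epowr G (p / q)"
    by (simp add: ennreal_mult mult_ac)
  also have "\<dots> \<le> ennreal (2 * (2 * N) powr p * 8 powr (N * p) * B powr p * r powr (p + k)) * epowr G (p / q)"
  proof (intro mult_right_mono ennreal_leI)
    \<comment> \<open>Since \<open>p / q\<close> is at least 1, \<open>k\<close> is at most
      \<open>N * p\<close>; this removes \<open>q\<close> from the numerical constant.\<close>
    have "(8::real) powr k \<le> 8 powr (N * p)"
      using pq by (intro powr_mono) (auto simp: k_def N_def field_simps)
    then have "8 powr k * (2 * ((2 * N) powr p * r powr p * (r powr k * B powr p))) \<le> 8 powr (N * p) * (2 * ((2 * N) powr p * r powr p * (r powr k * B powr p)))"
      by (intro mult_right_mono) auto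
    then show "2 * (D powr p * ((8 * r) powr k * B powr p)) \<le> 2 * (2 * N) powr p * 8 powr (N * p) * B powr p * r powr (p + k)"
      using r by (simp add: D_def N_def powr_mult powr_add mult_ac)
  qed simp
  finally show ?thesis unfolding G Q_def N_def k_def .
qed

section \<open>Lipschitz extension across the boundary of a cube\<close>

lemma infnorm_eq_Max: "infnorm (x :: real^'n) = Max (range (\<lambda>i. \<bar>x $ i\<bar>))"
proof -
  have B: "Basis = range (\<lambda>i::'n. axis i (1::real))" by (auto simp: Basis_vec_def)
  have "(\<lambda>i. \<bar>x \<bullet> i\<bar>) ` Basis = range (\<lambda>i. \<bar>x $ i\<bar>)"
    unfolding B image_image by (simp add: inner_axis)
  then show ?thesis by (simp only: infnorm_Max)
qed

lemma infnorm_less_iff: "infnorm (x :: real^'n) < c \<longleftrightarrow> (\<forall>i. \<bar>x $ i\<bar> < c)"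
  by (simp add: infnorm_eq_Max)

lemma infnorm_le_iff: "infnorm (x :: real^'n) \<le> c \<longleftrightarrow> (\<forall>i. \<bar>x $ i\<bar> \<le> c)"
  by (simp add: infnorm_eq_Max)

lemma in_cube_iff: "y \<in> cube x r \<longleftrightarrow> infnorm (y - x) < r"
  by (simp add: cube_def infnorm_less_iff)

lemma norm_le_infnorm_cart: "norm (x :: real^'n) \<le> real CARD('n) * infnorm x"
proof -
  have "norm x \<le> (\<Sum>i\<in>UNIV. \<bar>x $ i\<bar>)" by (rule norm_le_l1_cart)
  also have "(\<Sum>i\<in>UNIV. \<bar>x $ i\<bar>) \<le> (\<Sum>i\<in>(UNIV :: 'n set). infnorm x)"
    by (intro sum_mono component_le_infnorm_cart)
  finally show ?thesis by simp
qed

lemma measurable_infnorm [measurable]: "(infnorm :: real^'n \<Rightarrow> real) \<in> borel_measurable borel"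
  by (intro borel_measurable_continuous_onI continuous_on_infnorm continuous_on_id)

locale extension_geometry =
  fixes x0 :: "real^'n" and r \<epsilon> :: real
  assumes r: "0 < r" and \<epsilon>: "0 < \<epsilon>" "\<epsilon> \<le> r / 8"
begin

text \<open>The extension at \<open>x\<close> averages over \<open>cube (z x) (s x)\<close>. This cube lies in \<open>cube x0 r\<close>, its size is
  comparable to \<open>\<epsilon>\<close> plus the distance of \<open>x\<close> from \<open>cube x0 r\<close>, and it is contained in a cube around \<open>x\<close> of comparable
  size, so averages over it are controlled by the moving cubes estimate.\<close>

definition \<delta> :: "real^'n \<Rightarrow> real" where "\<delta> x = max 0 (infnorm (x - x0) - r)"

definition s :: "real^'n \<Rightarrow> real" where "s x = \<epsilon> + min (\<delta> x) r / 8"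

definition z :: "real^'n \<Rightarrow> real^'n" where
  "z x = (\<chi> i. x0 $ i + max (- (r - 2 * s x)) (min (r - 2 * s x) (x $ i - x0 $ i)))"

text \<open>A cutoff in the supremum norm: 1 up to distance \<open>5 / 4 * r\<close> from
  \<open>x0\<close>, and 0 from distance \<open>3 / 2 * r\<close> on.\<close>

definition \<eta> :: "real^'n \<Rightarrow> real" where
  "\<eta> x = max 0 (min 1 (6 - 4 * infnorm (x - x0) / r))"

lemma infnorm_lipschitz: "\<bar>infnorm (x - x0) - infnorm (y - x0)\<bar> \<le> infnorm (x - y)"
  using absdiff_infnorm[of "x - x0" "y - x0"] by simp

lemma s_bounds: "\<epsilon> \<le> s x" "s x \<le> r / 4" "0 < s x"
proof -
  have "0 \<le> min (\<delta> x) r" "min (\<delta> x) r \<le> r" using r by (auto simp: \<delta>_def)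
  moreover obtain d where "d = min (\<delta> x) r" by blast
  ultimately show "\<epsilon> \<le> s x" "s x \<le> r / 4" "0 < s x" using \<epsilon> unfolding s_def by auto
qed

text \<open>The small slope comes from the factor 1/8 in \<open>s\<close>; it keeps the averaging
  cubes of nearby points inside one common cube.\<close>

lemma s_lipschitz: "\<bar>s x - s y\<bar> \<le> infnorm (x - y) / 8"
proof -
  have "\<bar>min (\<delta> x) r - min (\<delta> y) r\<bar> \<le> \<bar>\<delta> x - \<delta> y\<bar>" by (auto simp: min_def)
  moreover have "\<bar>\<delta> x - \<delta> y\<bar> \<le> \<bar>infnorm (x - x0) - infnorm (y - x0)\<bar>" by (auto simp: \<delta>_def max_def)
  ultimately have "\<bar>min (\<delta> x) r - min (\<delta> y) r\<bar> / 8 \<le> infnorm (x - y) / 8"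
    using infnorm_lipschitz[of x y] by (meson divide_right_mono order_trans zero_le_numeral)
  moreover have "s x - s y = (min (\<delta> x) r - min (\<delta> y) r) / 8" by (simp add: s_def diff_divide_distrib)
  then have "\<bar>s x - s y\<bar> = \<bar>min (\<delta> x) r - min (\<delta> y) r\<bar> / 8" by (simp only: abs_divide abs_numeral)
  ultimately show ?thesis by simp
qed

text \<open>A clamped coordinate moves with slope 1, and the clamping level
  \<open>r - 2 * s x\<close> with slope at most 2/8; together 5/4.\<close>

lemma z_lipschitz: "infnorm (z x - z y) \<le> 5 / 4 * infnorm (x - y)"
  unfolding infnorm_le_iff
proof
  fix i
  have "\<bar>x $ i - y $ i\<bar> \<le> infnorm (x - y)"
    using component_le_infnorm_cart[of "x - y" i] by simp
  moreover have "\<bar>(z x - z y) $ i\<bar> \<le> \<bar>x $ i - y $ i\<bar> + 2 * \<bar>s x - s y\<bar>"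
  proof -
    have 1: "\<bar>max (- a) (min a c) - max (- b) (min b d)\<bar> \<le> \<bar>c - d\<bar> + \<bar>a - b\<bar>" for a b c d :: real
      by (auto simp: min_def max_def)
    have "(z x - z y) $ i = max (- (r - 2 * s x)) (min (r - 2 * s x) (x $ i - x0 $ i)) - max (- (r - 2 * s y)) (min (r - 2 * s y) (y $ i - x0 $ i))"
      by (simp add: z_def)
    then have "\<bar>(z x - z y) $ i\<bar> \<le> \<bar>(x $ i - x0 $ i) - (y $ i - x0 $ i)\<bar> + \<bar>(r - 2 * s x) - (r - 2 * s y)\<bar>"
      by (simp only: 1)
    also have "(x $ i - x0 $ i) - (y $ i - x0 $ i) = x $ i - y $ i" by simp
    also have "(r - 2 * s x) - (r - 2 * s y) = (- 2) * (s x - s y)" by simp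
    also have "\<bar>(- 2) * (s x - s y)\<bar> = 2 * \<bar>s x - s y\<bar>" by (simp only: abs_mult abs_neg_numeral)
    finally show ?thesis .
  qed
  ultimately have bnd: "\<bar>x $ i - y $ i\<bar> \<le> infnorm (x - y)" "\<bar>(z x - z y) $ i\<bar> \<le> \<bar>x $ i - y $ i\<bar> + 2 * \<bar>s x - s y\<bar>"
    by blast+
  show "\<bar>(z x - z y) $ i\<bar> \<le> 5 / 4 * infnorm (x - y)"
  proof -
    have "c \<le> 5 / 4 * d" if "a \<le> d" "c \<le> a + 2 * b" "b \<le> d / 8" for a b c d :: real
      using that by linarith
    with bnd s_lipschitz[of x y] show ?thesis by blast
  qed
qed

lemma \<eta>_lipschitz: "\<bar>\<eta> x - \<eta> y\<bar> \<le> 4 / r * infnorm (x - y)"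
proof -
  have "\<bar>\<eta> x - \<eta> y\<bar> \<le> \<bar>4 * infnorm (x - x0) / r - 4 * infnorm (y - x0) / r\<bar>"
  proof -
    have 1: "\<bar>max 0 (min 1 a) - max 0 (min 1 b)\<bar> \<le> \<bar>a - b\<bar>" for a b :: real
      by (auto simp: min_def max_def)
    show ?thesis unfolding \<eta>_def by (rule order_trans[OF 1]) simp
  qed
  also have "\<dots> = 4 / r * \<bar>infnorm (x - x0) - infnorm (y - x0)\<bar>"
  proof -
    have "4 * a / r - 4 * b / r = 4 / r * (a - b)" for a b :: real by (simp add: right_diff_distrib)
    then show ?thesis using r by (simp only: abs_mult) simp
  qed
  also have "\<dots> \<le> 4 / r * infnorm (x - y)"
    using infnorm_lipschitz r by (intro mult_left_mono) auto
  finally show ?thesis .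
qed

lemma \<eta>_bounds: "0 \<le> \<eta> x" "\<eta> x \<le> 1" by (auto simp: \<eta>_def)

lemma z_depth: "infnorm (z x - x0) \<le> r - 2 * s x"
  unfolding infnorm_le_iff z_def using s_bounds[of x] r by (auto simp: min_def max_def)

text \<open>Clamping moves a coordinate by at most \<open>\<delta> x + 2 * s x\<close>, and in the
  double cube \<open>\<delta> x\<close> is at most \<open>r\<close>, hence at most
  \<open>8 * s x\<close>.\<close>

lemma z_close: "infnorm (z x - x) \<le> 10 * s x" if "infnorm (x - x0) < 2 * r"
  unfolding infnorm_le_iff
proof
  fix i
  have "\<bar>x $ i - x0 $ i\<bar> \<le> infnorm (x - x0)"
    using component_le_infnorm_cart[of "x - x0" i] by simp
  then have "\<bar>x $ i - x0 $ i\<bar> \<le> r + \<delta> x" by (simp add: \<delta>_def)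
  moreover have "\<bar>max (- \<rho>) (min \<rho> c) - c\<bar> \<le> max 0 (\<bar>c\<bar> - \<rho>)" if "0 \<le> \<rho>" for \<rho> c :: real
    using that by (auto simp: min_def max_def)
  from this[of "r - 2 * s x" "x $ i - x0 $ i"]
  have "\<bar>(z x - x) $ i\<bar> \<le> max 0 (\<bar>x $ i - x0 $ i\<bar> - (r - 2 * s x))"
    using s_bounds[of x] r by (simp add: z_def algebra_simps)
  moreover have "\<delta> x \<le> r" using that r by (simp add: \<delta>_def)
  then have "\<delta> x \<le> 8 * s x" using \<epsilon> by (simp add: s_def)
  ultimately show "\<bar>(z x - x) $ i\<bar> \<le> 10 * s x"
  proof -
    assume bnd: "\<bar>x $ i - x0 $ i\<bar> \<le> r + \<delta> x" "\<delta> x \<le> 8 * s x" "\<bar>(z x - x) $ i\<bar> \<le> max 0 (\<bar>x $ i - x0 $ i\<bar> - (r - 2 * s x))"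
    have "c \<le> 10 * d" if "a \<le> r + b" "b \<le> 8 * d" "c \<le> max 0 (a - (r - 2 * d))" "0 < d" for a b c d :: real
      using that by (simp add: max_def split: if_splits)
    with bnd s_bounds(3)[of x] show ?thesis by blast
  qed
qed

text \<open>The radius \<open>3 / 2 * s x\<close> uses up part of the margin \<open>2 * s x\<close>
  in the definition of \<open>z\<close> and leaves the depth \<open>s x / 2\<close> inside
  \<open>cube x0 r\<close>. This depth later makes scales comparable. The number 23/2 is 10 +
  3/2.\<close>

lemma near_subset:
  assumes "w \<in> cube (z x) (3 / 2 * s x)"
  shows "infnorm (w - x0) \<le> r - s x / 2" "infnorm (x - x0) < 2 * r \<Longrightarrow> infnorm (w - x) < 23 / 2 * s x"
proof -
  have w: "infnorm (w - z x) < 3 / 2 * s x" using assms by (simp add: in_cube_iff)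
  show "infnorm (w - x0) \<le> r - s x / 2"
    using infnorm_triangle[of "w - z x" "z x - x0"] w z_depth[of x] by simp
  show "infnorm (w - x) < 23 / 2 * s x" if "infnorm (x - x0) < 2 * r"
    using infnorm_triangle[of "w - z x" "z x - x"] w z_close[OF that] by simp
qed

text \<open>Since \<open>\<epsilon>\<close> is at most \<open>s x\<close>, moving by
  \<open>\<epsilon> / 8\<close> changes \<open>s\<close> by at most 1/64 and \<open>z\<close> by at
  most 5/32 of \<open>s x\<close>, and 65/64 + 5/32 stays below 3/2. All averaging cubes along the
  interpolation thus lie in one cube attached to \<open>x\<close>.\<close>

lemma interpolated_subset:
  assumes x1: "infnorm (x1 - x) < \<epsilon> / 8" and x2: "infnorm (x2 - x) < \<epsilon> / 8" and t: "0 \<le> t" "t \<le> 1"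
  shows "cube ((1 - t) *\<^sub>R z x1 + t *\<^sub>R z x2) ((1 - t) * s x1 + t * s x2) \<subseteq> cube (z x) (3 / 2 * s x)"
    and "s x / 2 \<le> (1 - t) * s x1 + t * s x2"
proof -
  have s1: "\<bar>s x1 - s x\<bar> \<le> s x / 64" "\<bar>s x2 - s x\<bar> \<le> s x / 64"
    using s_lipschitz[of x1 x] s_lipschitz[of x2 x] x1 x2 s_bounds[of x] by auto
  have eq: "(1 - t) * s x1 + t * s x2 = s x + (1 - t) * (s x1 - s x) + t * (s x2 - s x)"
    by (simp add: algebra_simps)
  have "\<bar>(1 - t) * (s x1 - s x)\<bar> \<le> (1 - t) * (s x / 64)" "\<bar>t * (s x2 - s x)\<bar> \<le> t * (s x / 64)"
    using t mult_left_mono[OF s1(1), of "1 - t"] mult_left_mono[OF s1(2), of t] by (simp_all add: abs_mult)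
  moreover have "(1 - t) * (s x / 64) + t * (s x / 64) = s x / 64" by (simp only: distrib_right[symmetric]) simp
  ultimately have st: "\<bar>(1 - t) * s x1 + t * s x2 - s x\<bar> \<le> s x / 64" unfolding eq by linarith
  then show "s x / 2 \<le> (1 - t) * s x1 + t * s x2" using s_bounds[of x] by linarith
  have z1: "infnorm (z x1 - z x) \<le> 5 / 32 * s x" "infnorm (z x2 - z x) \<le> 5 / 32 * s x"
    using z_lipschitz[of x1 x] z_lipschitz[of x2 x] x1 x2 s_bounds[of x] by auto
  show "cube ((1 - t) *\<^sub>R z x1 + t *\<^sub>R z x2) ((1 - t) * s x1 + t * s x2) \<subseteq> cube (z x) (3 / 2 * s x)"
  proof
    fix w assume w: "w \<in> cube ((1 - t) *\<^sub>R z x1 + t *\<^sub>R z x2) ((1 - t) * s x1 + t * s x2)"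
    have "infnorm ((1 - t) *\<^sub>R (z x1 - z x) + t *\<^sub>R (z x2 - z x)) \<le> (1 - t) * (5 / 32 * s x) + t * (5 / 32 * s x)"
      using t z1 infnorm_triangle[of "(1 - t) *\<^sub>R (z x1 - z x)" "t *\<^sub>R (z x2 - z x)"]
        mult_left_mono[OF z1(1), of "1 - t"] mult_left_mono[OF z1(2), of t]
      by (simp add: infnorm_mul)
    also have "(1 - t) * (5 / 32 * s x) + t * (5 / 32 * s x) = 5 / 32 * s x" by (simp only: distrib_right[symmetric]) simp
    finally have 1: "infnorm ((1 - t) *\<^sub>R z x1 + t *\<^sub>R z x2 - z x) \<le> 5 / 32 * s x"
      by (simp add: algebra_simps)
    define \<rho> where "\<rho> = (1 - t) * s x1 + t * s x2"
    have "\<rho> - s x \<le> s x / 64" using st unfolding \<rho>_def[symmetric] by (rule order_trans[OF abs_ge_self])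
    then have "infnorm (w - z x) < 65 / 64 * s x + 5 / 32 * s x"
      using infnorm_triangle[of "w - ((1 - t) *\<^sub>R z x1 + t *\<^sub>R z x2)" "(1 - t) *\<^sub>R z x1 + t *\<^sub>R z x2 - z x"] w 1
      unfolding in_cube_iff \<rho>_def[symmetric] by simp
    then show "w \<in> cube (z x) (3 / 2 * s x)" using s_bounds[of x] by (simp add: in_cube_iff)
  qed
qed

lemma s_cont: "continuous_on UNIV s"
  unfolding s_def \<delta>_def by (intro continuous_intros) auto

lemma s_measurable [measurable]: "s \<in> borel_measurable borel"
  unfolding s_def \<delta>_def by measurable

lemma z_measurable [measurable]: "z \<in> borel_measurable borel"
  unfolding z_def
  by (intro borel_measurable_continuous_onI continuous_on_vec_lambda continuous_intros s_cont)

text \<open>Points that share a \<open>y\<close> must have comparable \<open>s\<close>, for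
  different reasons inside and outside \<open>cube x0 r\<close>; hence the splitting into
  \<open>X1\<close> and \<open>X2\<close> and the factor 2. The ratio of scales is at most 23, and
  23/2 * 23 + 23/2 = 276 is the size of the enclosing cube in units of \<open>s x\<close>; 552 is
  twice that.\<close>

lemma moving_average_estimate:
  fixes m :: "real^'n \<Rightarrow> real" and h :: "real^'n \<Rightarrow> ennreal"
  assumes A: "Apq m q q B" and mm [measurable]: "m \<in> borel_measurable borel" and m: "\<And>x. 0 < m x"
    and q: "1 < q" and B: "0 \<le> B" and hm [measurable]: "h \<in> borel_measurable borel"
  shows "(\<integral>\<^sup>+x\<in>cube x0 (2 * r). epowr (ennreal (s x powr - real CARD('n)) * (\<integral>\<^sup>+y\<in>cube (z x) (3 / 2 * s x). h y \<partial>lborel)) q * ennreal (m x powr q) \<partial>lborel)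
    \<le> ennreal (2 * 552 powr (real CARD('n) * q) * B powr q) * (\<integral>\<^sup>+y\<in>cube x0 r. epowr (h y) q * ennreal (m y powr q) \<partial>lborel)"
proof -
  define N where "N = real CARD('n)"
  define G where "G = (\<integral>\<^sup>+y\<in>cube x0 r. epowr (h y) q * ennreal (m y powr q) \<partial>lborel)"
  define F where "F x = epowr (\<integral>\<^sup>+y\<in>cube (z x) (3 / 2 * s x). h y \<partial>lborel) q * ennreal ((2 * (276 * s x)) powr - (CARD('n) * (1 + q - q / q))) * ennreal (m x powr q)" for x
  have Rm: "{(x, y). y \<in> cube (z x) (3 / 2 * s x)} \<in> sets (borel \<Otimes>\<^sub>M borel)"
  proof -
    have "Measurable.pred (borel \<Otimes>\<^sub>M borel) (\<lambda>w. snd w \<in> cube (z (fst w)) (3 / 2 * s (fst w)))" by measurable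
    then show ?thesis by (simp add: pred_def space_pair_measure case_prod_beta')
  qed
  have [measurable]: "(\<lambda>(x, y). indicator (cube (z x) (3 / 2 * s x)) y :: ennreal) \<in> borel_measurable (borel \<Otimes>\<^sub>M borel)"
    using Rm by (auto simp: case_prod_beta' space_pair_measure intro!: borel_measurable_indicator')
  have [measurable]: "F \<in> borel_measurable borel" unfolding F_def by measurable
  have sub: "cube (z x) (3 / 2 * s x) \<subseteq> cube x (276 * s x)" "cube (z x) (3 / 2 * s x) \<subseteq> cube x0 r"
    if "infnorm (x - x0) < 2 * r" for x
  proof -
    show "cube (z x) (3 / 2 * s x) \<subseteq> cube x (276 * s x)"
    proof
      fix w assume "w \<in> cube (z x) (3 / 2 * s x)"
      from near_subset(2)[OF this that] show "w \<in> cube x (276 * s x)" using s_bounds(3)[of x] by (simp add: in_cube_iff)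
    qed
    show "cube (z x) (3 / 2 * s x) \<subseteq> cube x0 r"
    proof
      fix w assume "w \<in> cube (z x) (3 / 2 * s x)"
      from near_subset(1)[OF this] show "w \<in> cube x0 r" using s_bounds(3)[of x] by (simp add: in_cube_iff)
    qed
  qed
  define X1 where "X1 = {x. infnorm (x - x0) \<le> r}"
  define X2 where "X2 = {x. r < infnorm (x - x0) \<and> infnorm (x - x0) < 2 * r}"
  have X [measurable]: "X1 \<in> sets borel" "X2 \<in> sets borel"
    unfolding X1_def X2_def by measurable
  have X2r: "infnorm (x - x0) < 2 * r" if "x \<in> X1 \<or> x \<in> X2" for x using that r by (auto simp: X1_def X2_def)
  have main: "(\<integral>\<^sup>+x\<in>X. F x \<partial>lborel) \<le> ennreal (B powr q) * G"
    if X: "X = X1 \<or> X = X2" for X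
  proof -
    have "(\<integral>\<^sup>+x\<in>X. F x \<partial>lborel) \<le> ennreal (B powr q) * epowr G (q / q)"
      unfolding F_def G_def
    proof (rule moving_cubes_estimate[OF A mm m q order.refl B hm])
      show "X \<in> sets borel" using X by auto
      show "(\<lambda>x. 276 * s x) \<in> borel_measurable borel" by measurable
      fix x assume x: "x \<in> X"
      then have xr: "infnorm (x - x0) < 2 * r" using X X2r by blast
      show "0 < 276 * s x" using s_bounds[of x] by simp
      show "cube (z x) (3 / 2 * s x) \<subseteq> cube x (276 * s x)" "cube (z x) (3 / 2 * s x) \<subseteq> cube x0 r"
        using sub[OF xr] .
      fix x' y assume x': "x' \<in> X" and y: "y \<in> cube (z x) (3 / 2 * s x)" "y \<in> cube (z x') (3 / 2 * s x')"
      then have xr': "infnorm (x' - x0) < 2 * r" using X X2r by blast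
      have 1: "infnorm (y - x) < 23 / 2 * s x" "infnorm (y - x') < 23 / 2 * s x'"
        using near_subset(2) y xr xr' by blast+
      \<comment> \<open>On \<open>X1\<close> the scale is constantly \<open>\<epsilon>\<close>. On
        \<open>X2\<close> the point \<open>x\<close> is outside \<open>cube x0 r\<close>, while
        \<open>y\<close> has depth at least \<open>s x' / 2\<close> in it, so
        \<open>s x' / 2\<close> is at most the distance from \<open>y\<close> to \<open>x\<close>,
        which is below \<open>23 / 2 * s x\<close>.\<close>
      have "s x' \<le> 23 * s x"
        using X
      proof
        assume "X = X1"
        then have "s x = \<epsilon>" "s x' = \<epsilon>" using x x' r by (auto simp: X1_def s_def \<delta>_def)
        then show ?thesis using \<epsilon> by simp
      next
        assume "X = X2"
        then have "r < infnorm (x - x0)" using x by (simp add: X2_def)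
        also have "infnorm (x - x0) \<le> infnorm (x - y) + infnorm (y - x0)"
          using infnorm_triangle[of "x - y" "y - x0"] by simp
        also have "infnorm (x - y) = infnorm (y - x)" by (rule infnorm_sub)
        finally show ?thesis using 1 near_subset(1)[OF y(2)] by linarith
      qed
      moreover have "infnorm (x' - x) \<le> infnorm (y - x') + infnorm (y - x)"
        using infnorm_triangle[of "x' - y" "y - x"] infnorm_sub[of y x'] by simp
      ultimately have "infnorm (x' - x) < 276 * s x" using 1 by linarith
      then show "x' \<in> cube x (276 * s x)" by (simp add: in_cube_iff)
    qed (use Rm in auto)
    then show ?thesis using q by simp
  qed
  have "(\<integral>\<^sup>+x\<in>cube x0 (2 * r). epowr (ennreal (s x powr - real CARD('n)) * (\<integral>\<^sup>+y\<in>cube (z x) (3 / 2 * s x). h y \<partial>lborel)) q * ennreal (m x powr q) \<partial>lborel)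
    \<le> (\<integral>\<^sup>+x. ennreal (552 powr (N * q)) * (F x * indicator X1 x + F x * indicator X2 x) \<partial>lborel)"
  proof (intro nn_integral_mono)
    fix x
    have eq: "ennreal (s x powr (- N * q)) = ennreal (552 powr (N * q)) * ennreal ((2 * (276 * s x)) powr - (CARD('n) * (1 + q - q / q)))"
      using s_bounds[of x] q by (simp add: ennreal_mult[symmetric] powr_mult powr_minus N_def)
    have "epowr (ennreal (s x powr - N) * (\<integral>\<^sup>+y\<in>cube (z x) (3 / 2 * s x). h y \<partial>lborel)) q
      = ennreal (s x powr (- N * q)) * epowr (\<integral>\<^sup>+y\<in>cube (z x) (3 / 2 * s x). h y \<partial>lborel) q"
      by (simp add: epowr_mult epowr_ennreal powr_powr)
    then have "epowr (ennreal (s x powr - N) * (\<integral>\<^sup>+y\<in>cube (z x) (3 / 2 * s x). h y \<partial>lborel)) q * ennreal (m x powr q)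
      = ennreal (552 powr (N * q)) * F x"
      unfolding F_def eq by (simp only: mult_ac)
    then show "epowr (ennreal (s x powr - real CARD('n)) * (\<integral>\<^sup>+y\<in>cube (z x) (3 / 2 * s x). h y \<partial>lborel)) q * ennreal (m x powr q) * indicator (cube x0 (2 * r)) x
      \<le> ennreal (552 powr (N * q)) * (F x * indicator X1 x + F x * indicator X2 x)"
      by (auto simp: indicator_def N_def X1_def X2_def in_cube_iff)
  qed
  also have "\<dots> = ennreal (552 powr (N * q)) * ((\<integral>\<^sup>+x\<in>X1. F x \<partial>lborel) + (\<integral>\<^sup>+x\<in>X2. F x \<partial>lborel))"
    by (simp add: nn_integral_cmult nn_integral_add)
  also have "\<dots> \<le> ennreal (552 powr (N * q)) * (ennreal (B powr q) * G + ennreal (B powr q) * G)"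
    by (intro mult_left_mono add_mono main) auto
  also have "\<dots> = ennreal (2 * 552 powr (N * q) * B powr q) * G"
    by (simp add: ennreal_mult mult_2[symmetric] mult.assoc mult.left_commute)
  finally show ?thesis by (simp add: G_def N_def)
qed

end

section \<open>Integrals of continuous functions over cubes\<close>

lemma set_integrable_cube:
  fixes f :: "real^'n \<Rightarrow> real"
  assumes "continuous_on UNIV f"
  shows "set_integrable lborel (cube c \<rho>) f"
proof -
  let ?S = "cbox (c - (\<chi> i. \<rho>)) (c + (\<chi> i. \<rho>))"
  have "set_integrable lborel ?S f"
    unfolding set_integrable_def
    by (rule borel_integrable_compact) (use assms in \<open>auto intro: continuous_on_subset\<close>)
  then show ?thesis
    by (rule set_integrable_subset) (auto simp: cube_eq_box box_subset_cbox)
qed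

lemma nn_integral_cube_finite:
  fixes f :: "real^'n \<Rightarrow> real"
  assumes "continuous_on UNIV f"
  shows "(\<integral>\<^sup>+x\<in>cube c \<rho>. ennreal (f x) \<partial>lborel) < top"
proof -
  have "(\<integral>\<^sup>+x\<in>cube c \<rho>. ennreal (f x) \<partial>lborel) \<le> (\<integral>\<^sup>+x. ennreal (norm (indicator (cube c \<rho>) x *\<^sub>R f x)) \<partial>lborel)"
    by (intro nn_integral_mono) (auto simp: indicator_def intro: ennreal_leI)
  also have "\<dots> < top"
    using set_integrable_cube[OF assms, of c \<rho>] unfolding set_integrable_def integrable_iff_bounded by simp
  finally show ?thesis .
qed

lemma set_integral_cube_abs_le:
  fixes f :: "real^'n \<Rightarrow> real"
  assumes "continuous_on UNIV f"
  shows "ennreal \<bar>LINT y:cube c \<rho>|lborel. f y\<bar> \<le> (\<integral>\<^sup>+y\<in>cube c \<rho>. ennreal \<bar>f y\<bar> \<partial>lborel)"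
proof -
  have "ennreal \<bar>LINT y:cube c \<rho>|lborel. f y\<bar> \<le> (\<integral>\<^sup>+x. ennreal (norm (indicator (cube c \<rho>) x *\<^sub>R f x)) \<partial>lborel)"
    using integral_norm_bound_ennreal[OF set_integrable_cube[OF assms, of c \<rho>, unfolded set_integrable_def]]
    by (simp add: set_lebesgue_integral_def)
  also have "\<dots> = (\<integral>\<^sup>+y\<in>cube c \<rho>. ennreal \<bar>f y\<bar> \<partial>lborel)"
    by (intro nn_integral_cong) (auto simp: indicator_def)
  finally show ?thesis .
qed

lemma emeasure_unit_cube: "emeasure lborel (cube (c :: real^'n) 1) = ennreal (2 powr real CARD('n))"
  by (simp add: emeasure_cube)

context extension_geometry begin

text \<open>The average of \<open>v\<close> over \<open>cube (z x) (s x)\<close>, pulled back to the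
  unit cube so that the averages at two points can be subtracted under one integral.\<close>

definition ext :: "(real^'n \<Rightarrow> real) \<Rightarrow> real^'n \<Rightarrow> real" where
  "ext v x = (LINT y:cube 0 1|lborel. v (z x + s x *\<^sub>R y)) / 2 powr real CARD('n)"

lemma ext_diff:
  assumes v: "continuous_on UNIV v"
  shows "ennreal \<bar>ext v x1 - ext v x2\<bar> \<le> ennreal (2 powr - real CARD('n)) *
    (\<integral>\<^sup>+y\<in>cube 0 1. ennreal \<bar>v (z x1 + s x1 *\<^sub>R y) - v (z x2 + s x2 *\<^sub>R y)\<bar> \<partial>lborel)"
    and "ennreal \<bar>c - ext v x2\<bar> \<le> ennreal (2 powr - real CARD('n)) *
    (\<integral>\<^sup>+y\<in>cube 0 1. ennreal \<bar>c - v (z x2 + s x2 *\<^sub>R y)\<bar> \<partial>lborel)"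
proof -
  have cont: "continuous_on UNIV (\<lambda>y. v (z x + s x *\<^sub>R y))" for x
    by (intro continuous_on_compose2[OF v] continuous_intros) auto
  note int = set_integrable_cube[OF cont, of 0 1] set_integrable_cube[OF continuous_on_const, of 0 1]
  have "ext v x1 - ext v x2 = 2 powr - real CARD('n) * (LINT y:cube 0 1|lborel. v (z x1 + s x1 *\<^sub>R y) - v (z x2 + s x2 *\<^sub>R y))"
    by (subst set_integral_diff[OF int(1) int(1)]) (simp add: ext_def powr_minus field_simps)
  then have "ennreal \<bar>ext v x1 - ext v x2\<bar> = ennreal (2 powr - real CARD('n)) * ennreal \<bar>LINT y:cube 0 1|lborel. v (z x1 + s x1 *\<^sub>R y) - v (z x2 + s x2 *\<^sub>R y)\<bar>"
    by (simp add: abs_mult ennreal_mult)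
  also have "\<dots> \<le> ennreal (2 powr - real CARD('n)) * (\<integral>\<^sup>+y\<in>cube 0 1. ennreal \<bar>v (z x1 + s x1 *\<^sub>R y) - v (z x2 + s x2 *\<^sub>R y)\<bar> \<partial>lborel)"
    by (intro mult_left_mono set_integral_cube_abs_le continuous_on_diff cont) simp
  finally show "ennreal \<bar>ext v x1 - ext v x2\<bar> \<le> \<dots>" .
  have "(LINT y:cube (0 :: real^'n) 1|lborel. c) = 2 powr real CARD('n) * c"
    using emeasure_unit_cube[of "0 :: real^'n"]
    by (simp add: set_lebesgue_integral_def measure_def)
  then have "c - ext v x2 = 2 powr - real CARD('n) * (LINT y:cube 0 1|lborel. c - v (z x2 + s x2 *\<^sub>R y))"
    by (subst set_integral_diff[OF int(2) int(1)]) (simp add: ext_def powr_minus field_simps)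
  then have "ennreal \<bar>c - ext v x2\<bar> = ennreal (2 powr - real CARD('n)) * ennreal \<bar>LINT y:cube 0 1|lborel. c - v (z x2 + s x2 *\<^sub>R y)\<bar>"
    by (simp add: abs_mult ennreal_mult)
  also have "\<dots> \<le> ennreal (2 powr - real CARD('n)) * (\<integral>\<^sup>+y\<in>cube 0 1. ennreal \<bar>c - v (z x2 + s x2 *\<^sub>R y)\<bar> \<partial>lborel)"
    by (intro mult_left_mono set_integral_cube_abs_le continuous_on_diff cont continuous_on_const) simp
  finally show "ennreal \<bar>c - ext v x2\<bar> \<le> \<dots>" .
qed

text \<open>Passing back from the unit cube costs the radius to the power \<open>- CARD('n)\<close>,
  and the radius is at least \<open>s x / 2\<close>. The interpolated centre and radius cover both a
  single average, with \<open>x1 = x2\<close>, and the segments between two averages.\<close>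

lemma rescaled_average_le:
  fixes g :: "real^'n \<Rightarrow> ennreal"
  assumes [measurable]: "g \<in> borel_measurable borel"
    and x1: "infnorm (x1 - x) < \<epsilon> / 8" and x2: "infnorm (x2 - x) < \<epsilon> / 8" and t: "0 \<le> t" "t \<le> 1"
  shows "(\<integral>\<^sup>+y\<in>cube 0 1. g (((1 - t) *\<^sub>R z x1 + t *\<^sub>R z x2) + ((1 - t) * s x1 + t * s x2) *\<^sub>R y) \<partial>lborel)
    \<le> ennreal (2 powr real CARD('n) * s x powr - real CARD('n)) * (\<integral>\<^sup>+y\<in>cube (z x) (3 / 2 * s x). g y \<partial>lborel)"
proof -
  define c where "c = (1 - t) *\<^sub>R z x1 + t *\<^sub>R z x2"
  define \<rho> where "\<rho> = (1 - t) * s x1 + t * s x2"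
  have sub: "cube c \<rho> \<subseteq> cube (z x) (3 / 2 * s x)" and \<rho>: "s x / 2 \<le> \<rho>"
    using interpolated_subset[OF x1 x2 t] by (simp_all add: c_def \<rho>_def)
  have \<rho>0: "0 < \<rho>" using \<rho> s_bounds(3)[of x] by simp
  have "(\<integral>\<^sup>+y\<in>cube 0 1. g (c + \<rho> *\<^sub>R y) \<partial>lborel) = ennreal (\<rho> powr - real CARD('n)) * (\<integral>\<^sup>+y\<in>cube c \<rho>. g y \<partial>lborel)"
    using \<rho>0 by (subst nn_integral_rescaled_cube) simp_all
  also have "\<dots> \<le> ennreal (2 powr real CARD('n) * s x powr - real CARD('n)) * (\<integral>\<^sup>+y\<in>cube (z x) (3 / 2 * s x). g y \<partial>lborel)"
  proof (intro mult_mono ennreal_leI nn_integral_mono)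
    have "\<rho> powr - real CARD('n) \<le> (s x / 2) powr - real CARD('n)"
      using \<rho> s_bounds(3)[of x] by (intro powr_mono2') auto
    also have "\<dots> = 2 powr real CARD('n) * s x powr - real CARD('n)"
      using s_bounds(3)[of x] by (simp add: powr_divide powr_minus field_simps)
    finally show "\<rho> powr - real CARD('n) \<le> 2 powr real CARD('n) * s x powr - real CARD('n)" .
  qed (use sub in \<open>auto simp: indicator_def\<close>)
  finally show ?thesis by (simp add: c_def \<rho>_def)
qed

lemma ext_near:
  assumes v: "continuous_on UNIV v" and x2: "infnorm (x2 - x) < \<epsilon> / 8"
  shows "ennreal \<bar>1 - ext v x2\<bar> \<le> ennreal (s x powr - real CARD('n)) * (\<integral>\<^sup>+y\<in>cube (z x) (3 / 2 * s x). ennreal \<bar>1 - v y\<bar> \<partial>lborel)"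
proof -
  have [measurable]: "v \<in> borel_measurable borel" using v by (rule borel_measurable_continuous_onI)
  have "ennreal \<bar>1 - ext v x2\<bar> \<le> ennreal (2 powr - real CARD('n)) * (\<integral>\<^sup>+y\<in>cube 0 1. ennreal \<bar>1 - v (z x2 + s x2 *\<^sub>R y)\<bar> \<partial>lborel)"
    by (rule ext_diff[OF v])
  also have "\<dots> \<le> ennreal (2 powr - real CARD('n)) * (ennreal (2 powr real CARD('n) * s x powr - real CARD('n)) * (\<integral>\<^sup>+y\<in>cube (z x) (3 / 2 * s x). ennreal \<bar>1 - v y\<bar> \<partial>lborel))"
    using rescaled_average_le[of "\<lambda>y. ennreal \<bar>1 - v y\<bar>" x2 x x2 0] x2 by (intro mult_left_mono) auto
  also have "\<dots> = ennreal (s x powr - real CARD('n)) * (\<integral>\<^sup>+y\<in>cube (z x) (3 / 2 * s x). ennreal \<bar>1 - v y\<bar> \<partial>lborel)"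
    by (simp add: mult.assoc[symmetric] ennreal_mult[symmetric] powr_minus)
  finally show ?thesis .
qed

text \<open>Corresponding points of the two averaging cubes are joined by segments. For each
  \<open>t\<close> the points at parameter \<open>t\<close> sweep out an interpolated cube, which
  lies in \<open>cube (z x) (3 / 2 * s x)\<close>. The segments have length at most
  \<open>2 * CARD('n) * norm (x1 - x2)\<close>, as 5/4 + 1/8 is below 2.\<close>

lemma ext_lipschitz:
  assumes v: "C_k (Suc 0) v" and x1: "infnorm (x1 - x) < \<epsilon> / 8" and x2: "infnorm (x2 - x) < \<epsilon> / 8"
  shows "ennreal \<bar>ext v x1 - ext v x2\<bar> \<le> ennreal (2 * real CARD('n) * norm (x1 - x2)) *
    (ennreal (s x powr - real CARD('n)) * (\<integral>\<^sup>+y\<in>cube (z x) (3 / 2 * s x). ennreal (norm (grad v y)) \<partial>lborel))"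
proof -
  define N where "N = real CARD('n)"
  define g where "g y = ennreal (norm (grad v y))" for y
  define L where "L = 2 * N * norm (x1 - x2)"
  define P1 where "P1 y = z x1 + s x1 *\<^sub>R y" for y
  define P2 where "P2 y = z x2 + s x2 *\<^sub>R y" for y
  define W where "W = (\<integral>\<^sup>+y\<in>cube (z x) (3 / 2 * s x). g y \<partial>lborel)"
  have [measurable]: "grad v \<in> borel_measurable borel"
    using C_k_grad_continuous[OF v] by (rule borel_measurable_continuous_onI)
  have [measurable]: "g \<in> borel_measurable borel" unfolding g_def by measurable
  have cv: "continuous_on UNIV v" using v by (rule C_k_continuous)
  have seg: "(1 - t) *\<^sub>R P1 y + t *\<^sub>R P2 y = ((1 - t) *\<^sub>R z x1 + t *\<^sub>R z x2) + ((1 - t) * s x1 + t * s x2) *\<^sub>R y" for t y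
    by (simp add: P1_def P2_def algebra_simps)
  have nrm: "norm (P2 y - P1 y) \<le> L" if y: "y \<in> cube 0 1" for y
  proof -
    have "P2 y - P1 y = (z x2 - z x1) + (s x2 - s x1) *\<^sub>R y"
      by (simp add: P1_def P2_def algebra_simps)
    then have "infnorm (P2 y - P1 y) \<le> infnorm (z x2 - z x1) + \<bar>s x2 - s x1\<bar> * infnorm y"
      using infnorm_triangle[of "z x2 - z x1" "(s x2 - s x1) *\<^sub>R y"] by (simp add: infnorm_mul)
    also have "\<bar>s x2 - s x1\<bar> * infnorm y \<le> \<bar>s x2 - s x1\<bar> * 1"
      using y by (intro mult_left_mono) (auto simp: in_cube_iff)
    finally have "infnorm (P2 y - P1 y) \<le> infnorm (z x2 - z x1) + \<bar>s x2 - s x1\<bar>" by simp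
    also have "\<dots> \<le> 5 / 4 * infnorm (x2 - x1) + infnorm (x2 - x1) / 8"
      by (intro add_mono z_lipschitz s_lipschitz)
    also have "\<dots> \<le> 2 * infnorm (x2 - x1)" using infnorm_pos_le[of "x2 - x1"] by simp
    also have "\<dots> \<le> 2 * norm (x1 - x2)" using infnorm_le_norm[of "x2 - x1"] by (simp add: norm_minus_commute)
    finally have "N * infnorm (P2 y - P1 y) \<le> L" by (simp add: L_def N_def)
    then show ?thesis using norm_le_infnorm_cart[of "P2 y - P1 y"] by (simp add: N_def)
  qed
  have "ennreal \<bar>ext v x1 - ext v x2\<bar> \<le> ennreal (2 powr - N) * (\<integral>\<^sup>+y\<in>cube 0 1. ennreal \<bar>v (P1 y) - v (P2 y)\<bar> \<partial>lborel)"
    unfolding N_def P1_def P2_def by (rule ext_diff[OF cv])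
  also have "\<dots> \<le> ennreal (2 powr - N) * (\<integral>\<^sup>+y. (\<integral>\<^sup>+t. ennreal L * (g ((1 - t) *\<^sub>R P1 y + t *\<^sub>R P2 y) * indicator {0..1} t * indicator (cube 0 1) y) \<partial>lborel) \<partial>lborel)"
  proof (intro mult_left_mono nn_integral_mono)
    fix y
    have [measurable]: "(\<lambda>t. g ((1 - t) *\<^sub>R P1 y + t *\<^sub>R P2 y)) \<in> borel_measurable borel" by measurable
    show "ennreal \<bar>v (P1 y) - v (P2 y)\<bar> * indicator (cube 0 1) y \<le> (\<integral>\<^sup>+t. ennreal L * (g ((1 - t) *\<^sub>R P1 y + t *\<^sub>R P2 y) * indicator {0..1} t * indicator (cube 0 1) y) \<partial>lborel)"
    proof (cases "y \<in> cube 0 1")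
      case True
      have "ennreal \<bar>v (P1 y) - v (P2 y)\<bar> \<le> ennreal (norm (P2 y - P1 y)) * (\<integral>\<^sup>+t\<in>{0..1}. g ((1 - t) *\<^sub>R P1 y + t *\<^sub>R P2 y) \<partial>lborel)"
        unfolding g_def by (rule C1_segment_estimate[OF v])
      also have "\<dots> \<le> ennreal L * (\<integral>\<^sup>+t\<in>{0..1}. g ((1 - t) *\<^sub>R P1 y + t *\<^sub>R P2 y) \<partial>lborel)"
        by (intro mult_right_mono ennreal_leI nrm True) simp
      also have "\<dots> = (\<integral>\<^sup>+t. ennreal L * (g ((1 - t) *\<^sub>R P1 y + t *\<^sub>R P2 y) * indicator {0..1} t) \<partial>lborel)"
        by (rule nn_integral_cmult[symmetric]) measurable
      finally show ?thesis using True by simp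
    qed simp
  qed simp
  also have "(\<integral>\<^sup>+y. (\<integral>\<^sup>+t. ennreal L * (g ((1 - t) *\<^sub>R P1 y + t *\<^sub>R P2 y) * indicator {0..1} t * indicator (cube 0 1) y) \<partial>lborel) \<partial>lborel)
    = (\<integral>\<^sup>+t. (\<integral>\<^sup>+y. ennreal L * (g ((1 - t) *\<^sub>R P1 y + t *\<^sub>R P2 y) * indicator {0..1} t * indicator (cube 0 1) y) \<partial>lborel) \<partial>lborel)"
    unfolding P1_def P2_def by (rule lborel_pair.Fubini') measurable
  also have "\<dots> \<le> (\<integral>\<^sup>+t. ennreal L * (ennreal (2 powr N * s x powr - N) * W) * indicator {0..1::real} t \<partial>lborel)"
  proof (intro nn_integral_mono)
    fix t :: real
    have [measurable]: "(\<lambda>y. g ((1 - t) *\<^sub>R P1 y + t *\<^sub>R P2 y)) \<in> borel_measurable borel"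
      unfolding P1_def P2_def by measurable
    show "(\<integral>\<^sup>+y. ennreal L * (g ((1 - t) *\<^sub>R P1 y + t *\<^sub>R P2 y) * indicator {0..1} t * indicator (cube 0 1) y) \<partial>lborel)
      \<le> ennreal L * (ennreal (2 powr N * s x powr - N) * W) * indicator {0..1} t"
    proof (cases "t \<in> {0..1}")
      case True
      then have "(\<integral>\<^sup>+y. ennreal L * (g ((1 - t) *\<^sub>R P1 y + t *\<^sub>R P2 y) * indicator {0..1} t * indicator (cube 0 1) y) \<partial>lborel)
        = ennreal L * (\<integral>\<^sup>+y\<in>cube 0 1. g ((1 - t) *\<^sub>R P1 y + t *\<^sub>R P2 y) \<partial>lborel)"
        by (simp add: nn_integral_cmult)
      also have "\<dots> \<le> ennreal L * (ennreal (2 powr N * s x powr - N) * W)"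
        unfolding seg W_def N_def using True by (intro mult_left_mono rescaled_average_le x1 x2) auto
      finally show ?thesis using True by simp
    qed simp
  qed
  also have "\<dots> = ennreal L * (ennreal (2 powr N * s x powr - N) * W)"
    by (simp add: nn_integral_cmult)
  also have "ennreal (2 powr - N) * (ennreal L * (ennreal (2 powr N * s x powr - N) * W)) = ennreal L * (ennreal (s x powr - N) * W)"
  proof -
    have eq: "ennreal (s x powr - N) = ennreal (2 powr - N) * ennreal (2 powr N * s x powr - N)"
      by (simp add: ennreal_mult[symmetric] powr_minus)
    show ?thesis unfolding eq by (simp only: mult_ac)
  qed
  finally show ?thesis by (simp add: mult_left_mono L_def N_def W_def g_def)
qed

text \<open>A candidate for the capacity: where \<open>v\<close> vanishes, \<open>1 - ext v\<close>
  equals 1, and the cutoff makes the support compact in the double cube.\<close>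

definition cutoff_ext :: "(real^'n \<Rightarrow> real) \<Rightarrow> real^'n \<Rightarrow> real" where
  "cutoff_ext v x = \<eta> x * (1 - ext v x)"

text \<open>The product rule: the slope \<open>4 / r\<close> of the cutoff, in front of
  \<open>1 - ext v\<close>, is the origin of the term \<open>\<bar>1 - v y\<bar> / r\<close>. The
  constant depends on \<open>x\<close> through an average over
  \<open>cube (z x) (3 / 2 * s x)\<close>, as \<open>moving_average_estimate\<close>
  requires.\<close>

lemma cutoff_ext_lipschitz:
  assumes v: "C_k (Suc 0) v"
  obtains L where "0 \<le> L"
    "ennreal L = ennreal (4 * real CARD('n)) * (ennreal (s x powr - real CARD('n)) *
      (\<integral>\<^sup>+y\<in>cube (z x) (3 / 2 * s x). ennreal (norm (grad v y) + \<bar>1 - v y\<bar> / r) \<partial>lborel))"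
    "\<forall>x1\<in>cube x (\<epsilon> / 8). \<forall>x2\<in>cube x (\<epsilon> / 8). \<bar>cutoff_ext v x1 - cutoff_ext v x2\<bar> \<le> L * norm (x1 - x2)"
proof -
  let ?S = "cube (z x) (3 / 2 * s x)"
  define N where "N = real CARD('n)"
  have N: "1 \<le> N" by (simp add: N_def)
  have cv: "continuous_on UNIV v" using v by (rule C_k_continuous)
  have [measurable]: "grad v \<in> borel_measurable borel" "v \<in> borel_measurable borel"
    using C_k_grad_continuous[OF v] cv by (auto intro: borel_measurable_continuous_onI)
  obtain a where a: "(\<integral>\<^sup>+y\<in>?S. ennreal (norm (grad v y)) \<partial>lborel) = ennreal a" "0 \<le> a"
    using nn_integral_cube_finite[OF continuous_on_norm[OF C_k_grad_continuous[OF v]], of "z x" "3 / 2 * s x"]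
    unfolding less_top_ennreal by blast
  have "continuous_on UNIV (\<lambda>y. \<bar>1 - v y\<bar>)" using cv by (intro continuous_intros)
  from nn_integral_cube_finite[OF this, of "z x" "3 / 2 * s x"]
  obtain b where b: "(\<integral>\<^sup>+y\<in>?S. ennreal \<bar>1 - v y\<bar> \<partial>lborel) = ennreal b" "0 \<le> b"
    unfolding less_top_ennreal by blast
  define w where "w = s x powr - N"
  have w: "0 \<le> w" by (simp add: w_def)
  have h: "(\<integral>\<^sup>+y\<in>?S. ennreal (norm (grad v y) + \<bar>1 - v y\<bar> / r) \<partial>lborel) = ennreal (a + b / r)"
  proof -
    have "(\<integral>\<^sup>+y\<in>?S. ennreal (norm (grad v y) + \<bar>1 - v y\<bar> / r) \<partial>lborel)
      = (\<integral>\<^sup>+y. ennreal (norm (grad v y)) * indicator ?S y + ennreal (1 / r) * (ennreal \<bar>1 - v y\<bar> * indicator ?S y) \<partial>lborel)"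
      using r by (intro nn_integral_cong) (auto simp: indicator_def ennreal_mult[symmetric] ennreal_plus[symmetric] simp del: ennreal_plus)
    also have "\<dots> = ennreal a + ennreal (1 / r) * ennreal b"
      using a b by (simp add: nn_integral_add nn_integral_cmult)
    also have "\<dots> = ennreal (a + b / r)"
      using a b r by (simp add: ennreal_mult[symmetric] ennreal_plus[symmetric] del: ennreal_plus)
    finally show ?thesis .
  qed
  show thesis
  proof (rule that[of "4 * N * (w * (a + b / r))"], safe)
    show "0 \<le> 4 * N * (w * (a + b / r))" using N w a b r by simp
    show "ennreal (4 * N * (w * (a + b / r))) = ennreal (4 * real CARD('n)) * (ennreal (s x powr - real CARD('n)) *
      (\<integral>\<^sup>+y\<in>?S. ennreal (norm (grad v y) + \<bar>1 - v y\<bar> / r) \<partial>lborel))"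
      unfolding h using N w a b r by (simp add: N_def[symmetric] w_def[symmetric] ennreal_mult)
    fix x1 x2 assume "x1 \<in> cube x (\<epsilon> / 8)" "x2 \<in> cube x (\<epsilon> / 8)"
    then have x12: "infnorm (x1 - x) < \<epsilon> / 8" "infnorm (x2 - x) < \<epsilon> / 8" by (auto simp: in_cube_iff)
    have "ennreal \<bar>ext v x1 - ext v x2\<bar> \<le> ennreal (2 * N * norm (x1 - x2) * (w * a))"
      using ext_lipschitz[OF v x12] a w N by (simp add: N_def[symmetric] w_def[symmetric] ennreal_mult)
    then have 1: "\<bar>ext v x1 - ext v x2\<bar> \<le> 2 * N * norm (x1 - x2) * (w * a)"
      using w a N by (subst (asm) ennreal_le_iff) auto
    have "ennreal \<bar>1 - ext v x2\<bar> \<le> ennreal (w * b)"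
      using ext_near[OF cv x12(2)] b w by (simp add: N_def[symmetric] w_def[symmetric] ennreal_mult)
    then have 2: "\<bar>1 - ext v x2\<bar> \<le> w * b"
      using w b by (subst (asm) ennreal_le_iff) auto
    have 3: "\<bar>\<eta> x1 - \<eta> x2\<bar> \<le> 4 / r * norm (x1 - x2)"
      using r by (intro order_trans[OF \<eta>_lipschitz] mult_left_mono infnorm_le_norm) auto
    have "cutoff_ext v x1 - cutoff_ext v x2 = - (\<eta> x1 * (ext v x1 - ext v x2)) + (\<eta> x1 - \<eta> x2) * (1 - ext v x2)"
      by (simp add: cutoff_ext_def algebra_simps)
    then have "\<bar>cutoff_ext v x1 - cutoff_ext v x2\<bar> \<le> \<bar>\<eta> x1\<bar> * \<bar>ext v x1 - ext v x2\<bar> + \<bar>\<eta> x1 - \<eta> x2\<bar> * \<bar>1 - ext v x2\<bar>"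
      using abs_triangle_ineq[of "- (\<eta> x1 * (ext v x1 - ext v x2))" "(\<eta> x1 - \<eta> x2) * (1 - ext v x2)"]
      by (simp only: abs_minus_cancel abs_mult)
    also have "\<dots> \<le> 1 * (2 * N * norm (x1 - x2) * (w * a)) + (4 / r * norm (x1 - x2)) * (w * b)"
    proof (rule add_mono)
      show "\<bar>\<eta> x1\<bar> * \<bar>ext v x1 - ext v x2\<bar> \<le> 1 * (2 * N * norm (x1 - x2) * (w * a))"
        using \<eta>_bounds[of x1] by (intro mult_mono 1) auto
      show "\<bar>\<eta> x1 - \<eta> x2\<bar> * \<bar>1 - ext v x2\<bar> \<le> (4 / r * norm (x1 - x2)) * (w * b)"
        using r by (intro mult_mono 2 3) auto
    qed
    also have "\<dots> \<le> 4 * N * norm (x1 - x2) * (w * a) + N * (4 / r * norm (x1 - x2) * (w * b))"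
    proof (rule add_mono)
      show "1 * (2 * N * norm (x1 - x2) * (w * a)) \<le> 4 * N * norm (x1 - x2) * (w * a)"
        using N w a by (simp add: mult_right_mono)
      have "0 \<le> 4 / r * norm (x1 - x2) * (w * b)" using r w b by simp
      from mult_right_mono[OF N this] show "4 / r * norm (x1 - x2) * (w * b) \<le> N * (4 / r * norm (x1 - x2) * (w * b))"
        by simp
    qed
    also have "\<dots> = 4 * N * (w * (a + b / r)) * norm (x1 - x2)" by (simp add: algebra_simps)
    finally show "\<bar>cutoff_ext v x1 - cutoff_ext v x2\<bar> \<le> 4 * N * (w * (a + b / r)) * norm (x1 - x2)" .
  qed
qed

lemma cutoff_ext_support: "3 / 2 * r \<le> infnorm (x - x0) \<Longrightarrow> cutoff_ext v x = 0"
  using r by (simp add: cutoff_ext_def \<eta>_def field_simps)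

text \<open>Even for \<open>k\<close> on the boundary, near \<open>k\<close> the scale is at most
  \<open>\<epsilon> + \<epsilon> / 64\<close> and \<open>\<delta>\<close> at most
  \<open>\<epsilon> / 8\<close>. So the averaging cube stays within \<open>4 * \<epsilon>\<close> of
  \<open>k\<close>, where \<open>v\<close> vanishes.\<close>

lemma cutoff_ext_eq_1:
  assumes k: "infnorm (k - x0) \<le> r" and v0: "\<And>w. w \<in> cube x0 r \<Longrightarrow> infnorm (w - k) < 4 * \<epsilon> \<Longrightarrow> v w = 0"
    and y: "infnorm (y - k) < \<epsilon> / 8"
  shows "cutoff_ext v y = 1"
proof -
  have yx: "infnorm (y - x0) \<le> r + \<epsilon> / 8"
    using infnorm_triangle[of "y - k" "k - x0"] k y by simp
  then have "4 * infnorm (y - x0) / r \<le> 4 * (r + r / 64) / r"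
    using \<epsilon> r by (intro divide_right_mono) auto
  also have "\<dots> \<le> 5" using r by (simp add: field_simps)
  finally have "\<eta> y = 1" by (simp add: \<eta>_def)
  have \<delta>: "\<delta> y \<le> \<epsilon> / 8" using yx \<epsilon> unfolding \<delta>_def by (intro max.boundedI) simp_all
  then have sy: "s y \<le> \<epsilon> + \<epsilon> / 64" by (simp add: s_def min_def)
  have zy: "infnorm (z y - y) \<le> \<delta> y + 2 * s y"
    unfolding infnorm_le_iff
  proof
    fix i
    have "\<bar>y $ i - x0 $ i\<bar> \<le> infnorm (y - x0)" using component_le_infnorm_cart[of "y - x0" i] by simp
    then have "\<bar>y $ i - x0 $ i\<bar> \<le> r + \<delta> y" by (simp add: \<delta>_def)
    moreover have "\<bar>max (- \<rho>) (min \<rho> c) - c\<bar> \<le> max 0 (\<bar>c\<bar> - \<rho>)" if "0 \<le> \<rho>" for \<rho> c :: real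
      using that by (auto simp: min_def max_def)
    from this[of "r - 2 * s y" "y $ i - x0 $ i"]
    have "\<bar>(z y - y) $ i\<bar> \<le> max 0 (\<bar>y $ i - x0 $ i\<bar> - (r - 2 * s y))"
      using s_bounds[of y] r by (simp add: z_def algebra_simps)
    moreover have "0 \<le> \<delta> y" by (simp add: \<delta>_def)
    ultimately show "\<bar>(z y - y) $ i\<bar> \<le> \<delta> y + 2 * s y" using s_bounds(3)[of y]
      by (simp add: max_def split: if_splits)
  qed
  have "v (z y + s y *\<^sub>R u) = 0" if u: "u \<in> cube 0 1" for u
  proof (rule v0)
    have su: "infnorm (s y *\<^sub>R u) < s y"
      using u s_bounds(3)[of y] by (simp add: in_cube_iff infnorm_mul)
    show "z y + s y *\<^sub>R u \<in> cube x0 r"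
      using infnorm_triangle[of "z y - x0" "s y *\<^sub>R u"] su z_depth[of y] s_bounds(3)[of y]
      by (simp add: in_cube_iff algebra_simps)
    have "z y + s y *\<^sub>R u - k = (z y - y) + (s y *\<^sub>R u + (y - k))" by simp
    then have "infnorm (z y + s y *\<^sub>R u - k) \<le> infnorm (z y - y) + infnorm (s y *\<^sub>R u + (y - k))"
      using infnorm_triangle[of "z y - y" "s y *\<^sub>R u + (y - k)"] by (simp only:)
    then have "infnorm (z y + s y *\<^sub>R u - k) \<le> infnorm (z y - y) + (infnorm (s y *\<^sub>R u) + infnorm (y - k))"
      using infnorm_triangle[of "s y *\<^sub>R u" "y - k"] by linarith
    then show "infnorm (z y + s y *\<^sub>R u - k) < 4 * \<epsilon>" using zy su \<delta> sy y \<epsilon> by linarith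
  qed
  then have "(LINT u:cube 0 1|lborel. v (z y + s y *\<^sub>R u)) = (LINT u:cube (0 :: real^'n) 1|lborel. 0)"
    by (intro set_lebesgue_integral_cong) auto
  then have "ext v y = 0" by (simp add: ext_def)
  with \<open>\<eta> y = 1\<close> show ?thesis by (simp add: cutoff_ext_def)
qed

end

section \<open>Estimates of the capacity\<close>

lemma infnorm_le_of_closure_cube:
  fixes k x0 :: "real^'n"
  assumes "k \<in> closure (cube x0 r)" shows "infnorm (k - x0) \<le> r"
proof -
  have "closed {x :: real^'n. infnorm (x - x0) \<le> r}"
    by (intro closed_Collect_le continuous_intros)
  then have "closure (cube x0 r) \<subseteq> {x. infnorm (x - x0) \<le> r}"
    by (intro closure_minimal) (auto simp: in_cube_iff)
  then show ?thesis using assms by blast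
qed

lemma Cap_le:
  fixes \<phi> :: "real^'n \<Rightarrow> real"
  assumes "\<phi> \<in> Cinf_c U" "\<And>x. x \<in> K \<Longrightarrow> 1 \<le> \<phi> x"
  shows "Cap q \<rho> K U \<le> (\<integral>\<^sup>+x\<in>U. ennreal (norm (grad \<phi> x) powr q * \<rho> x) \<partial>lborel)"
  unfolding Cap_def nn_integral_completion using assms by (intro INF_lower) auto

text \<open>The competitor is the mollification of \<open>cutoff_ext v\<close> at scale
  \<open>\<epsilon> / 8\<close>, the scale on which the Lipschitz constants are available. Its
  gradient is bounded pointwise by a moving average of
  \<open>norm (grad v y) + \<bar>1 - v y\<bar> / r\<close>, whose weighted norm over the double cube
  returns to \<open>cube x0 r\<close>.\<close>

lemma Cap_extension:
  fixes m v :: "real^'n \<Rightarrow> real"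
  assumes A: "Apq m q q B" and mm [measurable]: "m \<in> borel_measurable borel" and m: "\<And>x. 0 < m x"
    and q: "1 < q" and B: "0 \<le> B" and r: "0 < r" and v: "C_k (Suc 0) v"
    and K: "K \<subseteq> closure (cube x0 r)" and d: "0 < d"
    and v0: "\<And>k w. k \<in> K \<Longrightarrow> w \<in> cube x0 r \<Longrightarrow> infnorm (w - k) < d \<Longrightarrow> v w = 0"
  shows "Cap q (\<lambda>x. m x powr q) K (cube x0 (2 * r))
    \<le> ennreal ((4 * real CARD('n)) powr q * (2 * 552 powr (real CARD('n) * q) * B powr q)) *
      (\<integral>\<^sup>+y\<in>cube x0 r. ennreal ((norm (grad v y) + \<bar>1 - v y\<bar> / r) powr q * m y powr q) \<partial>lborel)"
proof -
  \<comment> \<open>The first bound serves the geometry of the extension, the second matches the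
    distance \<open>4 * \<epsilon>\<close> in \<open>cutoff_ext_eq_1\<close>.\<close>
  define \<epsilon> where "\<epsilon> = min (r / 8) (d / 4)"
  interpret extension_geometry x0 r \<epsilon>
    by unfold_locales (use r d in \<open>auto simp: \<epsilon>_def\<close>)
  define f where "f = cutoff_ext v"
  define h where "h y = ennreal (norm (grad v y) + \<bar>1 - v y\<bar> / r)" for y
  have cv: "continuous_on UNIV v" using v by (rule C_k_continuous)
  have [measurable]: "grad v \<in> borel_measurable borel" "v \<in> borel_measurable borel"
    using C_k_grad_continuous[OF v] cv by (auto intro: borel_measurable_continuous_onI)
  have hm [measurable]: "h \<in> borel_measurable borel" unfolding h_def by measurable
  have cf: "continuous_on UNIV f"
  proof (rule continuous_at_imp_continuous_on, rule ballI)
    fix x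
    obtain L where L: "0 \<le> L" "ennreal L = ennreal (4 * real CARD('n)) * (ennreal (s x powr - real CARD('n)) *
      (\<integral>\<^sup>+y\<in>cube (z x) (3 / 2 * s x). ennreal (norm (grad v y) + \<bar>1 - v y\<bar> / r) \<partial>lborel))"
      "\<forall>x1\<in>cube x (\<epsilon> / 8). \<forall>x2\<in>cube x (\<epsilon> / 8). \<bar>f x1 - f x2\<bar> \<le> L * norm (x1 - x2)"
      unfolding f_def by (rule cutoff_ext_lipschitz[OF v, of x])
    then have "L-lipschitz_on (cube x (\<epsilon> / 8)) f"
      by (intro lipschitz_onI) (simp_all add: dist_norm)
    then have "continuous_on (cube x (\<epsilon> / 8)) f" by (rule lipschitz_on_continuous_on)
    then show "isCont f x" using \<epsilon> by (simp add: continuous_on_eq_continuous_at)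
  qed
  have bd: "bounded {x. f x \<noteq> 0}"
  proof (rule bounded_subset)
    show "bounded (cube x0 (2 * r))" by (simp add: cube_eq_box)
    show "{x. f x \<noteq> 0} \<subseteq> cube x0 (2 * r)"
    proof
      fix x assume "x \<in> {x. f x \<noteq> 0}"
      then have "infnorm (x - x0) < 3 / 2 * r" using cutoff_ext_support[of x v] by (auto simp: f_def not_less[symmetric])
      then show "x \<in> cube x0 (2 * r)" using r by (simp add: in_cube_iff)
    qed
  qed
  have "0 < \<epsilon> / 8" using \<epsilon> by simp
  with cf bd obtain \<phi> where \<phi>: "smooth \<phi>"
    "\<forall>x c. (\<forall>y\<in>cube x (\<epsilon> / 8). f y = c) \<longrightarrow> \<phi> x = c"
    "\<forall>x L. (\<forall>y\<in>cube x (\<epsilon> / 8). \<forall>z\<in>cube x (\<epsilon> / 8). \<bar>f y - f z\<bar> \<le> L * norm (y - z)) \<longrightarrow> norm (grad \<phi> x) \<le> L"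
    by (rule mollification)
  \<comment> \<open>The cutoff ends at \<open>3 / 2 * r\<close>, and mollification spreads the
    support by at most \<open>\<epsilon> / 8\<close>.\<close>
  have supp: "infnorm (x - x0) \<le> 7 / 4 * r" if "\<phi> x \<noteq> 0" for x
  proof (rule ccontr)
    assume far: "\<not> infnorm (x - x0) \<le> 7 / 4 * r"
    have "f y = 0" if y: "y \<in> cube x (\<epsilon> / 8)" for y
      unfolding f_def
    proof (rule cutoff_ext_support)
      have "infnorm (x - x0) \<le> infnorm (x - y) + infnorm (y - x0)"
        using infnorm_triangle[of "x - y" "y - x0"] by simp
      then show "3 / 2 * r \<le> infnorm (y - x0)"
        using y far \<epsilon> infnorm_sub[of x y] by (simp add: in_cube_iff)
    qed
    then have "\<phi> x = 0" using \<phi>(2) by blast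
    with that show False by simp
  qed
  have "closed {x :: real^'n. infnorm (x - x0) \<le> 7 / 4 * r}"
    by (intro closed_Collect_le continuous_intros)
  then have cl: "closure {x. \<phi> x \<noteq> 0} \<subseteq> {x. infnorm (x - x0) \<le> 7 / 4 * r}"
    using supp by (intro closure_minimal) auto
  then have clU: "closure {x. \<phi> x \<noteq> 0} \<subseteq> cube x0 (2 * r)" using r by (force simp: in_cube_iff)
  have "bounded (cube x0 (2 * r))" by (simp add: cube_eq_box)
  then have "\<phi> \<in> Cinf_c (cube x0 (2 * r))"
    using \<phi>(1) clU by (auto simp: Cinf_c_def compact_eq_bounded_closed intro: bounded_subset)
  moreover have "1 \<le> \<phi> k" if k: "k \<in> K" for k
  proof -
    have "f y = 1" if "y \<in> cube k (\<epsilon> / 8)" for y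
      unfolding f_def
    proof (rule cutoff_ext_eq_1[of k])
      show "infnorm (k - x0) \<le> r" using K k infnorm_le_of_closure_cube by blast
      show "v w = 0" if "w \<in> cube x0 r" "infnorm (w - k) < 4 * \<epsilon>" for w
        using v0[OF k] that by (simp add: \<epsilon>_def)
    qed (use that in \<open>simp add: in_cube_iff\<close>)
    then have "\<phi> k = 1" using \<phi>(2) by blast
    then show ?thesis by simp
  qed
  ultimately have "Cap q (\<lambda>x. m x powr q) K (cube x0 (2 * r))
    \<le> (\<integral>\<^sup>+x\<in>cube x0 (2 * r). ennreal (norm (grad \<phi> x) powr q * m x powr q) \<partial>lborel)"
    by (rule Cap_le)
  also have "\<dots> \<le> (\<integral>\<^sup>+x. ennreal ((4 * real CARD('n)) powr q) * (epowr (ennreal (s x powr - real CARD('n)) * (\<integral>\<^sup>+y\<in>cube (z x) (3 / 2 * s x). h y \<partial>lborel)) q * ennreal (m x powr q) * indicator (cube x0 (2 * r)) x) \<partial>lborel)"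
  proof (intro nn_integral_mono)
    fix x
    obtain L where L: "0 \<le> L" "ennreal L = ennreal (4 * real CARD('n)) * (ennreal (s x powr - real CARD('n)) * (\<integral>\<^sup>+y\<in>cube (z x) (3 / 2 * s x). h y \<partial>lborel))"
      "\<forall>x1\<in>cube x (\<epsilon> / 8). \<forall>x2\<in>cube x (\<epsilon> / 8). \<bar>f x1 - f x2\<bar> \<le> L * norm (x1 - x2)"
      unfolding f_def h_def by (rule cutoff_ext_lipschitz[OF v, of x])
    have "norm (grad \<phi> x) \<le> L" using \<phi>(3) L(3) by blast
    then have "ennreal (norm (grad \<phi> x) powr q) \<le> ennreal (L powr q)"
      using q by (intro ennreal_leI powr_mono2) auto
    also have "\<dots> = epowr (ennreal L) q" using L(1) by (simp add: epowr_ennreal)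
    also have "\<dots> = ennreal ((4 * real CARD('n)) powr q) * epowr (ennreal (s x powr - real CARD('n)) * (\<integral>\<^sup>+y\<in>cube (z x) (3 / 2 * s x). h y \<partial>lborel)) q"
      unfolding L(2) by (subst epowr_mult) (simp add: epowr_ennreal)
    finally have "ennreal (norm (grad \<phi> x) powr q) * ennreal (m x powr q) * indicator (cube x0 (2 * r)) x \<le> \<dots> * ennreal (m x powr q) * indicator (cube x0 (2 * r)) x"
      by (intro mult_right_mono) auto
    then show "ennreal (norm (grad \<phi> x) powr q * m x powr q) * indicator (cube x0 (2 * r)) x \<le>
      ennreal ((4 * real CARD('n)) powr q) * (epowr (ennreal (s x powr - real CARD('n)) * (\<integral>\<^sup>+y\<in>cube (z x) (3 / 2 * s x). h y \<partial>lborel)) q * ennreal (m x powr q) * indicator (cube x0 (2 * r)) x)"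
      by (simp only: ennreal_mult powr_ge_zero mult.assoc)
  qed
  also have "\<dots> = ennreal ((4 * real CARD('n)) powr q) * (\<integral>\<^sup>+x\<in>cube x0 (2 * r). epowr (ennreal (s x powr - real CARD('n)) * (\<integral>\<^sup>+y\<in>cube (z x) (3 / 2 * s x). h y \<partial>lborel)) q * ennreal (m x powr q) \<partial>lborel)"
  proof -
    have "Measurable.pred (borel \<Otimes>\<^sub>M borel) (\<lambda>w. snd w \<in> cube (z (fst w)) (3 / 2 * s (fst w)))" by measurable
    then have [measurable]: "(\<lambda>(x, y). indicator (cube (z x) (3 / 2 * s x)) y :: ennreal) \<in> borel_measurable (borel \<Otimes>\<^sub>M borel)"
      by (auto simp: pred_def case_prod_beta' space_pair_measure intro!: borel_measurable_indicator')
    show ?thesis by (rule nn_integral_cmult) measurable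
  qed
  also have "\<dots> \<le> ennreal ((4 * real CARD('n)) powr q) * (ennreal (2 * 552 powr (real CARD('n) * q) * B powr q) * (\<integral>\<^sup>+y\<in>cube x0 r. epowr (h y) q * ennreal (m y powr q) \<partial>lborel))"
    by (intro mult_left_mono moving_average_estimate[OF A mm m q B hm]) simp
  also have "\<dots> = ennreal ((4 * real CARD('n)) powr q * (2 * 552 powr (real CARD('n) * q) * B powr q)) *
      (\<integral>\<^sup>+y\<in>cube x0 r. ennreal ((norm (grad v y) + \<bar>1 - v y\<bar> / r) powr q * m y powr q) \<partial>lborel)"
  proof -
    have "(\<integral>\<^sup>+y\<in>cube x0 r. epowr (h y) q * ennreal (m y powr q) \<partial>lborel)
      = (\<integral>\<^sup>+y\<in>cube x0 r. ennreal ((norm (grad v y) + \<bar>1 - v y\<bar> / r) powr q * m y powr q) \<partial>lborel)"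
      using r by (intro nn_integral_cong) (simp add: h_def epowr_ennreal ennreal_mult del: ennreal_plus)
    moreover have "0 \<le> 2 * 552 powr (real CARD('n) * q) * B powr q" by simp
    ultimately show ?thesis by (simp only: ennreal_mult'' mult.assoc)
  qed
  finally show ?thesis .
qed

lemma C_k_const: "C_k k (\<lambda>x :: real^'n. c)"
  using C_k_affine[OF C_k_prod[OF C1_k_const], where a = 0 and c = c] by simp

text \<open>The extension estimate for \<open>v = 0\<close>, where the competitor comes from the
  cutoff alone. It yields finiteness of the capacity, and in the upper estimate a bound of
  \<open>r powr q\<close> by mass over capacity.\<close>

lemma Cap_le_mass:
  fixes m :: "real^'n \<Rightarrow> real"
  assumes A: "Apq m q q B" and mm [measurable]: "m \<in> borel_measurable borel" and m: "\<And>x. 0 < m x"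
    and q: "1 < q" and B: "0 \<le> B" and r: "0 < r" and K: "K \<subseteq> closure (cube x0 r)"
  shows "Cap q (\<lambda>x. m x powr q) K (cube x0 (2 * r))
    \<le> ennreal ((4 * real CARD('n)) powr q * (2 * 552 powr (real CARD('n) * q) * B powr q) * r powr - q) *
      (\<integral>\<^sup>+y\<in>cube x0 r. ennreal (m y powr q) \<partial>lborel)"
proof -
  define c where "c = (4 * real CARD('n)) powr q * (2 * 552 powr (real CARD('n) * q) * B powr q)"
  have g: "grad (\<lambda>x. 0) y = 0" for y :: "real^'n" by (rule grad_eqI) simp
  have "Cap q (\<lambda>x. m x powr q) K (cube x0 (2 * r)) \<le> ennreal c *
      (\<integral>\<^sup>+y\<in>cube x0 r. ennreal ((norm (grad (\<lambda>x. 0) y) + \<bar>1 - 0\<bar> / r) powr q * m y powr q) \<partial>lborel)"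
    unfolding c_def by (rule Cap_extension[OF A mm m q B r C_k_const K]) (use r in auto)
  also have "(\<integral>\<^sup>+y\<in>cube x0 r. ennreal ((norm (grad (\<lambda>x. 0) y) + \<bar>1 - 0\<bar> / r) powr q * m y powr q) \<partial>lborel)
    = (\<integral>\<^sup>+y. ennreal (r powr - q) * (ennreal (m y powr q) * indicator (cube x0 r) y) \<partial>lborel)"
  proof (intro nn_integral_cong)
    fix y :: "real^'n"
    have e: "(norm (grad (\<lambda>x. 0) y) + \<bar>1 - 0\<bar> / r) powr q = r powr - q"
      using r by (simp add: g powr_divide powr_minus_divide)
    show "ennreal ((norm (grad (\<lambda>x. 0) y) + \<bar>1 - 0\<bar> / r) powr q * m y powr q) * indicator (cube x0 r) y
      = ennreal (r powr - q) * (ennreal (m y powr q) * indicator (cube x0 r) y)"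
      unfolding e by (simp only: ennreal_mult powr_ge_zero mult.assoc)
  qed
  also have "\<dots> = ennreal (r powr - q) * (\<integral>\<^sup>+y\<in>cube x0 r. ennreal (m y powr q) \<partial>lborel)"
    by (rule nn_integral_cmult) measurable
  also have "ennreal c * (ennreal (r powr - q) * (\<integral>\<^sup>+y\<in>cube x0 r. ennreal (m y powr q) \<partial>lborel))
    = ennreal (c * r powr - q) * (\<integral>\<^sup>+y\<in>cube x0 r. ennreal (m y powr q) \<partial>lborel)"
    by (simp add: ennreal_mult'' mult.assoc)
  finally show ?thesis by (simp only: c_def)
qed

lemma powr_add_le:
  fixes a b q :: real
  assumes "0 \<le> a" "0 \<le> b" "0 \<le> q"
  shows "(a + b) powr q \<le> 2 powr q * (a powr q + b powr q)"
proof -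
  have "(a + b) powr q \<le> (2 * max a b) powr q" using assms by (intro powr_mono2) auto
  also have "\<dots> = 2 powr q * max a b powr q" using assms by (simp add: powr_mult)
  also have "max a b powr q \<le> a powr q + b powr q" by (auto simp: max_def)
  finally show ?thesis by simp
qed

text \<open>The function \<open>f\<close> is a mollification of \<open>min 1 (2 * \<phi>)\<close> for an almost minimal \<open>\<phi>\<close>. The factor \<open>2\<close> makes it equal
  to \<open>1\<close> on a whole neighbourhood of \<open>K\<close>, as the test functions \<open>1 - f\<close> have to vanish there.\<close>

lemma near_extremal:
  fixes m :: "real^'n \<Rightarrow> real" and M E :: real
  assumes mm [measurable]: "m \<in> borel_measurable borel" and q: "1 < q"
    and M: "(\<integral>\<^sup>+x\<in>cube x0 R. ennreal (m x powr q) \<partial>lborel) = ennreal M" "0 \<le> M"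
    and K: "compact K" and E: "Cap q (\<lambda>x. m x powr q) K (cube x0 R) < ennreal E"
  obtains f d where "smooth f" "0 < d" "\<forall>k\<in>K. \<forall>x. infnorm (x - k) < d \<longrightarrow> f x = 1"
    "\<forall>x. x \<notin> cube x0 R \<longrightarrow> f x = 0 \<and> grad f x = 0"
    "(\<integral>\<^sup>+x\<in>cube x0 R. ennreal (norm (grad f x) powr q * m x powr q) \<partial>lborel) \<le> ennreal (4 powr q * E)"
proof -
  define N where "N = real CARD('n)"
  have N: "1 \<le> N" by (simp add: N_def)
  let ?U = "cube x0 R"
  from E obtain \<phi> where \<phi>: "\<phi> \<in> Cinf_c ?U" "\<And>x. x \<in> K \<Longrightarrow> 1 \<le> \<phi> x"
    and e: "(\<integral>\<^sup>+x\<in>?U. ennreal (norm (grad \<phi> x) powr q * m x powr q) \<partial>lborel) < ennreal E"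
    unfolding Cap_def nn_integral_completion by (auto simp: INF_less_iff)
  obtain E0 where E0: "(\<integral>\<^sup>+x\<in>?U. ennreal (norm (grad \<phi> x) powr q * m x powr q) \<partial>lborel) = ennreal E0" "0 \<le> E0"
    using less_trans[OF e ennreal_less_top] unfolding less_top_ennreal by blast
  have E0E: "E0 < E" using e E0 by (simp add: ennreal_less_iff)
  have C1: "C_k (Suc 0) \<phi>" using \<phi>(1) by (simp add: Cinf_c_def smooth_def del: C_k.simps)
  have c\<phi>: "continuous_on UNIV \<phi>" and cg: "continuous_on UNIV (grad \<phi>)"
    using C_k_continuous[OF C1] C_k_grad_continuous[OF C1] by auto
  have [measurable]: "grad \<phi> \<in> borel_measurable borel" using cg by (rule borel_measurable_continuous_onI)
  \<comment> \<open>The permitted oscillation of the gradient: its total contribution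
    \<open>\<omega> powr q * M\<close> fits into the slack \<open>E - E0\<close>. Adding 1 to
    \<open>M\<close> covers \<open>M = 0\<close>.\<close>
  define \<omega> where "\<omega> = ((E - E0) / (M + 1)) powr (1 / q)"
  have \<omega>: "0 < \<omega>" "\<omega> powr q * M \<le> E - E0"
  proof -
    show "0 < \<omega>" using E0E M by (simp add: \<omega>_def)
    have "\<omega> powr q = (E - E0) / (M + 1)" using E0E M q by (simp add: \<omega>_def powr_powr)
    then have "\<omega> powr q * M = (E - E0) * (M / (M + 1))" by simp
    also have "\<dots> \<le> (E - E0) * 1" using E0E M by (intro mult_left_mono) auto
    finally show "\<omega> powr q * M \<le> E - E0" by simp
  qed
  let ?C = "cbox (x0 - (\<chi> i. R + 1)) (x0 + (\<chi> i. R + 1))"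
  have "uniformly_continuous_on ?C (grad \<phi>)"
    by (intro compact_uniformly_continuous continuous_on_subset[OF cg]) auto
  then obtain d1 where d1: "0 < d1" "\<And>x y. x \<in> ?C \<Longrightarrow> y \<in> ?C \<Longrightarrow> dist y x < d1 \<Longrightarrow> dist (grad \<phi> y) (grad \<phi> x) < \<omega>"
    using \<omega>(1) unfolding uniformly_continuous_on_def by metis
  have "open {x. 1 / 2 < \<phi> x}" using c\<phi> by (intro open_Collect_less continuous_intros) auto
  moreover have "K \<subseteq> {x. 1 / 2 < \<phi> x}" using \<phi>(2) by force
  ultimately obtain d2 where d2: "0 < d2" "(\<Union>k\<in>K. ball k d2) \<subseteq> {x. 1 / 2 < \<phi> x}"
    using compact_subset_open_imp_ball_epsilon_subset[OF K] by metis
  have "compact (closure {x. \<phi> x \<noteq> 0})" "closure {x. \<phi> x \<noteq> 0} \<subseteq> ?U" using \<phi>(1) by (auto simp: Cinf_c_def)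
  then obtain d3 where d3: "0 < d3" "(\<Union>k\<in>closure {x. \<phi> x \<noteq> 0}. ball k d3) \<subseteq> ?U"
    using compact_subset_open_imp_ball_epsilon_subset[of "closure {x. \<phi> x \<noteq> 0}" ?U] open_cube by metis
  \<comment> \<open>Three scales are respected: the gradient oscillates by less than
    \<open>\<omega>\<close> within \<open>d1\<close>, \<open>\<phi>\<close> exceeds 1/2 within
    \<open>d2\<close> of \<open>K\<close>, and the support of \<open>\<phi>\<close> keeps distance
    \<open>d3\<close> from the complement of the cube. Dividing by \<open>2 * N\<close> turns the
    Euclidean distances into supremum distances, with room for two steps of size
    \<open>d\<close>.\<close>
  define d where "d = min (1 / 2) (min d1 (min d2 d3)) / (2 * N)"
  have d0: "0 < d" using d1 d2 d3 N by (simp add: d_def)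
  have "2 * (N * d) = min (1 / 2) (min d1 (min d2 d3))" using N by (simp add: d_def)
  then have dN: "2 * (N * d) \<le> d1" "2 * (N * d) \<le> d2" "2 * (N * d) \<le> d3" "2 * (N * d) \<le> 1" by auto
  have d1': "d \<le> N * d" using N d0 by simp
  have nrm: "norm x < c" if "infnorm x < e" "N * e \<le> c" for x :: "real^'n" and e c
  proof -
    have "norm x \<le> N * infnorm x" unfolding N_def by (rule norm_le_infnorm_cart)
    also have "\<dots> < N * e" using that N by simp
    finally show ?thesis using that by simp
  qed
  define F where "F x = min 1 (2 * \<phi> x)" for x
  have cF: "continuous_on UNIV F" unfolding F_def using c\<phi> by (intro continuous_intros)
  have \<phi>0: "\<phi> y = 0" if x: "x \<notin> ?U" and y: "infnorm (y - x) < d" for x y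
  proof (rule ccontr)
    assume "\<phi> y \<noteq> 0"
    then have "y \<in> closure {x. \<phi> x \<noteq> 0}" by (intro subsetD[OF closure_subset]) simp
    then have "ball y d3 \<subseteq> ?U" using d3(2) by (meson UN_subset_iff)
    moreover have "N * d \<le> d3" using dN(3) d0 d1' by linarith
    then have "norm (y - x) < d3" using nrm[OF y] by blast
    then have "x \<in> ball y d3" by (simp add: dist_norm)
    ultimately show False using x by blast
  qed
  have far: "F y = 0" if "x \<notin> ?U" "y \<in> cube x d" for x y
    using \<phi>0[of x y] that by (simp add: F_def in_cube_iff)
  have "bounded {x. F x \<noteq> 0}"
  proof (rule bounded_subset)
    show "bounded ?U" by (simp add: cube_eq_box)
    show "{x. F x \<noteq> 0} \<subseteq> ?U"
    proof
      fix x assume "x \<in> {x. F x \<noteq> 0}"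
      then show "x \<in> ?U" using far[of x x] cube_center[OF d0, of x] by (cases "x \<in> ?U") auto
    qed
  qed
  from cF this d0 obtain f where f: "smooth f"
    "\<forall>x c. (\<forall>y\<in>cube x d. F y = c) \<longrightarrow> f x = c"
    "\<forall>x L. (\<forall>y\<in>cube x d. \<forall>z\<in>cube x d. \<bar>F y - F z\<bar> \<le> L * norm (y - z)) \<longrightarrow> norm (grad f x) \<le> L"
    by (rule mollification)
  have C1f: "C_k (Suc 0) f" using f(1) unfolding smooth_def by blast
  have [measurable]: "grad f \<in> borel_measurable borel"
    using C_k_grad_continuous[OF C1f] by (rule borel_measurable_continuous_onI)
  \<comment> \<open>The mean value theorem on \<open>cube x d\<close>; the truncation at 1 does not
    increase differences, and the factor 2 is the one in \<open>F\<close>.\<close>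
  have grad_le: "norm (grad f x) \<le> 2 * (norm (grad \<phi> x) + \<omega>)" if x: "x \<in> ?U" for x
  proof (rule f(3)[rule_format])
    fix y z assume yz: "y \<in> cube x d" "z \<in> cube x d"
    have sub: "cube x d \<subseteq> ?C"
    proof
      fix w assume w: "w \<in> cube x d"
      have "\<bar>w $ i - x0 $ i\<bar> \<le> R + 1" for i
      proof -
        have "\<bar>w $ i - x $ i\<bar> < d" "\<bar>x $ i - x0 $ i\<bar> < R" using w x by (auto simp: cube_def)
        then show ?thesis using dN d1' d0 by linarith
      qed
      then show "w \<in> ?C" by (auto simp: mem_box_cart abs_le_iff algebra_simps)
    qed
    have "norm (\<phi> y - \<phi> z) \<le> (norm (grad \<phi> x) + \<omega>) * norm (y - z)"
    proof (rule differentiable_bound[where S = "cube x d" and f' = "\<lambda>w h. h \<bullet> grad \<phi> w"])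
      show "convex (cube x d)" by (simp add: cube_eq_box)
      fix w assume w: "w \<in> cube x d"
      have "\<phi> differentiable (at w)" using C1 unfolding C_k.simps by blast
      then show "(\<phi> has_derivative (\<lambda>h. h \<bullet> grad \<phi> w)) (at w within cube x d)"
        by (rule has_derivative_at_withinI[OF has_derivative_grad])
      have "N * d \<le> d1" using dN(1) d0 d1' by linarith
      then have "norm (w - x) < d1" using nrm[of "w - x" d d1] w by (simp add: in_cube_iff)
      then have "dist (grad \<phi> w) (grad \<phi> x) < \<omega>"
        using subsetD[OF sub w] subsetD[OF sub cube_center[OF d0]] by (intro d1(2)) (simp_all only: dist_norm)
      then have *: "norm (grad \<phi> w) \<le> norm (grad \<phi> x) + \<omega>"
        using norm_triangle_ineq2[of "grad \<phi> w" "grad \<phi> x"] by (simp add: dist_norm)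
      show "onorm (\<lambda>h. h \<bullet> grad \<phi> w) \<le> norm (grad \<phi> x) + \<omega>"
      proof (intro onorm_le)
        fix h
        have "\<bar>h \<bullet> grad \<phi> w\<bar> \<le> norm h * norm (grad \<phi> w)" by (rule Cauchy_Schwarz_ineq2)
        also have "\<dots> \<le> norm h * (norm (grad \<phi> x) + \<omega>)" by (intro mult_left_mono *) simp
        finally show "norm (h \<bullet> grad \<phi> w) \<le> (norm (grad \<phi> x) + \<omega>) * norm h" by (simp add: mult.commute)
      qed
    qed (use yz in auto)
    moreover have "\<bar>F y - F z\<bar> \<le> 2 * \<bar>\<phi> y - \<phi> z\<bar>"
    proof -
      have 1: "\<bar>min 1 a - min 1 b\<bar> \<le> \<bar>a - b\<bar>" for a b :: real by (auto simp: min_def)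
      have 2: "2 * a - 2 * b = 2 * (a - b)" for a b :: real by simp
      have "\<bar>2 * \<phi> y - 2 * \<phi> z\<bar> = 2 * \<bar>\<phi> y - \<phi> z\<bar>" unfolding 2 by (simp only: abs_mult abs_numeral)
      then show ?thesis using 1[of "2 * \<phi> y" "2 * \<phi> z"] unfolding F_def by (simp only:)
    qed
    ultimately show "\<bar>F y - F z\<bar> \<le> 2 * (norm (grad \<phi> x) + \<omega>) * norm (y - z)"
      unfolding mult.assoc real_norm_def by (meson mult_left_mono order_trans zero_le_numeral)
  qed
  have one: "f x = 1" if "k \<in> K" "infnorm (x - k) < d" for k x
  proof (rule f(2)[rule_format])
    fix y assume "y \<in> cube x d"
    then have "infnorm (y - k) < 2 * d"
      using infnorm_triangle[of "y - x" "x - k"] that by (simp add: in_cube_iff)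
    then have "norm (y - k) < d2" using dN(2) by (intro nrm[of _ "2 * d"]) (simp_all add: mult.left_commute)
    then have "y \<in> ball k d2" by (simp add: dist_norm norm_minus_commute)
    then have "1 / 2 < \<phi> y" using d2(2) that by blast
    then show "F y = 1" by (simp add: F_def)
  qed
  have zero: "f x = 0" if "x \<notin> ?U" for x using far[OF that] f(2) by blast
  have grad_zero: "grad f x = 0" if "x \<notin> ?U" for x
  proof -
    have "norm (grad f x) \<le> 0" by (rule f(3)[rule_format]) (simp add: far[OF that])
    then show ?thesis by simp
  qed
  have "(\<integral>\<^sup>+x\<in>?U. ennreal (norm (grad f x) powr q * m x powr q) \<partial>lborel)
    \<le> (\<integral>\<^sup>+x. ennreal (4 powr q) * (ennreal (norm (grad \<phi> x) powr q * m x powr q) * indicator ?U x + ennreal (\<omega> powr q) * (ennreal (m x powr q) * indicator ?U x)) \<partial>lborel)"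
  proof (intro nn_integral_mono)
    fix x
    show "ennreal (norm (grad f x) powr q * m x powr q) * indicator ?U x
      \<le> ennreal (4 powr q) * (ennreal (norm (grad \<phi> x) powr q * m x powr q) * indicator ?U x + ennreal (\<omega> powr q) * (ennreal (m x powr q) * indicator ?U x))"
    proof (cases "x \<in> ?U")
      case True
      have "norm (grad f x) powr q \<le> (2 * (norm (grad \<phi> x) + \<omega>)) powr q"
        using grad_le[OF True] q by (intro powr_mono2) auto
      also have "\<dots> = 2 powr q * (norm (grad \<phi> x) + \<omega>) powr q"
        using \<omega> by (intro powr_mult)
      also have "\<dots> \<le> 2 powr q * (2 powr q * (norm (grad \<phi> x) powr q + \<omega> powr q))"
        using \<omega> q by (intro mult_left_mono powr_add_le) auto
      also have "\<dots> = 4 powr q * (norm (grad \<phi> x) powr q + \<omega> powr q)"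
        by (simp add: powr_mult[of 2 2, symmetric] mult.assoc[symmetric])
      finally have "norm (grad f x) powr q * m x powr q \<le> 4 powr q * (norm (grad \<phi> x) powr q + \<omega> powr q) * m x powr q"
        by (intro mult_right_mono) auto
      then have "ennreal (norm (grad f x) powr q * m x powr q) \<le> ennreal (4 powr q * (norm (grad \<phi> x) powr q * m x powr q + \<omega> powr q * m x powr q))"
        by (intro ennreal_leI) (simp add: algebra_simps)
      then show ?thesis using True by (simp add: ennreal_mult[symmetric] ennreal_plus[symmetric] del: ennreal_plus)
    qed simp
  qed
  also have "\<dots> = ennreal (4 powr q) * (ennreal E0 + ennreal (\<omega> powr q) * ennreal M)"
    using E0 M by (simp add: nn_integral_cmult nn_integral_add)
  also have "\<dots> = ennreal (4 powr q * (E0 + \<omega> powr q * M))"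
    using E0 M by (simp add: ennreal_mult[symmetric] ennreal_plus[symmetric] del: ennreal_plus)
  also have "\<dots> \<le> ennreal (4 powr q * E)"
    using \<omega>(2) by (intro ennreal_leI mult_left_mono) auto
  finally have int: "(\<integral>\<^sup>+x\<in>?U. ennreal (norm (grad f x) powr q * m x powr q) \<partial>lborel) \<le> ennreal (4 powr q * E)" .
  show thesis by (rule that[OF f(1) d0 _ _ int]) (use one zero grad_zero in blast)+
qed

section \<open>The Friedrichs inequality\<close>

lemma Apq_mono: "Apq m p q B \<Longrightarrow> B \<le> B' \<Longrightarrow> Apq m p q B'"
  unfolding Apq_def by (meson ennreal_leI mult_right_mono order_trans powr_ge_zero)

text \<open>Jensen's inequality replaces the integral of \<open>m powr q\<close> by that of
  \<open>m powr p\<close>; the volume factors match, so \<open>B\<close> does not change.\<close>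

lemma Apq_diag:
  fixes m :: "real^'n \<Rightarrow> real"
  assumes A: "Apq m p q B" and [measurable]: "m \<in> borel_measurable borel" and pq: "1 < q" "q \<le> p"
    and B: "0 \<le> B"
  shows "Apq m q q B"
proof (cases "q = p")
  case False
  then have qp: "1 < p / q" using pq by simp
  show ?thesis
    unfolding Apq_def
  proof (intro allI impI)
    fix x0 :: "real^'n" and r :: real assume r: "0 < r"
    let ?S = "\<integral>\<^sup>+x\<in>cube x0 r. ennreal (m x powr - (q / (q - 1))) \<partial>lborel"
    let ?P = "\<integral>\<^sup>+x\<in>cube x0 r. ennreal (m x powr p) \<partial>lborel"
    let ?Q = "\<integral>\<^sup>+x\<in>cube x0 r. ennreal (m x powr q) \<partial>lborel"
    define V where "V = (2 * r) powr real CARD('n)"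
    have V: "0 < V" using r by (simp add: V_def)
    have "epowr ?Q (p / q) \<le> ennreal (V powr (p / q - 1)) * (\<integral>\<^sup>+x\<in>cube x0 r. epowr (ennreal (m x powr q)) (p / q) \<partial>lborel)"
      by (rule nn_integral_Jensen) (use qp r in \<open>auto simp: emeasure_cube V_def\<close>)
    also have "(\<integral>\<^sup>+x\<in>cube x0 r. epowr (ennreal (m x powr q)) (p / q) \<partial>lborel) = ?P"
      using pq by (simp add: epowr_ennreal powr_powr)
    finally have "epowr (epowr ?Q (p / q)) (1 / p) \<le> epowr (ennreal (V powr (p / q - 1)) * ?P) (1 / p)"
      using pq by (intro epowr_mono) auto
    moreover have "p / q * (1 / p) = 1 / q" "(p / q - 1) * (1 / p) = 1 / q - 1 / p"
      using pq by (auto simp: field_simps)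
    ultimately have 1: "epowr ?Q (1 / q) \<le> ennreal (V powr (1 / q - 1 / p)) * epowr ?P (1 / p)"
      by (simp only: epowr_mult epowr_epowr epowr_ennreal powr_ge_zero powr_powr)
    have "epowr ?Q (1 / q) * epowr ?S ((q - 1) / q) \<le> ennreal (V powr (1 / q - 1 / p)) * epowr ?P (1 / p) * epowr ?S ((q - 1) / q)"
      by (intro mult_right_mono 1) simp
    also have "\<dots> \<le> ennreal (V powr (1 / q - 1 / p)) * ennreal (B * (2 * r) powr (CARD('n) * (1 / p + (q - 1) / q)))"
      unfolding mult.assoc using A r by (intro mult_left_mono) (auto simp: Apq_def)
    also have "\<dots> = ennreal (B * (2 * r) powr (CARD('n) * (1 / q + (q - 1) / q)))"
    proof -
      have "V powr (1 / q - 1 / p) * (2 * r) powr (CARD('n) * (1 / p + (q - 1) / q)) = (2 * r) powr (CARD('n) * (1 / q + (q - 1) / q))"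
        by (simp add: V_def powr_powr powr_add[symmetric] distrib_left[symmetric])
      then show ?thesis using B by (simp add: ennreal_mult[symmetric] mult.left_commute)
    qed
    finally show "epowr ?Q (1 / q) * epowr ?S ((q - 1) / q) \<le> ennreal (B * (2 * r) powr (CARD('n) * (1 / q + (q - 1) / q)))" .
  qed
qed (use A in simp)

text \<open>\<open>single_cube_estimate\<close> with \<open>g = 1\<close> on the inner cube; the
  side lengths have ratio 4.\<close>

lemma Apq_doubling:
  fixes m :: "real^'n \<Rightarrow> real"
  assumes A: "Apq m q q B" and mm [measurable]: "m \<in> borel_measurable borel" and m: "\<And>x. 0 < m x"
    and q: "1 < q" and B: "0 \<le> B" and r: "0 < r"
  shows "(\<integral>\<^sup>+x\<in>cube x0 (2 * r). ennreal (m x powr q) \<partial>lborel) \<le>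
    ennreal (B powr q * 4 powr (real CARD('n) * q)) * (\<integral>\<^sup>+x\<in>cube x0 (r / 2). ennreal (m x powr q) \<partial>lborel)"
    (is "?W \<le> _ * ?W'")
proof -
  define k where "k = real CARD('n) * q"
  have "epowr (\<integral>\<^sup>+y\<in>cube x0 (r / 2). 1 \<partial>lborel) q * ?W
    \<le> ennreal (B powr q * (2 * (2 * r)) powr (CARD('n) * (1 + q - q / q))) *
       epowr (\<integral>\<^sup>+y\<in>cube x0 (r / 2). epowr 1 q * ennreal (m y powr q) \<partial>lborel) (q / q)"
    by (rule single_cube_estimate[OF A mm m]) (use q r B in \<open>auto intro!: cube_mono\<close>)
  then have "ennreal (r powr k) * ?W \<le> ennreal (B powr q * (4 * r) powr k) * ?W'"
    using r q by (simp add: emeasure_cube epowr_ennreal powr_powr k_def)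
  then have "ennreal (r powr - k) * (ennreal (r powr k) * ?W) \<le> ennreal (r powr - k) * (ennreal (B powr q * (4 * r) powr k) * ?W')"
    by (intro mult_left_mono) auto
  moreover have "ennreal (r powr - k) * ennreal (r powr k) = 1"
    using r by (simp add: ennreal_mult[symmetric] powr_add[symmetric])
  moreover have "ennreal (r powr - k) * ennreal (B powr q * (4 * r) powr k) = ennreal (B powr q * 4 powr k)"
    using r by (simp add: ennreal_mult[symmetric] powr_mult powr_minus field_simps)
  ultimately show ?thesis by (simp add: mult.assoc[symmetric] k_def)
qed

text \<open>The reverse of Jensen's inequality: the \<open>p\<close>-mean of \<open>m\<close> is at
  most \<open>B\<close> times its \<open>q\<close>-mean. It is \<open>single_cube_estimate\<close>
  with \<open>g = 1\<close> and \<open>S\<close> the whole cube.\<close>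

lemma Apq_mass_compare:
  fixes m :: "real^'n \<Rightarrow> real"
  assumes A: "Apq m p q B" and mm [measurable]: "m \<in> borel_measurable borel" and m: "\<And>x. 0 < m x"
    and pq: "1 < q" "q \<le> p" and B: "0 \<le> B" and r: "0 < r"
  shows "(\<integral>\<^sup>+x\<in>cube x0 r. ennreal (m x powr p) \<partial>lborel) \<le>
    ennreal (B powr p * ((2 * r) powr real CARD('n)) powr (1 - p / q)) * epowr (\<integral>\<^sup>+x\<in>cube x0 r. ennreal (m x powr q) \<partial>lborel) (p / q)"
    (is "?W \<le> _ * epowr ?W' _")
proof -
  define V where "V = (2 * r) powr real CARD('n)"
  have V: "0 < V" using r by (simp add: V_def)
  have "epowr (\<integral>\<^sup>+y\<in>cube x0 r. 1 \<partial>lborel) p * ?W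
    \<le> ennreal (B powr p * (2 * r) powr (CARD('n) * (1 + p - p / q))) *
       epowr (\<integral>\<^sup>+y\<in>cube x0 r. epowr 1 q * ennreal (m y powr q) \<partial>lborel) (p / q)"
    by (rule single_cube_estimate[OF A mm m]) (use pq r B in auto)
  then have "ennreal (V powr p) * ?W \<le> ennreal (B powr p * V powr (1 + p - p / q)) * epowr ?W' (p / q)"
    using r by (simp add: emeasure_cube epowr_ennreal V_def powr_powr)
  then have "ennreal (V powr - p) * (ennreal (V powr p) * ?W) \<le> ennreal (V powr - p) * (ennreal (B powr p * V powr (1 + p - p / q)) * epowr ?W' (p / q))"
    by (intro mult_left_mono) auto
  moreover have "ennreal (V powr - p) * ennreal (V powr p) = 1"
    using V by (simp add: ennreal_mult[symmetric] powr_add[symmetric])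
  moreover have "ennreal (V powr - p) * ennreal (B powr p * V powr (1 + p - p / q)) = ennreal (B powr p * V powr (1 - p / q))"
    by (simp add: ennreal_mult[symmetric] mult.left_commute powr_add[symmetric])
  ultimately show ?thesis by (simp add: mult.assoc[symmetric] V_def)
qed

text \<open>The deviation from the mean is at most the average of
  \<open>\<bar>v x - v y\<bar>\<close> over \<open>y\<close>. The remaining powers of
  \<open>r\<close> are rewritten with the volume \<open>V\<close>, so that they later cancel against
  the averages.\<close>

lemma mean_Poincare:
  fixes m v :: "real^'n \<Rightarrow> real" and p q B r :: real and x0 :: "real^'n"
  assumes A: "Apq m p q B" and mm [measurable]: "m \<in> borel_measurable borel" and m: "\<And>x. 0 < m x"
    and pq: "1 < q" "q \<le> p" and np: "CARD('n) * (p / q - 1) \<le> 1 / 2" and B: "0 \<le> B" and r: "0 < r"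
    and v: "C_k (Suc 0) v"
  defines "V \<equiv> (2 * r) powr real CARD('n)"
  defines "a \<equiv> (LINT y:cube x0 r|lborel. v y) / V"
  shows "(\<integral>\<^sup>+x\<in>cube x0 r. ennreal (\<bar>v x - a\<bar> powr p * m x powr p) \<partial>lborel)
    \<le> ennreal (2 * (2 * real CARD('n)) powr p * 8 powr (real CARD('n) * p) * B powr p * (r powr p * V powr (1 - p / q))) *
      epowr (\<integral>\<^sup>+y\<in>cube x0 r. ennreal (norm (grad v y) powr q * m y powr q) \<partial>lborel) (p / q)"
proof -
  define N where "N = real CARD('n)"
  define K where "K = 2 * (2 * N) powr p * 8 powr (N * p) * B powr p"
  have K: "0 \<le> K" by (simp add: K_def)
  have V: "0 < V" using r by (simp add: V_def)
  have cv: "continuous_on UNIV v" using v by (rule C_k_continuous)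
  have [measurable]: "v \<in> borel_measurable borel" using cv by (rule borel_measurable_continuous_onI)
  define I where "I = (\<integral>\<^sup>+y\<in>cube x0 r. ennreal (norm (grad v y) powr q * m y powr q) \<partial>lborel)"
  have pw: "ennreal \<bar>v x - a\<bar> \<le> ennreal (1 / V) * (\<integral>\<^sup>+y\<in>cube x0 r. ennreal \<bar>v x - v y\<bar> \<partial>lborel)" for x
  proof -
    note int = set_integrable_cube[OF cv, of x0 r] set_integrable_cube[OF continuous_on_const, of x0 r]
    have "(LINT y:cube x0 r|lborel. v x) = V * v x"
      using emeasure_cube[OF r, of x0] by (simp add: set_lebesgue_integral_def measure_def V_def)
    then have "v x - a = (1 / V) * (LINT y:cube x0 r|lborel. v x - v y)"
      using V by (subst set_integral_diff[OF int(2) int(1)]) (simp add: a_def field_simps)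
    then have "ennreal \<bar>v x - a\<bar> = ennreal (1 / V) * ennreal \<bar>LINT y:cube x0 r|lborel. v x - v y\<bar>"
      using V by (simp only: abs_mult) (simp add: ennreal_mult[symmetric])
    also have "\<dots> \<le> ennreal (1 / V) * (\<integral>\<^sup>+y\<in>cube x0 r. ennreal \<bar>v x - v y\<bar> \<partial>lborel)"
      by (intro mult_left_mono set_integral_cube_abs_le continuous_on_diff cv continuous_on_const) simp
    finally show ?thesis .
  qed
  have "(\<integral>\<^sup>+x\<in>cube x0 r. ennreal (\<bar>v x - a\<bar> powr p * m x powr p) \<partial>lborel)
    \<le> (\<integral>\<^sup>+x. ennreal (V powr - p) * (epowr (\<integral>\<^sup>+y\<in>cube x0 r. ennreal \<bar>v x - v y\<bar> \<partial>lborel) p * ennreal (m x powr p) * indicator (cube x0 r) x) \<partial>lborel)"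
  proof (intro nn_integral_mono)
    fix x
    have "epowr (ennreal \<bar>v x - a\<bar>) p \<le> epowr (ennreal (1 / V) * (\<integral>\<^sup>+y\<in>cube x0 r. ennreal \<bar>v x - v y\<bar> \<partial>lborel)) p"
      using pq by (intro epowr_mono pw) auto
    then have 1: "ennreal (\<bar>v x - a\<bar> powr p) \<le> ennreal (V powr - p) * epowr (\<integral>\<^sup>+y\<in>cube x0 r. ennreal \<bar>v x - v y\<bar> \<partial>lborel) p"
      using V by (simp add: epowr_mult epowr_ennreal powr_divide powr_minus_divide)
    have "ennreal (\<bar>v x - a\<bar> powr p) * (ennreal (m x powr p) * indicator (cube x0 r) x)
      \<le> ennreal (V powr - p) * epowr (\<integral>\<^sup>+y\<in>cube x0 r. ennreal \<bar>v x - v y\<bar> \<partial>lborel) p * (ennreal (m x powr p) * indicator (cube x0 r) x)"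
      by (intro mult_right_mono 1) simp
    then show "ennreal (\<bar>v x - a\<bar> powr p * m x powr p) * indicator (cube x0 r) x
      \<le> ennreal (V powr - p) * (epowr (\<integral>\<^sup>+y\<in>cube x0 r. ennreal \<bar>v x - v y\<bar> \<partial>lborel) p * ennreal (m x powr p) * indicator (cube x0 r) x)"
      by (simp only: ennreal_mult powr_ge_zero mult.assoc)
  qed
  also have "\<dots> = ennreal (V powr - p) * (\<integral>\<^sup>+x\<in>cube x0 r. epowr (\<integral>\<^sup>+y\<in>cube x0 r. ennreal \<bar>v x - v y\<bar> \<partial>lborel) p * ennreal (m x powr p) \<partial>lborel)"
    by (rule nn_integral_cmult) measurable
  also have "\<dots> \<le> ennreal (V powr - p) * (ennreal (K * r powr (p + N * (1 + p - p / q))) * epowr I (p / q))"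
    unfolding K_def N_def I_def
    by (intro mult_left_mono weighted_Poincare[OF A mm m pq np B r v]) simp
  also have "\<dots> = ennreal (V powr - p * (K * r powr (p + N * (1 + p - p / q)))) * epowr I (p / q)"
    by (simp add: ennreal_mult'' K mult.assoc[symmetric])
  also have "\<dots> \<le> ennreal (K * (r powr p * V powr (1 - p / q))) * epowr I (p / q)"
  proof (intro mult_right_mono ennreal_leI)
    have "r powr (N * (1 + p - p / q)) \<le> V powr (1 + p - p / q)"
    proof -
      have "p / q \<le> p" using pq by (simp add: field_simps)
      then have "r powr (N * (1 + p - p / q)) \<le> (2 * r) powr (N * (1 + p - p / q))"
        using r by (intro powr_mono2) (auto simp: N_def)
      then show ?thesis by (simp add: V_def powr_powr N_def)
    qed
    then have "V powr - p * r powr (N * (1 + p - p / q)) \<le> V powr - p * V powr (1 + p - p / q)"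
      by (intro mult_left_mono) auto
    also have "\<dots> = V powr (1 - p / q)" by (simp add: powr_add[symmetric])
    finally have "(K * r powr p) * (V powr - p * r powr (N * (1 + p - p / q))) \<le> (K * r powr p) * V powr (1 - p / q)"
      using K by (intro mult_left_mono) auto
    then show "V powr - p * (K * r powr (p + N * (1 + p - p / q))) \<le> K * (r powr p * V powr (1 - p / q))"
      by (simp add: powr_add mult_ac)
  qed simp
  finally show ?thesis by (simp add: K_def N_def I_def)
qed

text \<open>The Poincare inequality on the cube of radius \<open>4 * r\<close>. There
  \<open>f\<close> vanishes on at least half of the volume \<open>V\<close>, so
  \<open>\<bar>f x\<bar> * V / 2\<close> is at most the integral of
  \<open>\<bar>f x - f y\<bar>\<close> over \<open>y\<close>. Equal exponents make the condition on
  \<open>p / q\<close> trivial.\<close>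

lemma Friedrichs:
  fixes m f :: "real^'n \<Rightarrow> real" and q B r :: real
  assumes A: "Apq m q q B" and mm [measurable]: "m \<in> borel_measurable borel" and m: "\<And>x. 0 < m x"
    and q: "1 < q" and B: "0 \<le> B" and r: "0 < r"
    and f: "C_k (Suc 0) f" and f0: "\<forall>x. x \<notin> cube x0 (2 * r) \<longrightarrow> f x = 0 \<and> grad f x = 0"
  shows "(\<integral>\<^sup>+x\<in>cube x0 (2 * r). ennreal (\<bar>f x\<bar> powr q * m x powr q) \<partial>lborel)
    \<le> ennreal (2 * (2 * real CARD('n)) powr q * 8 powr (real CARD('n) * q) * B powr q * 8 powr q * r powr q) *
      (\<integral>\<^sup>+y\<in>cube x0 (2 * r). ennreal (norm (grad f y) powr q * m y powr q) \<partial>lborel)"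
proof -
  define N where "N = real CARD('n)"
  have N: "1 \<le> N" by (simp add: N_def)
  define K where "K = 2 * (2 * N) powr q * 8 powr (N * q) * B powr q"
  have K: "0 \<le> K" by (simp add: K_def)
  define V where "V = (8 * r) powr N"
  have V: "0 < V" using r by (simp add: V_def)
  define J where "J = (\<integral>\<^sup>+y\<in>cube x0 (2 * r). ennreal (norm (grad f y) powr q * m y powr q) \<partial>lborel)"
  have cf: "continuous_on UNIV f" using f by (rule C_k_continuous)
  have [measurable]: "f \<in> borel_measurable borel" using cf by (rule borel_measurable_continuous_onI)
  have sub: "cube x0 (2 * r) \<subseteq> cube x0 (4 * r)" using r by (intro cube_mono) simp
  have vol: "ennreal (V / 2) \<le> emeasure lborel (cube x0 (4 * r) - cube x0 (2 * r))"
  proof -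
    have "emeasure lborel (cube x0 (4 * r) - cube x0 (2 * r)) = ennreal (V - (4 * r) powr N)"
      using r sub by (subst emeasure_Diff) (auto simp: emeasure_cube V_def N_def ennreal_minus)
    moreover have "(4 * r) powr N \<le> V / 2"
    proof -
      have "(4 * r) powr N = V * (1 / 2) powr N"
        using r by (simp add: V_def powr_mult[symmetric])
      also have "(1 / 2) powr N \<le> (1 / 2) powr (1::real)" using N by (intro powr_mono') auto
      finally show ?thesis using V by simp
    qed
    ultimately show ?thesis by (auto intro: ennreal_leI)
  qed
  have pw: "ennreal \<bar>f x\<bar> * ennreal (V / 2) \<le> (\<integral>\<^sup>+y\<in>cube x0 (4 * r). ennreal \<bar>f x - f y\<bar> \<partial>lborel)" for x
  proof -
    have "ennreal \<bar>f x\<bar> * ennreal (V / 2) \<le> ennreal \<bar>f x\<bar> * emeasure lborel (cube x0 (4 * r) - cube x0 (2 * r))"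
      by (intro mult_left_mono vol) simp
    also have "\<dots> = (\<integral>\<^sup>+y. ennreal \<bar>f x\<bar> * indicator (cube x0 (4 * r) - cube x0 (2 * r)) y \<partial>lborel)"
      by (simp add: nn_integral_cmult)
    also have "\<dots> \<le> (\<integral>\<^sup>+y\<in>cube x0 (4 * r). ennreal \<bar>f x - f y\<bar> \<partial>lborel)"
      by (intro nn_integral_mono) (use f0 in \<open>auto simp: indicator_def\<close>)
    finally show ?thesis .
  qed
  have "(\<integral>\<^sup>+x\<in>cube x0 (2 * r). ennreal (\<bar>f x\<bar> powr q * m x powr q) \<partial>lborel)
    \<le> (\<integral>\<^sup>+x. ennreal ((2 / V) powr q) * (epowr (\<integral>\<^sup>+y\<in>cube x0 (4 * r). ennreal \<bar>f x - f y\<bar> \<partial>lborel) q * ennreal (m x powr q) * indicator (cube x0 (4 * r)) x) \<partial>lborel)"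
  proof (intro nn_integral_mono)
    fix x
    let ?T = "\<integral>\<^sup>+y\<in>cube x0 (4 * r). ennreal \<bar>f x - f y\<bar> \<partial>lborel"
    have "ennreal \<bar>f x\<bar> = ennreal (2 / V) * (ennreal \<bar>f x\<bar> * ennreal (V / 2))"
      using V by (simp add: ennreal_mult[symmetric])
    also have "\<dots> \<le> ennreal (2 / V) * ?T" by (intro mult_left_mono pw) simp
    finally have "epowr (ennreal \<bar>f x\<bar>) q \<le> epowr (ennreal (2 / V) * ?T) q"
      using q by (intro epowr_mono) auto
    then have "ennreal (\<bar>f x\<bar> powr q) \<le> ennreal ((2 / V) powr q) * epowr ?T q"
      using V by (simp add: epowr_mult epowr_ennreal)
    then have "ennreal (\<bar>f x\<bar> powr q) * (ennreal (m x powr q) * indicator (cube x0 (2 * r)) x)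
       \<le> ennreal ((2 / V) powr q) * epowr ?T q * (ennreal (m x powr q) * indicator (cube x0 (4 * r)) x)"
      using sub by (intro mult_mono) (auto simp: indicator_def)
    then show "ennreal (\<bar>f x\<bar> powr q * m x powr q) * indicator (cube x0 (2 * r)) x
      \<le> ennreal ((2 / V) powr q) * (epowr ?T q * ennreal (m x powr q) * indicator (cube x0 (4 * r)) x)"
      by (simp only: ennreal_mult powr_ge_zero mult.assoc)
  qed
  also have "\<dots> = ennreal ((2 / V) powr q) * (\<integral>\<^sup>+x\<in>cube x0 (4 * r). epowr (\<integral>\<^sup>+y\<in>cube x0 (4 * r). ennreal \<bar>f x - f y\<bar> \<partial>lborel) q * ennreal (m x powr q) \<partial>lborel)"
    by (rule nn_integral_cmult) measurable
  also have "\<dots> \<le> ennreal ((2 / V) powr q) * (ennreal (K * (4 * r) powr (q + N * (1 + q - q / q))) *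
      epowr (\<integral>\<^sup>+y\<in>cube x0 (4 * r). ennreal (norm (grad f y) powr q * m y powr q) \<partial>lborel) (q / q))"
    unfolding K_def N_def
    by (intro mult_left_mono weighted_Poincare[OF A mm m q order.refl _ B _ f]) (use q r in auto)
  also have "(\<integral>\<^sup>+y\<in>cube x0 (4 * r). ennreal (norm (grad f y) powr q * m y powr q) \<partial>lborel) = J"
    unfolding J_def using f0 sub by (intro nn_integral_cong) (auto simp: indicator_def)
  also have "ennreal ((2 / V) powr q) * (ennreal (K * (4 * r) powr (q + N * (1 + q - q / q))) * epowr J (q / q))
    = ennreal ((2 / V) powr q * (K * (4 * r) powr (q + N * q))) * J"
    using q by (simp add: ennreal_mult'' K mult.assoc[symmetric])
  also have "\<dots> \<le> ennreal (K * 8 powr q * r powr q) * J"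
  proof (intro mult_right_mono ennreal_leI)
    have "(4 * r) powr (N * q) \<le> V powr q"
      unfolding V_def powr_powr using r N q by (intro powr_mono2) auto
    then have "(2 / V) powr q * (4 * r) powr (N * q) \<le> (2 / V) powr q * V powr q"
      by (intro mult_left_mono) auto
    also have "\<dots> = 2 powr q" using V by (simp add: powr_mult[symmetric])
    finally have "K * (4 * r) powr q * ((2 / V) powr q * (4 * r) powr (N * q)) \<le> K * (4 * r) powr q * 2 powr q"
      using K by (intro mult_left_mono) auto
    also have "\<dots> = K * 8 powr q * r powr q"
    proof -
      have "(4 * r) powr q * 2 powr q = (8 * r) powr q" using r by (simp add: powr_mult[symmetric])
      also have "\<dots> = 8 powr q * r powr q" using r by (simp add: powr_mult)
      finally show ?thesis by (simp only: mult.assoc)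
    qed
    finally show "(2 / V) powr q * (K * (4 * r) powr (q + N * q)) \<le> K * 8 powr q * r powr q"
      by (simp add: powr_add mult_ac)
  qed simp
  finally show ?thesis by (simp add: K_def N_def J_def)
qed

section \<open>Upper estimate\<close>

text \<open>The estimates above produce such constants with exponent \<open>q\<close>. With all
  bases at least 1 they increase with the exponent, so their values at \<open>p\<close> serve every
  \<open>q\<close> in the range.\<close>

definition poincare_const :: "real \<Rightarrow> real \<Rightarrow> real \<Rightarrow> real" where
  "poincare_const N p B = 2 * (2 * N) powr p * 8 powr (N * p) * B powr p"

definition capacity_const :: "real \<Rightarrow> real \<Rightarrow> real \<Rightarrow> real" where
  "capacity_const N p B = (4 * N) powr p * (2 * 552 powr (N * p) * B powr p)"

definition mean_const :: "real \<Rightarrow> real \<Rightarrow> real \<Rightarrow> real" where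
  "mean_const N p B = capacity_const N p B * 2 powr p * (1 + poincare_const N p B)"

text \<open>The two summands belong to the deviation \<open>v - a\<close> and to the mean
  \<open>a\<close>; the factor \<open>2 powr p\<close> splits the power of their sum.\<close>

definition upper_const :: "real \<Rightarrow> real \<Rightarrow> real \<Rightarrow> real" where
  "upper_const N p B = (2 powr p * (poincare_const N p B * capacity_const N p B powr p + B powr p * mean_const N p B powr p)) powr (1 / p)"

lemma poincare_const_mono: "1 \<le> N \<Longrightarrow> 1 \<le> B \<Longrightarrow> 0 \<le> q \<Longrightarrow> q \<le> p \<Longrightarrow> poincare_const N q B \<le> poincare_const N p B"
  unfolding poincare_const_def by (intro mult_mono powr_mono mult_left_mono) auto

lemma capacity_const_mono: "1 \<le> N \<Longrightarrow> 1 \<le> B \<Longrightarrow> 0 \<le> q \<Longrightarrow> q \<le> p \<Longrightarrow> capacity_const N q B \<le> capacity_const N p B"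
  unfolding capacity_const_def by (intro mult_mono powr_mono mult_left_mono) auto

lemma upper_consts_ge_1:
  assumes "1 \<le> N" "1 \<le> B" "0 \<le> p"
  shows "1 \<le> poincare_const N p B" "1 \<le> capacity_const N p B" "1 \<le> mean_const N p B"
proof -
  have ge: "1 \<le> (2 * N) powr p" "1 \<le> (8::real) powr (N * p)" "1 \<le> B powr p" "1 \<le> (4 * N) powr p" "1 \<le> (552::real) powr (N * p)" "1 \<le> (2::real) powr p"
    using assms by (auto intro!: ge_one_powr_ge_zero)
  have m: "1 \<le> a * b" if "1 \<le> a" "1 \<le> b" for a b :: real
    using mult_mono[of 1 a 1 b] that by simp
  show 1: "1 \<le> poincare_const N p B" unfolding poincare_const_def by (intro m ge) simp
  show 2: "1 \<le> capacity_const N p B" unfolding capacity_const_def by (intro m ge) simp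
  show "1 \<le> mean_const N p B" unfolding mean_const_def using 1 by (intro m ge 2) simp
qed

text \<open>\<open>Cap_extension\<close> for \<open>u = v / a\<close>, which still vanishes near
  \<open>K\<close>. Since \<open>\<bar>1 - u\<bar> = \<bar>v - a\<bar> / \<bar>a\<bar>\<close>, both
  terms of the resulting energy are controlled by that of \<open>v\<close>, the second through the
  assumed Poincare bound, and \<open>\<bar>a\<bar> powr q\<close> moves to the other side.\<close>

lemma mean_capacity_estimate:
  fixes m v :: "real^'n \<Rightarrow> real" and q B r \<kappa> \<iota> a :: real and x0 :: "real^'n"
  assumes A: "Apq m q q B" and mm [measurable]: "m \<in> borel_measurable borel" and m: "\<And>x. 0 < m x"
    and q: "1 < q" "q \<le> p" and B: "1 \<le> B" and r: "0 < r" and v: "C_k (Suc 0) v"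
    and K: "K \<subseteq> closure (cube x0 r)" and d: "0 < d"
    and v0: "\<And>k w. k \<in> K \<Longrightarrow> w \<in> cube x0 r \<Longrightarrow> infnorm (w - k) < d \<Longrightarrow> v w = 0"
    and \<kappa>: "Cap q (\<lambda>x. m x powr q) K (cube x0 (2 * r)) = ennreal \<kappa>" "0 \<le> \<kappa>"
    and \<iota>: "(\<integral>\<^sup>+y\<in>cube x0 r. ennreal (norm (grad v y) powr q * m y powr q) \<partial>lborel) = ennreal \<iota>" "0 \<le> \<iota>"
    and a: "(\<integral>\<^sup>+x\<in>cube x0 r. ennreal (\<bar>v x - a\<bar> powr q * m x powr q) \<partial>lborel) \<le> ennreal (poincare_const (real CARD('n)) p B * (r powr q * \<iota>))"
  shows "\<kappa> * \<bar>a\<bar> powr q \<le> mean_const (real CARD('n)) p B * \<iota>"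
proof (cases "a = 0")
  case True
  then show ?thesis using \<iota> upper_consts_ge_1[of "real CARD('n)" B p] B q by simp
next
  case False
  define N where "N = real CARD('n)"
  have N: "1 \<le> N" by (simp add: N_def)
  note c1 = upper_consts_ge_1[OF N B, of p]
  have [measurable]: "grad v \<in> borel_measurable borel" "v \<in> borel_measurable borel"
    using C_k_grad_continuous[OF v] C_k_continuous[OF v] by (auto intro: borel_measurable_continuous_onI)
  define u where "u x = (1 / a) * v x + 0" for x
  have u: "C_k (Suc 0) u" unfolding u_def by (rule C_k_affine[OF v])
  have gu: "grad u x = (1 / a) *\<^sub>R grad v x" for x
  proof (rule grad_eqI)
    have "v differentiable (at x)" using v unfolding C_k.simps by blast
    from has_derivative_grad[OF this] show "(u has_derivative (\<lambda>h. h \<bullet> ((1 / a) *\<^sub>R grad v x))) (at x)"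
      using False unfolding u_def by (auto intro!: derivative_eq_intros)
  qed
  have pw: "(norm (grad u y) + \<bar>1 - u y\<bar> / r) powr q * m y powr q
    \<le> \<bar>a\<bar> powr - q * 2 powr q * (norm (grad v y) powr q * m y powr q + r powr - q * (\<bar>v y - a\<bar> powr q * m y powr q))" for y
  proof -
    have "1 - u y = (1 / a) * (a - v y)" using False by (simp add: u_def field_simps)
    then have "\<bar>1 - u y\<bar> = (1 / \<bar>a\<bar>) * \<bar>v y - a\<bar>" by (simp add: abs_mult abs_minus_commute)
    then have "norm (grad u y) + \<bar>1 - u y\<bar> / r = (1 / \<bar>a\<bar>) * (norm (grad v y) + \<bar>v y - a\<bar> / r)"
      by (simp add: gu distrib_left)
    then have "(norm (grad u y) + \<bar>1 - u y\<bar> / r) powr q = \<bar>a\<bar> powr - q * (norm (grad v y) + \<bar>v y - a\<bar> / r) powr q"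
      using r by (simp add: powr_mult powr_divide powr_minus_divide)
    also have "\<dots> \<le> \<bar>a\<bar> powr - q * (2 powr q * (norm (grad v y) powr q + (\<bar>v y - a\<bar> / r) powr q))"
      using q r by (intro mult_left_mono powr_add_le) auto
    also have "(\<bar>v y - a\<bar> / r) powr q = r powr - q * \<bar>v y - a\<bar> powr q"
      using r by (simp add: powr_divide powr_minus_divide)
    finally have "(norm (grad u y) + \<bar>1 - u y\<bar> / r) powr q * m y powr q \<le> \<bar>a\<bar> powr - q * (2 powr q * (norm (grad v y) powr q + r powr - q * \<bar>v y - a\<bar> powr q)) * m y powr q"
      by (intro mult_right_mono) auto
    then show ?thesis by (simp add: algebra_simps)
  qed
  have "Cap q (\<lambda>x. m x powr q) K (cube x0 (2 * r)) \<le> ennreal (capacity_const N q B) *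
      (\<integral>\<^sup>+y\<in>cube x0 r. ennreal ((norm (grad u y) + \<bar>1 - u y\<bar> / r) powr q * m y powr q) \<partial>lborel)"
    unfolding capacity_const_def N_def
    by (rule Cap_extension[OF A mm m q(1) _ r u K d]) (use v0 B in \<open>auto simp: u_def\<close>)
  also have "\<dots> \<le> ennreal (capacity_const N p B) * (\<integral>\<^sup>+y. ennreal (\<bar>a\<bar> powr - q * 2 powr q) *
      (ennreal (norm (grad v y) powr q * m y powr q) * indicator (cube x0 r) y + ennreal (r powr - q) * (ennreal (\<bar>v y - a\<bar> powr q * m y powr q) * indicator (cube x0 r) y)) \<partial>lborel)"
  proof (rule mult_mono[OF ennreal_leI nn_integral_mono])
    show "capacity_const N q B \<le> capacity_const N p B" using N B q by (intro capacity_const_mono) auto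
    fix y
    show "ennreal ((norm (grad u y) + \<bar>1 - u y\<bar> / r) powr q * m y powr q) * indicator (cube x0 r) y \<le> ennreal (\<bar>a\<bar> powr - q * 2 powr q) *
      (ennreal (norm (grad v y) powr q * m y powr q) * indicator (cube x0 r) y + ennreal (r powr - q) * (ennreal (\<bar>v y - a\<bar> powr q * m y powr q) * indicator (cube x0 r) y))"
      using ennreal_leI[OF pw[of y]]
      by (cases "y \<in> cube x0 r") (simp_all add: ennreal_mult[symmetric] ennreal_plus[symmetric] del: ennreal_plus)
  qed auto
  also have "(\<integral>\<^sup>+y. ennreal (\<bar>a\<bar> powr - q * 2 powr q) *
      (ennreal (norm (grad v y) powr q * m y powr q) * indicator (cube x0 r) y + ennreal (r powr - q) * (ennreal (\<bar>v y - a\<bar> powr q * m y powr q) * indicator (cube x0 r) y)) \<partial>lborel)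
    = ennreal (\<bar>a\<bar> powr - q * 2 powr q) * (ennreal \<iota> + ennreal (r powr - q) * (\<integral>\<^sup>+x\<in>cube x0 r. ennreal (\<bar>v x - a\<bar> powr q * m x powr q) \<partial>lborel))"
    by (simp add: nn_integral_cmult nn_integral_add \<iota>)
  also have "\<dots> \<le> ennreal (\<bar>a\<bar> powr - q * 2 powr q) * (ennreal \<iota> + ennreal (r powr - q) * ennreal (poincare_const N p B * (r powr q * \<iota>)))"
    using a unfolding N_def by (intro mult_left_mono add_left_mono) auto
  also have "\<dots> = ennreal (\<bar>a\<bar> powr - q * 2 powr q * (\<iota> + r powr - q * (poincare_const N p B * (r powr q * \<iota>))))"
    using \<iota> c1 q by (simp add: ennreal_mult[symmetric] ennreal_plus[symmetric] del: ennreal_plus)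
  also have "r powr - q * (poincare_const N p B * (r powr q * \<iota>)) = poincare_const N p B * \<iota>"
    using r by (simp add: powr_minus)
  finally have "ennreal \<kappa> \<le> ennreal (capacity_const N p B) * ennreal (\<bar>a\<bar> powr - q * 2 powr q * (\<iota> + poincare_const N p B * \<iota>))"
    unfolding \<kappa>(1) by (simp add: mult_left_mono)
  then have "ennreal \<kappa> \<le> ennreal (capacity_const N p B * (\<bar>a\<bar> powr - q * 2 powr q * (\<iota> + poincare_const N p B * \<iota>)))"
    using c1 q by (simp add: ennreal_mult')
  then have le: "\<kappa> \<le> capacity_const N p B * (\<bar>a\<bar> powr - q * 2 powr q * (\<iota> + poincare_const N p B * \<iota>))"
    using \<iota> c1 q by (subst (asm) ennreal_le_iff) auto
  have "\<kappa> * \<bar>a\<bar> powr q \<le> capacity_const N p B * (\<bar>a\<bar> powr - q * 2 powr q * (\<iota> + poincare_const N p B * \<iota>)) * \<bar>a\<bar> powr q"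
    by (intro mult_right_mono le) simp
  also have "\<dots> = capacity_const N p B * (2 powr q * ((1 + poincare_const N p B) * \<iota>))"
    using False by (simp add: powr_minus field_simps)
  also have "\<dots> \<le> capacity_const N p B * (2 powr p * ((1 + poincare_const N p B) * \<iota>))"
    using c1 q \<iota> by (intro mult_left_mono mult_right_mono powr_mono) auto
  finally show ?thesis by (simp add: mean_const_def N_def mult.assoc)
qed

text \<open>Decomposition of \<open>v\<close> into \<open>v - a\<close> and the mean
  \<open>a\<close>. The Poincare inequality bounds the first part and the capacity bounds
  \<open>a\<close>; the mass of \<open>m powr p\<close> that multiplies \<open>a\<close> is
  converted to the mass of \<open>m powr q\<close> by \<open>Apq_mass_compare\<close>.\<close>

lemma upper_estimate:
  fixes m v :: "real^'n \<Rightarrow> real" and p q B r \<kappa> w :: real and x0 :: "real^'n"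
  assumes A: "Apq m p q B" and mm [measurable]: "m \<in> borel_measurable borel" and m: "\<And>x. 0 < m x"
    and q: "1 < q" "q \<le> p" and np: "CARD('n) * (p / q - 1) \<le> 1 / 2" and B: "1 \<le> B" and r: "0 < r" and v: "C_k (Suc 0) v"
    and K: "K \<subseteq> closure (cube x0 r)" and d: "0 < d"
    and v0: "\<And>k w. k \<in> K \<Longrightarrow> w \<in> cube x0 r \<Longrightarrow> infnorm (w - k) < d \<Longrightarrow> v w = 0"
    and \<kappa>: "Cap q (\<lambda>x. m x powr q) K (cube x0 (2 * r)) = ennreal \<kappa>" "0 < \<kappa>"
    and w: "(\<integral>\<^sup>+x\<in>cube x0 (2 * r). ennreal (m x powr q) \<partial>lborel) = ennreal w" "0 < w"
  defines "V \<equiv> (2 * r) powr real CARD('n)"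
  shows "epowr ((\<integral>\<^sup>+x\<in>cube x0 r. ennreal (\<bar>v x / r\<bar> powr p * m x powr p) \<partial>lborel) / ennreal V) (1 / p)
    \<le> ennreal (upper_const (real CARD('n)) p B / r * (w / \<kappa>) powr (1 / q)) *
      epowr ((\<integral>\<^sup>+y\<in>cube x0 r. ennreal (norm (grad v y) powr q * m y powr q) \<partial>lborel) / ennreal V) (1 / q)"
    (is "epowr (?X / _) _ \<le> ennreal ?c * epowr (?I / _) _")
proof -
  define N where "N = real CARD('n)"
  have N: "1 \<le> N" by (simp add: N_def)
  have p: "1 < p" using q by simp
  note c1 = upper_consts_ge_1[OF N B, of p]
  have V: "0 < V" and VN: "V = (2 * r) powr N" using r by (simp_all add: V_def N_def)
  have uc: "0 < upper_const N p B" "upper_const N p B powr p = 2 powr p * (poincare_const N p B * capacity_const N p B powr p + B powr p * mean_const N p B powr p)"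
  proof -
    define D where "D = 2 powr p * (poincare_const N p B * capacity_const N p B powr p + B powr p * mean_const N p B powr p)"
    have "0 < D"
      unfolding D_def using c1 p by (intro mult_pos_pos add_pos_nonneg) auto
    then show "0 < upper_const N p B" "upper_const N p B powr p = 2 powr p * (poincare_const N p B * capacity_const N p B powr p + B powr p * mean_const N p B powr p)"
      using p unfolding upper_const_def D_def[symmetric] by (simp_all add: powr_powr)
  qed
  have [measurable]: "grad v \<in> borel_measurable borel" "v \<in> borel_measurable borel"
    using C_k_grad_continuous[OF v] C_k_continuous[OF v] by (auto intro: borel_measurable_continuous_onI)
  have B0: "0 \<le> B" using B by simp
  show ?thesis
  proof (cases "?I = top")
    case True
    \<comment> \<open>Infinite energy gives an infinite right side only because the constant is
      positive: zero times infinity is 0.\<close>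
    have "0 < ?c" using uc r w \<kappa> by (simp add: N_def)
    then have "ennreal ?c \<noteq> 0" by (simp add: ennreal_eq_0_iff)
    moreover have "?I / ennreal V = top" unfolding True using V by (simp add: ennreal_top_divide)
    ultimately show ?thesis by (simp add: ennreal_mult_top)
  next
    case False
    then obtain \<iota> where \<iota>: "?I = ennreal \<iota>" "0 \<le> \<iota>" by (cases ?I) auto
    define a where "a = (LINT y:cube x0 r|lborel. v y) / V"
    have sub: "cube x0 r \<subseteq> cube x0 (2 * r)" using r by (intro cube_mono) simp
    have Aqq: "Apq m q q B" by (rule Apq_diag[OF A mm q B0])
    have P1: "(\<integral>\<^sup>+x\<in>cube x0 r. ennreal (\<bar>v x - a\<bar> powr p * m x powr p) \<partial>lborel)
      \<le> ennreal (poincare_const N p B * (r powr p * V powr (1 - p / q)) * \<iota> powr (p / q))"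
      using mean_Poincare[OF A mm m q np B0 r v, of x0] c1 p \<iota>
      unfolding a_def N_def[symmetric] poincare_const_def[symmetric] VN[symmetric]
      by (simp add: epowr_ennreal ennreal_mult'')
    have "(\<integral>\<^sup>+x\<in>cube x0 r. ennreal (\<bar>v x - a\<bar> powr q * m x powr q) \<partial>lborel) \<le> ennreal (poincare_const N q B * r powr q) * ennreal \<iota>"
      using mean_Poincare[OF Aqq mm m q(1) order.refl _ B0 r v, of x0] \<iota> q V
      unfolding a_def N_def[symmetric] poincare_const_def[symmetric] VN[symmetric]
      by simp
    also have "\<dots> \<le> ennreal (poincare_const N p B * (r powr q * \<iota>))"
      using poincare_const_mono[OF N B _ q(2)] \<iota> q by (simp add: ennreal_mult''[symmetric] ennreal_leI mult_right_mono mult.assoc)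
    finally have P2: "\<kappa> * \<bar>a\<bar> powr q \<le> mean_const N p B * \<iota>"
      unfolding N_def by (intro mean_capacity_estimate[OF Aqq mm m q B r v K d v0 \<kappa>(1) _ \<iota>]) (use \<kappa> in auto)
    \<comment> \<open>An upper bound for the capacity, although it stands in the denominator: it
      turns the factor \<open>r powr p\<close> of the Poincare inequality into the required power of
      \<open>w / \<kappa>\<close>.\<close>
    have "Cap q (\<lambda>x. m x powr q) K (cube x0 (2 * r)) \<le> ennreal (capacity_const N q B * r powr - q) * (\<integral>\<^sup>+y\<in>cube x0 r. ennreal (m y powr q) \<partial>lborel)"
      unfolding capacity_const_def N_def by (rule Cap_le_mass[OF Aqq mm m q(1) B0 r K])
    also have "\<dots> \<le> ennreal (capacity_const N p B * r powr - q) * ennreal w"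
      unfolding w(1)[symmetric] using r N B q c1
      by (intro mult_mono ennreal_leI mult_right_mono capacity_const_mono nn_integral_mono)
        (auto simp: indicator_def dest: subsetD[OF sub])
    also have "\<dots> = ennreal (capacity_const N p B * r powr - q * w)"
      using w by (simp add: ennreal_mult'')
    finally have "\<kappa> \<le> capacity_const N p B * r powr - q * w"
      using \<kappa> w c1 p by (subst (asm) \<kappa>(1), subst (asm) ennreal_le_iff) auto
    then have "\<kappa> * r powr q \<le> capacity_const N p B * r powr - q * w * r powr q" by (intro mult_right_mono) auto
    also have "\<dots> = capacity_const N p B * w" using r by (simp add: powr_minus field_simps)
    finally have "r powr q \<le> capacity_const N p B * (w / \<kappa>)" using \<kappa> by (simp add: field_simps)
    then have "(r powr q) powr (p / q) \<le> (capacity_const N p B * (w / \<kappa>)) powr (p / q)"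
      using q by (intro powr_mono2) auto
    also have "(r powr q) powr (p / q) = r powr p" using q by (simp add: powr_powr)
    also have "(capacity_const N p B * (w / \<kappa>)) powr (p / q) = capacity_const N p B powr (p / q) * (w / \<kappa>) powr (p / q)"
      using c1 w \<kappa> by (simp only: powr_mult)
    finally have rp: "r powr p \<le> capacity_const N p B powr (p / q) * (w / \<kappa>) powr (p / q)" .
    have "\<bar>a\<bar> powr q \<le> mean_const N p B * (\<iota> / \<kappa>)" using P2 \<kappa> by (simp add: field_simps)
    then have "(\<bar>a\<bar> powr q) powr (p / q) \<le> (mean_const N p B * (\<iota> / \<kappa>)) powr (p / q)"
      using q by (intro powr_mono2) auto
    also have "(\<bar>a\<bar> powr q) powr (p / q) = \<bar>a\<bar> powr p" using q by (simp add: powr_powr)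
    also have "(mean_const N p B * (\<iota> / \<kappa>)) powr (p / q) = mean_const N p B powr (p / q) * (\<iota> / \<kappa>) powr (p / q)"
      using c1 \<iota> \<kappa> by (simp only: powr_mult)
    finally have ap: "\<bar>a\<bar> powr p \<le> mean_const N p B powr (p / q) * (\<iota> / \<kappa>) powr (p / q)" .
    have P3: "(\<integral>\<^sup>+x\<in>cube x0 r. ennreal (m x powr p) \<partial>lborel) \<le> ennreal (B powr p * V powr (1 - p / q) * w powr (p / q))"
    proof -
      have "(\<integral>\<^sup>+x\<in>cube x0 r. ennreal (m x powr p) \<partial>lborel) \<le> ennreal (B powr p * V powr (1 - p / q)) * epowr (\<integral>\<^sup>+x\<in>cube x0 r. ennreal (m x powr q) \<partial>lborel) (p / q)"
        unfolding V_def by (rule Apq_mass_compare[OF A mm m q B0 r])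
      also have "\<dots> \<le> ennreal (B powr p * V powr (1 - p / q)) * epowr (ennreal w) (p / q)"
        unfolding w(1)[symmetric] using r q
        by (intro mult_left_mono epowr_mono nn_integral_mono)
          (auto simp: indicator_def dest: subsetD[OF sub])
      also have "\<dots> = ennreal (B powr p * V powr (1 - p / q) * w powr (p / q))"
        using w by (simp add: epowr_ennreal ennreal_mult'')
      finally show ?thesis .
    qed
    have "?X \<le> (\<integral>\<^sup>+x. ennreal (r powr - p * 2 powr p) * (ennreal (\<bar>v x - a\<bar> powr p * m x powr p) * indicator (cube x0 r) x + ennreal (\<bar>a\<bar> powr p) * (ennreal (m x powr p) * indicator (cube x0 r) x)) \<partial>lborel)"
    proof (intro nn_integral_mono)
      fix x
      have "\<bar>v x / r\<bar> powr p = r powr - p * \<bar>(v x - a) + a\<bar> powr p"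
        using r by (simp add: powr_divide powr_minus_divide)
      also have "\<dots> \<le> r powr - p * (\<bar>v x - a\<bar> + \<bar>a\<bar>) powr p"
        using p by (intro mult_left_mono powr_mono2 abs_triangle_ineq) auto
      also have "\<dots> \<le> r powr - p * (2 powr p * (\<bar>v x - a\<bar> powr p + \<bar>a\<bar> powr p))"
        using p by (intro mult_left_mono powr_add_le) auto
      finally have "\<bar>v x / r\<bar> powr p * m x powr p \<le> r powr - p * (2 powr p * (\<bar>v x - a\<bar> powr p + \<bar>a\<bar> powr p)) * m x powr p"
        by (intro mult_right_mono) auto
      also have "\<dots> = r powr - p * 2 powr p * (\<bar>v x - a\<bar> powr p * m x powr p + \<bar>a\<bar> powr p * m x powr p)"
        by (simp add: algebra_simps)
      finally have "ennreal (\<bar>v x / r\<bar> powr p * m x powr p) \<le> \<dots>" by (rule ennreal_leI)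
      then show "ennreal (\<bar>v x / r\<bar> powr p * m x powr p) * indicator (cube x0 r) x \<le> ennreal (r powr - p * 2 powr p) * (ennreal (\<bar>v x - a\<bar> powr p * m x powr p) * indicator (cube x0 r) x + ennreal (\<bar>a\<bar> powr p) * (ennreal (m x powr p) * indicator (cube x0 r) x))"
        by (cases "x \<in> cube x0 r") (simp_all add: ennreal_mult[symmetric] ennreal_plus[symmetric] del: ennreal_plus)
    qed
    also have "\<dots> = ennreal (r powr - p * 2 powr p) * ((\<integral>\<^sup>+x\<in>cube x0 r. ennreal (\<bar>v x - a\<bar> powr p * m x powr p) \<partial>lborel) + ennreal (\<bar>a\<bar> powr p) * (\<integral>\<^sup>+x\<in>cube x0 r. ennreal (m x powr p) \<partial>lborel))"
      by (simp add: nn_integral_cmult nn_integral_add)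
    also have "\<dots> \<le> ennreal (r powr - p * 2 powr p) * (ennreal (poincare_const N p B * (r powr p * V powr (1 - p / q)) * \<iota> powr (p / q)) + ennreal (\<bar>a\<bar> powr p) * ennreal (B powr p * V powr (1 - p / q) * w powr (p / q)))"
      by (intro mult_left_mono add_mono P1 P3) auto
    also have "\<dots> = ennreal (r powr - p * 2 powr p * (poincare_const N p B * (r powr p * V powr (1 - p / q)) * \<iota> powr (p / q) + \<bar>a\<bar> powr p * (B powr p * V powr (1 - p / q) * w powr (p / q))))"
      using c1 p by (simp add: ennreal_mult[symmetric] ennreal_plus[symmetric] del: ennreal_plus)
    also have "\<dots> \<le> ennreal (upper_const N p B powr p * (r powr - p * (V powr (1 - p / q) * (\<iota> * (w / \<kappa>)) powr (p / q))))"
    proof (rule ennreal_leI)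
      define Z where "Z = V powr (1 - p / q) * (\<iota> * (w / \<kappa>)) powr (p / q)"
      have Z: "0 \<le> Z" by (simp add: Z_def)
      \<comment> \<open>The bases are at least 1 and \<open>p / q\<close> is at most
        \<open>p\<close>, so \<open>q\<close> disappears from the constant.\<close>
      have pq: "capacity_const N p B powr (p / q) \<le> capacity_const N p B powr p" "mean_const N p B powr (p / q) \<le> mean_const N p B powr p"
        using c1 q p by (auto intro!: powr_mono simp: field_simps)
      have "poincare_const N p B * (r powr p * V powr (1 - p / q)) * \<iota> powr (p / q)
        \<le> poincare_const N p B * ((capacity_const N p B powr (p / q) * (w / \<kappa>) powr (p / q)) * V powr (1 - p / q)) * \<iota> powr (p / q)"
        using c1 p by (intro mult_right_mono mult_left_mono rp) auto
      also have "\<dots> = poincare_const N p B * capacity_const N p B powr (p / q) * Z"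
        unfolding Z_def powr_mult[of \<iota> "w / \<kappa>"] by (simp only: mult_ac)
      also have "\<dots> \<le> poincare_const N p B * capacity_const N p B powr p * Z"
        using c1 p Z pq by (intro mult_right_mono mult_left_mono) auto
      finally have t1: "poincare_const N p B * (r powr p * V powr (1 - p / q)) * \<iota> powr (p / q) \<le> poincare_const N p B * capacity_const N p B powr p * Z" .
      have "\<bar>a\<bar> powr p * (B powr p * V powr (1 - p / q) * w powr (p / q)) \<le> (mean_const N p B powr (p / q) * (\<iota> / \<kappa>) powr (p / q)) * (B powr p * V powr (1 - p / q) * w powr (p / q))"
        by (intro mult_right_mono ap) auto
      also have "\<dots> = B powr p * mean_const N p B powr (p / q) * Z"
      proof -
        have eq: "(\<iota> / \<kappa>) powr (p / q) * w powr (p / q) = (\<iota> * (w / \<kappa>)) powr (p / q)"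
          by (simp add: powr_mult[symmetric])
        show ?thesis unfolding Z_def eq[symmetric] by (simp only: mult_ac)
      qed
      also have "\<dots> \<le> B powr p * mean_const N p B powr p * Z"
        using Z pq by (intro mult_right_mono mult_left_mono) auto
      finally have t2: "\<bar>a\<bar> powr p * (B powr p * V powr (1 - p / q) * w powr (p / q)) \<le> B powr p * mean_const N p B powr p * Z" .
      have "r powr - p * 2 powr p * (poincare_const N p B * (r powr p * V powr (1 - p / q)) * \<iota> powr (p / q) + \<bar>a\<bar> powr p * (B powr p * V powr (1 - p / q) * w powr (p / q)))
        \<le> r powr - p * 2 powr p * (poincare_const N p B * capacity_const N p B powr p * Z + B powr p * mean_const N p B powr p * Z)"
        by (intro mult_left_mono add_mono t1 t2) auto
      also have "\<dots> = upper_const N p B powr p * (r powr - p * Z)"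
        unfolding uc(2) by (simp add: algebra_simps)
      finally show "r powr - p * 2 powr p * (poincare_const N p B * (r powr p * V powr (1 - p / q)) * \<iota> powr (p / q) + \<bar>a\<bar> powr p * (B powr p * V powr (1 - p / q) * w powr (p / q)))
        \<le> upper_const N p B powr p * (r powr - p * (V powr (1 - p / q) * (\<iota> * (w / \<kappa>)) powr (p / q)))"
        by (simp add: Z_def)
    qed
    finally have X: "?X \<le> ennreal (upper_const N p B powr p * (r powr - p * (V powr (1 - p / q) * (\<iota> * (w / \<kappa>)) powr (p / q))))" .
    have "?X / ennreal V \<le> ennreal (upper_const N p B powr p * (r powr - p * (V powr (1 - p / q) * (\<iota> * (w / \<kappa>)) powr (p / q)))) / ennreal V"
      by (rule divide_right_mono_ennreal[OF X])
    also have "\<dots> = ennreal ((?c * (\<iota> / V) powr (1 / q)) powr p)"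
    proof -
      have "(?c * (\<iota> / V) powr (1 / q)) powr p = upper_const N p B powr p * (r powr - p * ((w / \<kappa>) powr (p / q) * (\<iota> / V) powr (p / q)))"
        using uc r w \<kappa> \<iota> V by (simp add: N_def[symmetric] powr_mult powr_divide powr_powr powr_minus_divide)
      also have "(w / \<kappa>) powr (p / q) * (\<iota> / V) powr (p / q) = V powr (1 - p / q) * (\<iota> * (w / \<kappa>)) powr (p / q) / V"
        using V by (simp add: powr_mult powr_divide powr_diff mult.commute)
      finally have eq: "(?c * (\<iota> / V) powr (1 / q)) powr p = upper_const N p B powr p * (r powr - p * (V powr (1 - p / q) * (\<iota> * (w / \<kappa>)) powr (p / q))) / V"
        by (simp only: times_divide_eq_right)
      have "0 \<le> upper_const N p B powr p * (r powr - p * (V powr (1 - p / q) * (\<iota> * (w / \<kappa>)) powr (p / q)))" by simp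
      from divide_ennreal[OF this V] show ?thesis unfolding eq .
    qed
    finally have "epowr (?X / ennreal V) (1 / p) \<le> epowr (ennreal ((?c * (\<iota> / V) powr (1 / q)) powr p)) (1 / p)"
      using p by (intro epowr_mono) auto
    also have "\<dots> = ennreal (?c * (\<iota> / V) powr (1 / q))"
      using uc r w \<kappa> p by (simp add: epowr_ennreal powr_powr N_def[symmetric])
    also have "\<dots> = ennreal ?c * epowr (?I / ennreal V) (1 / q)"
    proof -
      have "epowr (?I / ennreal V) (1 / q) = ennreal ((\<iota> / V) powr (1 / q))"
        unfolding \<iota>(1) using \<iota>(2) V by (simp add: divide_ennreal epowr_ennreal)
      then show ?thesis by (simp only: ennreal_mult'' powr_ge_zero)
    qed
    finally show ?thesis .
  qed
qed

section \<open>Lower estimate\<close>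

definition friedrichs_const :: "real \<Rightarrow> real \<Rightarrow> real \<Rightarrow> real" where
  "friedrichs_const N p B = 2 * (2 * N) powr p * 8 powr (N * p) * B powr p * 8 powr p"

definition doubling_const :: "real \<Rightarrow> real \<Rightarrow> real \<Rightarrow> real" where
  "doubling_const N p B = B powr p * 4 powr (N * p)"

text \<open>Chosen so that the Friedrichs bound for the mass of \<open>f\<close>, at energies below
  twice the threshold, is at most \<open>w / (2 * doubling_const N p B * 2 powr p)\<close>. This is
  half of the share that doubling guarantees.\<close>

definition small_const :: "real \<Rightarrow> real \<Rightarrow> real \<Rightarrow> real" where
  "small_const N p B = 1 / (4 * doubling_const N p B * 2 powr p * friedrichs_const N p B * 4 powr p)"

lemma lower_consts_ge_1:
  assumes "1 \<le> N" "1 \<le> B" "0 \<le> p"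
  shows "1 \<le> friedrichs_const N p B" "1 \<le> doubling_const N p B"
proof -
  have ge: "1 \<le> (2 * N) powr p" "1 \<le> (8::real) powr (N * p)" "1 \<le> B powr p" "1 \<le> (8::real) powr p" "1 \<le> (4::real) powr (N * p)"
    using assms by (auto intro!: ge_one_powr_ge_zero)
  have m: "1 \<le> a * b" if "1 \<le> a" "1 \<le> b" for a b :: real
    using mult_mono[of 1 a 1 b] that by simp
  show "1 \<le> friedrichs_const N p B" unfolding friedrichs_const_def by (intro m ge) simp
  show "1 \<le> doubling_const N p B" unfolding doubling_const_def by (intro m ge)
qed

lemma small_const_bounds:
  assumes "1 \<le> N" "1 \<le> B" "1 < p"
  shows "0 < small_const N p B" "small_const N p B < 1 / 2"
proof -
  have m: "1 \<le> a * b" if "1 \<le> a" "1 \<le> b" for a b :: real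
    using mult_mono[of 1 a 1 b] that by simp
  define M where "M = doubling_const N p B * 2 powr p * friedrichs_const N p B * 4 powr p"
  have "1 \<le> M"
    unfolding M_def using assms by (intro m lower_consts_ge_1) (auto intro!: ge_one_powr_ge_zero)
  moreover have "small_const N p B = 1 / (4 * M)" by (simp add: small_const_def M_def mult.assoc)
  ultimately show "0 < small_const N p B" "small_const N p B < 1 / 2"
    by (simp_all add: divide_less_eq)
qed

text \<open>If the energy of \<open>f\<close> is small then, by the Friedrichs inequality, \<open>f\<close> is small on average,
  so \<open>1 - f\<close> retains a fixed part of the mass of the smaller cube.\<close>

lemma complement_mass:
  fixes m f :: "real^'n \<Rightarrow> real" and q B r w E :: real and x0 :: "real^'n"
  assumes A: "Apq m q q B" and mm [measurable]: "m \<in> borel_measurable borel" and m: "\<And>x. 0 < m x"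
    and q: "1 < q" "q \<le> p" and B: "1 \<le> B" and r: "0 < r"
    and f: "C_k (Suc 0) f" and f0: "\<forall>x. x \<notin> cube x0 (2 * r) \<longrightarrow> f x = 0 \<and> grad f x = 0"
    and w: "(\<integral>\<^sup>+x\<in>cube x0 (2 * r). ennreal (m x powr q) \<partial>lborel) = ennreal w" "0 \<le> w"
    and J: "(\<integral>\<^sup>+x\<in>cube x0 (2 * r). ennreal (norm (grad f x) powr q * m x powr q) \<partial>lborel) \<le> ennreal (4 powr q * E)"
    and E: "0 \<le> E" "E \<le> 2 * small_const (real CARD('n)) p B * r powr - q * w"
  shows "ennreal (w / (2 * doubling_const (real CARD('n)) p B * 2 powr p)) \<le>
    (\<integral>\<^sup>+x\<in>cube x0 (r / 2). ennreal (\<bar>1 - f x\<bar> powr q * m x powr q) \<partial>lborel)" (is "_ \<le> ?Y")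
proof -
  define N where "N = real CARD('n)"
  have N: "1 \<le> N" by (simp add: N_def)
  define D where "D = doubling_const N p B"
  define F where "F = friedrichs_const N p B"
  have DF: "1 \<le> D" "1 \<le> F" using lower_consts_ge_1[OF N B, of p] q by (auto simp: D_def F_def)
  have [measurable]: "f \<in> borel_measurable borel"
    using C_k_continuous[OF f] by (rule borel_measurable_continuous_onI)
  have B0: "0 \<le> B" using B by simp
  let ?Z = "\<integral>\<^sup>+x\<in>cube x0 (2 * r). ennreal (\<bar>f x\<bar> powr q * m x powr q) \<partial>lborel"
  have "?Z \<le> ennreal (friedrichs_const N q B * r powr q) * (\<integral>\<^sup>+y\<in>cube x0 (2 * r). ennreal (norm (grad f y) powr q * m y powr q) \<partial>lborel)"
    unfolding friedrichs_const_def N_def by (rule Friedrichs[OF A mm m q(1) B0 r f f0])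
  also have "\<dots> \<le> ennreal (F * r powr q) * ennreal (4 powr p * E)"
  proof (rule mult_mono)
    have "friedrichs_const N q B \<le> F"
      unfolding F_def friedrichs_const_def using N B q by (intro mult_mono powr_mono mult_left_mono) auto
    then show "ennreal (friedrichs_const N q B * r powr q) \<le> ennreal (F * r powr q)"
      by (intro ennreal_leI mult_right_mono) auto
    have "4 powr q * E \<le> 4 powr p * E" using q E by (intro mult_right_mono powr_mono) auto
    then show "(\<integral>\<^sup>+y\<in>cube x0 (2 * r). ennreal (norm (grad f y) powr q * m y powr q) \<partial>lborel) \<le> ennreal (4 powr p * E)"
      by (intro order_trans[OF J] ennreal_leI)
  qed auto
  also have "\<dots> = ennreal (F * r powr q * (4 powr p * E))"
    using DF E by (simp add: ennreal_mult[symmetric])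
  also have "\<dots> \<le> ennreal (w / (2 * D * 2 powr p))"
  proof (rule ennreal_leI)
    have "F * r powr q * (4 powr p * E) \<le> F * r powr q * (4 powr p * (2 * small_const N p B * r powr - q * w))"
      using DF E(2) by (intro mult_left_mono) (auto simp: N_def)
    also have "\<dots> = w / (2 * D * 2 powr p)"
      using DF r by (simp add: small_const_def D_def[symmetric] F_def[symmetric] powr_minus field_simps)
    finally show "F * r powr q * (4 powr p * E) \<le> w / (2 * D * 2 powr p)" .
  qed
  finally have Z: "?Z \<le> ennreal (w / (2 * D * 2 powr p))" .
  have sub: "cube x0 (r / 2) \<subseteq> cube x0 (2 * r)" using r by (intro cube_mono) simp
  have "ennreal w \<le> ennreal (B powr q * 4 powr (N * q)) * (\<integral>\<^sup>+x\<in>cube x0 (r / 2). ennreal (m x powr q) \<partial>lborel)"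
    unfolding w(1)[symmetric] N_def by (rule Apq_doubling[OF A mm m q(1) B0 r])
  also have "\<dots> \<le> ennreal D * (\<integral>\<^sup>+x. ennreal (2 powr p) * (ennreal (\<bar>1 - f x\<bar> powr q * m x powr q) * indicator (cube x0 (r / 2)) x + ennreal (\<bar>f x\<bar> powr q * m x powr q) * indicator (cube x0 (2 * r)) x) \<partial>lborel)"
  proof (rule mult_mono[OF ennreal_leI nn_integral_mono])
    show "B powr q * 4 powr (N * q) \<le> D"
      unfolding D_def doubling_const_def using N B q by (intro mult_mono powr_mono mult_left_mono) auto
    fix x
    \<comment> \<open>At each point \<open>f\<close> or \<open>1 - f\<close> is not small, so the
      mass of the inner cube splits between the two; the mass of \<open>f\<close> may be taken over
      the larger cube.\<close>
    have "1 = \<bar>(1 - f x) + f x\<bar> powr q" by simp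
    also have "\<dots> \<le> (\<bar>1 - f x\<bar> + \<bar>f x\<bar>) powr q"
      using q by (intro powr_mono2 abs_triangle_ineq) auto
    also have "\<dots> \<le> 2 powr q * (\<bar>1 - f x\<bar> powr q + \<bar>f x\<bar> powr q)"
      using q by (intro powr_add_le) auto
    also have "\<dots> \<le> 2 powr p * (\<bar>1 - f x\<bar> powr q + \<bar>f x\<bar> powr q)"
      using q by (intro mult_right_mono powr_mono) auto
    finally have "1 * m x powr q \<le> 2 powr p * (\<bar>1 - f x\<bar> powr q + \<bar>f x\<bar> powr q) * m x powr q"
      by (intro mult_right_mono) auto
    then have "ennreal (m x powr q) \<le> ennreal (2 powr p * (\<bar>1 - f x\<bar> powr q * m x powr q + \<bar>f x\<bar> powr q * m x powr q))"
      by (intro ennreal_leI) (simp add: algebra_simps)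
    then show "ennreal (m x powr q) * indicator (cube x0 (r / 2)) x \<le> ennreal (2 powr p) * (ennreal (\<bar>1 - f x\<bar> powr q * m x powr q) * indicator (cube x0 (r / 2)) x + ennreal (\<bar>f x\<bar> powr q * m x powr q) * indicator (cube x0 (2 * r)) x)"
      using sub by (cases "x \<in> cube x0 (r / 2)")
        (auto simp: ennreal_mult[symmetric] ennreal_plus[symmetric] simp del: ennreal_plus)
  qed auto
  also have "\<dots> = ennreal D * (ennreal (2 powr p) * (?Y + ?Z))"
    by (simp add: nn_integral_cmult nn_integral_add)
  also have "\<dots> \<le> ennreal D * (ennreal (2 powr p) * (?Y + ennreal (w / (2 * D * 2 powr p))))"
    by (intro mult_left_mono add_left_mono Z) auto
  finally have le: "ennreal w \<le> ennreal D * (ennreal (2 powr p) * (?Y + ennreal (w / (2 * D * 2 powr p))))" .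
  show ?thesis
  proof (cases "?Y = top")
    case False
    then obtain y where y: "?Y = ennreal y" "0 \<le> y" by (cases ?Y) auto
    have "ennreal D * (ennreal (2 powr p) * (?Y + ennreal (w / (2 * D * 2 powr p)))) = ennreal (D * (2 powr p * (y + w / (2 * D * 2 powr p))))"
      unfolding y(1) using y(2) DF w by (simp add: ennreal_mult[symmetric] ennreal_plus[symmetric] del: ennreal_plus)
    with le have "w \<le> D * (2 powr p * (y + w / (2 * D * 2 powr p)))"
      using y DF w by (simp only:) (subst (asm) ennreal_le_iff, auto)
    also have "\<dots> = D * 2 powr p * y + w / 2" using DF by (simp add: field_simps)
    finally have "w / (2 * D * 2 powr p) \<le> y" using DF by (simp add: field_simps)
    then show ?thesis unfolding y(1) D_def N_def by (rule ennreal_leI)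
  qed simp
qed

text \<open>The hypothesis \<open>H\<close> is the assumed inequality for \<open>1 - f\<close>.
  Jensen's inequality lowers its left side from exponent \<open>p\<close> to \<open>q\<close>, where
  \<open>complement_mass\<close> bounds it below by a share of \<open>w\<close>; the right side is
  at most \<open>C powr q\<close> times the energy bound. The powers of the volume cancel.\<close>

lemma lower_estimate:
  fixes m f :: "real^'n \<Rightarrow> real" and p q B r w E C :: real and x0 :: "real^'n"
  assumes A: "Apq m q q B" and mm [measurable]: "m \<in> borel_measurable borel" and m: "\<And>x. 0 < m x"
    and q: "1 < q" "q \<le> p" and B: "1 \<le> B" and r: "0 < r"
    and f: "C_k (Suc 0) f" and f0: "\<forall>x. x \<notin> cube x0 (2 * r) \<longrightarrow> f x = 0 \<and> grad f x = 0"
    and w: "(\<integral>\<^sup>+x\<in>cube x0 (2 * r). ennreal (m x powr q) \<partial>lborel) = ennreal w" "0 \<le> w"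
    and J: "(\<integral>\<^sup>+x\<in>cube x0 (2 * r). ennreal (norm (grad f x) powr q * m x powr q) \<partial>lborel) \<le> ennreal (4 powr q * E)"
    and E: "0 < E" "E \<le> 2 * small_const (real CARD('n)) p B * r powr - q * w"
    and C: "0 \<le> C" and H: "epowr ((\<integral>\<^sup>+x\<in>cube x0 (r / 2). ennreal (\<bar>(1 - f x) / r\<bar> powr p * m x powr p) \<partial>lborel) / ennreal (r powr real CARD('n))) (1 / p)
      \<le> ennreal C * epowr ((\<integral>\<^sup>+x\<in>cube x0 r. ennreal (norm (grad f x) powr q * m x powr q) \<partial>lborel) / ennreal ((2 * r) powr real CARD('n))) (1 / q)"
  shows "r powr - q * (w / E) / (2 * doubling_const (real CARD('n)) p B * 2 powr p * 4 powr p) \<le> C powr q"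
proof -
  define N where "N = real CARD('n)"
  have N: "1 \<le> N" by (simp add: N_def)
  define D where "D = doubling_const N p B"
  have D: "1 \<le> D" using lower_consts_ge_1[OF N B, of p] q by (auto simp: D_def)
  have [measurable]: "f \<in> borel_measurable borel"
    using C_k_continuous[OF f] by (rule borel_measurable_continuous_onI)
  let ?Y = "\<integral>\<^sup>+x\<in>cube x0 (r / 2). ennreal (\<bar>1 - f x\<bar> powr q * m x powr q) \<partial>lborel"
  let ?X = "\<integral>\<^sup>+x\<in>cube x0 (r / 2). ennreal (\<bar>(1 - f x) / r\<bar> powr p * m x powr p) \<partial>lborel"
  let ?I = "\<integral>\<^sup>+x\<in>cube x0 r. ennreal (norm (grad f x) powr q * m x powr q) \<partial>lborel"
  define V where "V = r powr N"
  have V: "0 < V" using r by (simp add: V_def)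
  have Y: "ennreal (w / (2 * D * 2 powr p)) \<le> ?Y"
    unfolding D_def N_def using E by (intro complement_mass[OF A mm m q B r f f0 w J]) auto
  have sub: "cube x0 r \<subseteq> cube x0 (2 * r)" using r by (intro cube_mono) simp
  have "?I \<le> (\<integral>\<^sup>+x\<in>cube x0 (2 * r). ennreal (norm (grad f x) powr q * m x powr q) \<partial>lborel)"
    by (intro nn_integral_mono) (use sub in \<open>auto simp: indicator_def\<close>)
  also note J
  finally have I: "?I \<le> ennreal (4 powr q * E)" .
  have J1: "epowr (ennreal (r powr - q) * ?Y) (p / q) \<le> ennreal (V powr (p / q - 1)) * ?X"
  proof -
    have eq: "ennreal (r powr - q) * ?Y = (\<integral>\<^sup>+x\<in>cube x0 (r / 2). ennreal (\<bar>(1 - f x) / r\<bar> powr q * m x powr q) \<partial>lborel)"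
    proof -
      have "ennreal (\<bar>(1 - f x) / r\<bar> powr q * m x powr q) * indicator (cube x0 (r / 2)) x
        = ennreal (r powr - q) * (ennreal (\<bar>1 - f x\<bar> powr q * m x powr q) * indicator (cube x0 (r / 2)) x)" for x
        using r by (simp add: powr_divide powr_minus_divide ennreal_mult[symmetric] mult.assoc[symmetric])
      then show ?thesis by (simp add: nn_integral_cmult)
    qed
    show ?thesis
    \<comment> \<open>\<open>nn_integral_Jensen\<close> needs \<open>p / q > 1\<close>; for equal
      exponents nothing has to be lowered.\<close>
    proof (cases "p = q")
      case True
      then show ?thesis unfolding eq using V q by simp
    next
      case False
      then have pq: "1 < p / q" using q by simp
      have "epowr (\<integral>\<^sup>+x\<in>cube x0 (r / 2). ennreal (\<bar>(1 - f x) / r\<bar> powr q * m x powr q) \<partial>lborel) (p / q)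
        \<le> ennreal (V powr (p / q - 1)) * (\<integral>\<^sup>+x\<in>cube x0 (r / 2). epowr (ennreal (\<bar>(1 - f x) / r\<bar> powr q * m x powr q)) (p / q) \<partial>lborel)"
        by (rule nn_integral_Jensen) (use pq r in \<open>auto simp: emeasure_cube V_def N_def\<close>)
      also have "(\<integral>\<^sup>+x\<in>cube x0 (r / 2). epowr (ennreal (\<bar>(1 - f x) / r\<bar> powr q * m x powr q)) (p / q) \<partial>lborel) = ?X"
        using q by (simp add: epowr_ennreal powr_mult powr_powr)
      finally show ?thesis unfolding eq .
    qed
  qed
  have "epowr (epowr (ennreal (r powr - q) * ?Y) (p / q)) (q / p) \<le> epowr (ennreal (V powr (p / q - 1)) * ?X) (q / p)"
    using q by (intro epowr_mono J1) auto
  then have "ennreal (r powr - q) * ?Y \<le> epowr (ennreal (V powr (p / q - 1)) * ?X) (q / p)"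
    using q by (simp add: epowr_epowr)
  also have "ennreal (V powr (p / q - 1)) * ?X = ennreal (V powr (p / q)) * (?X / ennreal V)"
    using V by (simp add: powr_diff divide_ennreal[symmetric] ennreal_times_divide ennreal_divide_times)
  also have "epowr (ennreal (V powr (p / q)) * (?X / ennreal V)) (q / p) = ennreal V * epowr (epowr (?X / ennreal V) (1 / p)) q"
    using V q by (simp add: epowr_mult epowr_epowr epowr_ennreal powr_powr)
  also have "\<dots> \<le> ennreal V * epowr (ennreal C * epowr (?I / ennreal ((2 * r) powr N)) (1 / q)) q"
    using H q unfolding V_def N_def by (intro mult_left_mono epowr_mono) auto
  also have "\<dots> \<le> ennreal V * epowr (ennreal C * epowr (ennreal (4 powr q * E) / ennreal V) (1 / q)) q"
  proof -
    have "?I / ennreal ((2 * r) powr N) \<le> ennreal (4 powr q * E) / ennreal ((2 * r) powr N)"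
      by (rule divide_right_mono_ennreal[OF I])
    also have "\<dots> = ennreal (4 powr q * E / (2 * r) powr N)" using E r by (simp add: divide_ennreal)
    also have "\<dots> \<le> ennreal (4 powr q * E / V)"
      unfolding V_def using E r N by (intro ennreal_leI divide_left_mono powr_mono2) auto
    also have "\<dots> = ennreal (4 powr q * E) / ennreal V" using E V by (simp add: divide_ennreal)
    finally show ?thesis using q by (intro mult_left_mono epowr_mono) auto
  qed
  also have "\<dots> = ennreal (C powr q * (4 powr q * E))"
  proof -
    have "epowr (ennreal C * epowr (ennreal (4 powr q * E) / ennreal V) (1 / q)) q = ennreal (C powr q) * (ennreal (4 powr q * E) / ennreal V)"
      using q C by (simp add: epowr_mult epowr_epowr epowr_ennreal)
    then show ?thesis using E V by (simp add: divide_ennreal ennreal_mult[symmetric])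
  qed
  finally have "ennreal (r powr - q) * ?Y \<le> ennreal (C powr q * (4 powr q * E))" .
  moreover have "ennreal (r powr - q * (w / (2 * D * 2 powr p))) \<le> ennreal (r powr - q) * ?Y"
    by (subst ennreal_mult'[OF powr_ge_zero]) (rule mult_left_mono[OF Y zero_le])
  ultimately have "ennreal (r powr - q * (w / (2 * D * 2 powr p))) \<le> ennreal (C powr q * (4 powr q * E))"
    by (rule order_trans[rotated])
  then have "r powr - q * (w / (2 * D * 2 powr p)) \<le> C powr q * (4 powr q * E)"
    using E by (subst (asm) ennreal_le_iff) auto
  also have "\<dots> \<le> C powr q * (4 powr p * E)"
    using q E by (intro mult_left_mono mult_right_mono powr_mono) auto
  finally have le: "r powr - q * (w / (2 * D * 2 powr p)) \<le> C powr q * (4 powr p * E)" .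
  have "0 < 4 powr p * E" using E by simp
  then have "r powr - q * (w / (2 * D * 2 powr p)) / (4 powr p * E) \<le> C powr q"
    using le by (simp only: pos_divide_le_eq)
  moreover have "r powr - q * (w / (2 * D * 2 powr p)) / (4 powr p * E) = r powr - q * (w / E) / (2 * D * 2 powr p * 4 powr p)"
    by (simp only: times_divide_eq_right divide_divide_eq_left times_divide_eq_left mult_ac)
  ultimately show ?thesis by (simp only: D_def N_def)
qed

section \<open>Passage to Borel representatives of the weight\<close>

text \<open>A weight is only Lebesgue measurable and only almost everywhere positive, while the
  estimates use Borel functions with positive values. Replacing bad values by 1 changes none of the
  integrals.\<close>

lemma weight_representative:
  fixes \<mu> :: "real^'n \<Rightarrow> real"
  assumes "weight \<mu>"
  obtains m where "m \<in> borel_measurable borel" "\<forall>x. 0 < m x" "AE x in lborel. \<mu> x = m x"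
proof -
  have "\<mu> \<in> borel_measurable lebesgue"
  \<comment> \<open>Local integrability gives measurability of the restrictions to balls, and the
    weight is their pointwise limit.\<close>
  proof (rule borel_measurable_LIMSEQ_real)
    fix i :: nat
    show "(\<lambda>x. indicator (cball 0 (real i)) x *\<^sub>R \<mu> x) \<in> borel_measurable lebesgue"
      using assms unfolding weight_def set_integrable_def
      by (intro borel_measurable_integrable) (blast intro: compact_cball)
  next
    fix x :: "real^'n"
    obtain k :: nat where k: "norm x \<le> real k" using real_arch_simple by blast
    have "eventually (\<lambda>i. indicator (cball 0 (real i)) x *\<^sub>R \<mu> x = \<mu> x) sequentially"
      using eventually_ge_at_top[of k] by eventually_elim (use k in auto)
    then show "(\<lambda>i. indicator (cball 0 (real i)) x *\<^sub>R \<mu> x) \<longlonglongrightarrow> \<mu> x"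
      by (rule tendsto_eventually)
  qed
  then obtain g where g: "g \<in> borel_measurable lborel" "AE x in lborel. \<mu> x = g x"
    using completion_ex_borel_measurable_real by blast
  have pos: "AE x in lborel. 0 < \<mu> x" using assms by (simp add: weight_def AE_completion_iff)
  show thesis
  proof
    show "(\<lambda>x. if 0 < g x then g x else 1) \<in> borel_measurable borel" using g(1) by simp
    show "\<forall>x. 0 < (if 0 < g x then g x else 1)" by simp
    show "AE x in lborel. \<mu> x = (if 0 < g x then g x else 1)"
      using g(2) pos by eventually_elim auto
  qed
qed

lemma eavg_representative:
  fixes \<mu> :: "real^'n \<Rightarrow> real"
  assumes "AE x in lborel. \<mu> x = m x" "S \<in> sets borel"
  shows "eavg S (\<lambda>x. F x (\<mu> x)) = (\<integral>\<^sup>+x\<in>S. ennreal (F x (m x)) \<partial>lborel) / emeasure lborel S"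
proof -
  have "(\<integral>\<^sup>+x\<in>S. ennreal (F x (\<mu> x)) \<partial>lborel) = (\<integral>\<^sup>+x\<in>S. ennreal (F x (m x)) \<partial>lborel)"
    using assms(1) by (intro nn_integral_cong_AE) (auto elim: eventually_mono)
  then show ?thesis using assms(2) by (simp add: eavg_def nn_integral_completion)
qed

lemma wmass_representative:
  assumes "AE x in lborel. \<mu> x = m x"
  shows "wmass (\<lambda>x. \<mu> x powr q) S = (\<integral>\<^sup>+x\<in>S. ennreal (m x powr q) \<partial>lborel)"
  unfolding wmass_def nn_integral_completion
  using assms by (intro nn_integral_cong_AE) (auto elim: eventually_mono)

lemma Cap_representative:
  assumes "AE x in lborel. \<mu> x = m x"
  shows "Cap q (\<lambda>x. \<mu> x powr q) K U = Cap q (\<lambda>x. m x powr q) K U"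
  unfolding Cap_def nn_integral_completion
  using assms by (intro INF_cong refl nn_integral_cong_AE) (auto elim: eventually_mono)

text \<open>The \<open>p\<close>-th root of the Muckenhoupt condition for
  \<open>\<mu> powr p\<close>, whose dual weight is \<open>\<mu> powr - (p / (p - 1))\<close>;
  averages become integrals by one factor of the volume.\<close>

lemma Apq_of_Ap_const:
  fixes \<mu> :: "real^'n \<Rightarrow> real"
  assumes Ap: "Ap_const p (\<lambda>x. \<mu> x powr p) < top" and p: "1 < p" and ae: "AE x in lborel. \<mu> x = m x"
  shows "Apq m p p (max 1 (enn2real (Ap_const p (\<lambda>x. \<mu> x powr p)) powr (1 / p)))"
  unfolding Apq_def
proof (intro allI impI)
  fix x0 :: "real^'n" and r :: real assume r: "0 < r"
  define \<alpha> where "\<alpha> = enn2real (Ap_const p (\<lambda>x. \<mu> x powr p))"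
  have \<alpha>: "0 \<le> \<alpha>" "Ap_const p (\<lambda>x. \<mu> x powr p) = ennreal \<alpha>"
    using Ap by (auto simp: \<alpha>_def less_top)
  define V where "V = (2 * r) powr real CARD('n)"
  have V: "0 < V" using r by (simp add: V_def)
  have Q: "emeasure lborel (cube x0 r) = ennreal V" using r by (simp add: V_def emeasure_cube)
  let ?P = "\<integral>\<^sup>+x\<in>cube x0 r. ennreal (m x powr p) \<partial>lborel"
  let ?S = "\<integral>\<^sup>+x\<in>cube x0 r. ennreal (m x powr - (p / (p - 1))) \<partial>lborel"
  have "eavg (cube x0 r) (\<lambda>x. \<mu> x powr p) * epowr (eavg (cube x0 r) (\<lambda>x. (\<mu> x powr p) powr (- 1 / (p - 1)))) (p - 1) \<le> ennreal \<alpha>"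
    unfolding \<alpha>(2)[symmetric] Ap_const_def
    by (rule SUP_upper2[of "(x0, r)"]) (use r in auto)
  also have "eavg (cube x0 r) (\<lambda>x. \<mu> x powr p) = ?P / ennreal V"
    using eavg_representative[OF ae cube_borel, where F = "\<lambda>x t. t powr p"] Q by simp
  also have "eavg (cube x0 r) (\<lambda>x. (\<mu> x powr p) powr (- 1 / (p - 1))) = ?S / ennreal V"
    using eavg_representative[OF ae cube_borel, where F = "\<lambda>x t. (t powr p) powr (- 1 / (p - 1))"] Q
    by (simp add: powr_powr)
  finally have "epowr (?P / ennreal V * epowr (?S / ennreal V) (p - 1)) (1 / p) \<le> epowr (ennreal \<alpha>) (1 / p)"
    using p by (intro epowr_mono) auto
  then have "epowr (?P / ennreal V) (1 / p) * epowr (?S / ennreal V) ((p - 1) / p) \<le> ennreal (\<alpha> powr (1 / p))"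
    using \<alpha> by (simp add: epowr_mult epowr_epowr epowr_ennreal)
  then have le: "ennreal V * (epowr (?P / ennreal V) (1 / p) * epowr (?S / ennreal V) ((p - 1) / p)) \<le> ennreal V * ennreal (\<alpha> powr (1 / p))"
    by (rule mult_left_mono) simp
  have div: "X = ennreal V * (X / ennreal V)" for X
    using V by (simp add: ennreal_times_divide mult_divide_eq_ennreal mult.commute)
  have "epowr ?P (1 / p) * epowr ?S ((p - 1) / p)
    = (epowr (ennreal V) (1 / p) * epowr (ennreal V) ((p - 1) / p)) * (epowr (?P / ennreal V) (1 / p) * epowr (?S / ennreal V) ((p - 1) / p))"
    by (subst (1) div[of ?P], subst (1) div[of ?S]) (simp only: epowr_mult mult_ac)
  also have "epowr (ennreal V) (1 / p) * epowr (ennreal V) ((p - 1) / p) = epowr (ennreal V) (1 / p + (p - 1) / p)"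
    by (rule epowr_add[symmetric])
  also have "1 / p + (p - 1) / p = 1" using p by (simp add: field_simps)
  also have "epowr (ennreal V) 1 * (epowr (?P / ennreal V) (1 / p) * epowr (?S / ennreal V) ((p - 1) / p)) \<le> ennreal V * ennreal (\<alpha> powr (1 / p))"
    using le by simp
  also have "\<dots> \<le> ennreal (max 1 (\<alpha> powr (1 / p)) * V)"
    using V by (simp add: ennreal_mult[symmetric] mult.commute ennreal_leI mult_right_mono)
  also have "V = (2 * r) powr (CARD('n) * (1 / p + (p - 1) / p))"
    using p by (simp add: V_def add_divide_distrib[symmetric])
  finally show "epowr ?P (1 / p) * epowr ?S ((p - 1) / p)
     \<le> ennreal (max 1 (enn2real (Ap_const p (\<lambda>x. \<mu> x powr p)) powr (1 / p)) * (2 * r) powr (CARD('n) * (1 / p + (p - 1) / p)))"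
    by (simp only: \<alpha>_def)
qed

text \<open>A test function is described by its values on the closed cube only. On the open cube its
  gradient is that of the smooth \<open>v\<close>, as derivatives are local; the positive Euclidean
  distance becomes a supremum distance after division by the dimension.\<close>

lemma test_funsE:
  fixes u :: "real^'n \<Rightarrow> real"
  assumes u: "u \<in> test_funs (closure (cube x0 r)) K"
  obtains v d where "smooth v" "0 < d" "\<forall>x\<in>cube x0 r. u x = v x \<and> grad u x = grad v x"
    "\<forall>k\<in>K. \<forall>w\<in>cube x0 r. infnorm (w - k) < d \<longrightarrow> v w = 0"
proof -
  define N where "N = real CARD('n)"
  have N: "1 \<le> N" by (simp add: N_def)
  from u obtain v where v: "smooth v" "\<forall>x\<in>closure (cube x0 r). u x = v x"
    and pos: "0 < esetdist (supp_in (closure (cube x0 r)) u) K"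
    by (auto simp: test_funs_def Cinf_closed_def)
  have uv: "u x = v x" if "x \<in> cube x0 r" for x using v(2) that closure_subset by blast
  have gr: "grad u x = grad v x" if x: "x \<in> cube x0 r" for x
  proof (rule grad_eqI)
    have "C_k (Suc 0) v" using v(1) unfolding smooth_def by blast
    then have "v differentiable (at x)" unfolding C_k.simps by blast
    from has_derivative_grad[OF this]
    show "(u has_derivative (\<lambda>h. h \<bullet> grad v x)) (at x)"
      by (rule has_derivative_transform_within_open[OF _ open_cube x]) (simp add: uv)
  qed
  \<comment> \<open>The distance may be infinite, for empty \<open>K\<close> or vanishing
    \<open>u\<close>, so a finite number below it is chosen.\<close>
  obtain e where e: "0 < e" "ennreal e < esetdist (supp_in (closure (cube x0 r)) u) K"
  proof -
    obtain t where t: "0 < t" "t < esetdist (supp_in (closure (cube x0 r)) u) K"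
      using dense[OF pos] by blast
    have "t < top" by (rule order.strict_trans2[OF t(2) top_greatest])
    then obtain e where "t = ennreal e" "0 \<le> e" unfolding less_top_ennreal by blast
    with t show thesis by (intro that[of e]) auto
  qed
  show thesis
  proof (rule that[of v "e / N"])
    show "smooth v" by (rule v)
    show "0 < e / N" using e N by simp
    show "\<forall>x\<in>cube x0 r. u x = v x \<and> grad u x = grad v x" using uv gr by blast
    show "\<forall>k\<in>K. \<forall>w\<in>cube x0 r. infnorm (w - k) < e / N \<longrightarrow> v w = 0"
    proof (intro ballI impI)
      fix k w assume k: "k \<in> K" and w: "w \<in> cube x0 r" and kw: "infnorm (w - k) < e / N"
      show "v w = 0"
      proof (rule ccontr)
        assume "v w \<noteq> 0"
        then have "w \<in> supp_in (closure (cube x0 r)) u"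
          unfolding supp_in_def using uv[OF w] w closure_subset[of "cube x0 r"]
          by (intro subsetD[OF closure_subset]) auto
        then have "esetdist (supp_in (closure (cube x0 r)) u) K \<le> ennreal (dist w k)"
          unfolding esetdist_def using k by (meson INF_lower2 INF_lower)
        moreover have "dist w k \<le> N * infnorm (w - k)"
          unfolding dist_norm N_def by (rule norm_le_infnorm_cart)
        then have "dist w k < e" using kw N by (simp add: field_simps)
        then have "ennreal (dist w k) < ennreal e" using e by (simp add: ennreal_less_iff)
        ultimately show False using e(2) by (meson less_trans not_le)
      qed
    qed
  qed
qed

theorem proposition4p1:
  fixes p :: real and A :: ennreal
  assumes "2 \<le> CARD('n)" and "1 < p"
  shows "\<exists>p0. 1 < p0 \<and> p0 < p \<and>
    (\<exists>c4>0. \<forall>(\<mu> :: real^'n \<Rightarrow> real) x0 r K q.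
       weight \<mu> \<and> (\<lambda>x. \<mu> x powr p) \<in> Ap p \<and> Ap_const p (\<lambda>x. \<mu> x powr p) = A \<and>
       0 < r \<and> closed K \<and> K \<subseteq> closure (cube x0 r) \<and> q \<in> {p0..p} \<and>
       Cap q (\<lambda>x. \<mu> x powr q) K (cube x0 (2*r)) \<noteq> 0 \<longrightarrow>
       (\<exists>C\<ge>0.
          (\<forall>u \<in> test_funs (closure (cube x0 r)) K.
             epowr (eavg (cube x0 r) (\<lambda>x. \<bar>u x / r\<bar> powr p * \<mu> x powr p)) (1/p)
             \<le> ennreal C * epowr (eavg (cube x0 r) (\<lambda>x. norm (grad u x) powr q * \<mu> x powr q)) (1/q)) \<and>
          ennreal C \<le> ennreal (c4 / r) *
            epowr (cap_quot (wmass (\<lambda>x. \<mu> x powr q) (cube x0 (2*r)))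
                            (Cap q (\<lambda>x. \<mu> x powr q) K (cube x0 (2*r)))) (1/q))) \<and>
    (\<exists>\<gamma> c5. 0 < \<gamma> \<and> \<gamma> < 1/2 \<and> 0 < c5 \<and>
       (\<forall>(\<mu> :: real^'n \<Rightarrow> real) x0 r K q C.
       weight \<mu> \<and> (\<lambda>x. \<mu> x powr p) \<in> Ap p \<and> Ap_const p (\<lambda>x. \<mu> x powr p) = A \<and>
       0 < r \<and> closed K \<and> K \<subseteq> closure (cube x0 r) \<and> q \<in> {p0..p} \<and>
       (\<forall>u \<in> test_funs (closure (cube x0 r)) K.
             epowr (eavg (cube x0 (r/2)) (\<lambda>x. \<bar>u x / r\<bar> powr p * \<mu> x powr p)) (1/p)
             \<le> ennreal C * epowr (eavg (cube x0 r) (\<lambda>x. norm (grad u x) powr q * \<mu> x powr q)) (1/q)) \<and>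
       K \<in> negligible_sets (\<lambda>x. \<mu> x powr q) \<gamma> q x0 r \<longrightarrow>
       ennreal C \<ge> ennreal (c5 / r) *
            epowr (cap_quot (wmass (\<lambda>x. \<mu> x powr q) (cube x0 (2*r)))
                            (Cap q (\<lambda>x. \<mu> x powr q) K (cube x0 (2*r)))) (1/q)))"
proof -
  note p = assms(2)
  define N where "N = real CARD('n)"
  have N: "1 \<le> N" by (simp add: N_def)
  define B0 where "B0 = max 1 (enn2real A powr (1 / p))"
  have B0: "0 \<le> B0" by (simp add: B0_def)
  obtain p0 B' where p0: "1 < p0" "p0 < p" and np0: "CARD('n) * (p / p0 - 1) \<le> 1 / 2" and B': "0 \<le> B'"
    and open_end: "\<forall>(m :: real^'n \<Rightarrow> real) q. Apq m p p B0 \<and> m \<in> borel_measurable borel \<and> (\<forall>x. 0 < m x) \<and> q \<in> {p0..p} \<longrightarrow> Apq m p q B'"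
    using Apq_open[OF p B0, where 'n = 'n] by blast
  \<comment> \<open>At least 1, so that all constants are monotone in the exponent.\<close>
  define B where "B = max 1 B'"
  have B: "1 \<le> B" by (simp add: B_def)
  then have B_nonneg: "0 \<le> B" by simp
  \<comment> \<open>The common input of both parts: a Borel representative, the weight condition for
    \<open>q\<close>, and mass and capacity as real numbers.\<close>
  have data: "\<exists>m w \<kappa>. m \<in> borel_measurable borel \<and> (\<forall>x. 0 < m x) \<and> (AE x in lborel. \<mu> x = m x) \<and> Apq m p q B \<and> 1 < q \<and> q \<le> p \<and>
      CARD('n) * (p / q - 1) \<le> 1 / 2 \<and>
      0 < w \<and> (\<integral>\<^sup>+x\<in>cube x0 (2 * r). ennreal (m x powr q) \<partial>lborel) = ennreal w \<and> wmass (\<lambda>x. \<mu> x powr q) (cube x0 (2 * r)) = ennreal w \<and>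
      0 \<le> \<kappa> \<and> Cap q (\<lambda>x. m x powr q) K (cube x0 (2 * r)) = ennreal \<kappa> \<and> Cap q (\<lambda>x. \<mu> x powr q) K (cube x0 (2 * r)) = ennreal \<kappa>"
    if \<mu>: "weight \<mu>" "(\<lambda>x. \<mu> x powr p) \<in> Ap p" "Ap_const p (\<lambda>x. \<mu> x powr p) = A"
      and r: "0 < r" and K: "K \<subseteq> closure (cube x0 r)" and q: "q \<in> {p0..p}"
    for \<mu> :: "real^'n \<Rightarrow> real" and x0 r K q
  proof -
    obtain m where mm [measurable]: "m \<in> borel_measurable borel" and m: "\<forall>x. 0 < m x" and ae: "AE x in lborel. \<mu> x = m x"
      using weight_representative[OF \<mu>(1)] by blast
    have "Apq m p p B0"
      using Apq_of_Ap_const[OF _ p ae] \<mu> by (simp add: Ap_def B0_def)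
    then have "Apq m p q B'" using open_end mm m q by blast
    then have Apq: "Apq m p q B" by (rule Apq_mono) (simp add: B_def)
    have q1: "1 < q" "q \<le> p" using q p0 by auto
    have "p / q \<le> p / p0" using q p0 p by (intro divide_left_mono) auto
    then have "CARD('n) * (p / q - 1) \<le> CARD('n) * (p / p0 - 1)" by (intro mult_left_mono) auto
    then have np: "CARD('n) * (p / q - 1) \<le> 1 / 2" using np0 by linarith
    have Aqq: "Apq m q q B" by (rule Apq_diag[OF Apq mm q1 B_nonneg])
    have r2: "0 < 2 * r" using r by simp
    let ?W = "\<integral>\<^sup>+x\<in>cube x0 (2 * r). ennreal (m x powr q) \<partial>lborel"
    have "?W < top" using Apq_finite(1)[OF Aqq mm _ _ q1(1) r2] m q1 by simp
    then obtain w where w: "?W = ennreal w" "0 \<le> w" unfolding less_top_ennreal by blast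
    have "0 < ?W" using m by (intro nn_integral_pos r2) (auto simp: less_imp_neq[symmetric])
    then have w0: "0 < w" unfolding w(1) by simp
    have "Cap q (\<lambda>x. m x powr q) K (cube x0 (2 * r)) < top"
    proof -
      have fin: "(\<integral>\<^sup>+x\<in>cube x0 r. ennreal (m x powr q) \<partial>lborel) < top"
        using Apq_finite(1)[OF Aqq mm _ _ q1(1) r] m q1 by simp
      show ?thesis
        using m fin by (intro le_less_trans[OF Cap_le_mass[OF Aqq mm _ q1(1) B_nonneg r K]]) (auto simp: ennreal_mult_less_top)
    qed
    then obtain \<kappa> where \<kappa>: "Cap q (\<lambda>x. m x powr q) K (cube x0 (2 * r)) = ennreal \<kappa>" "0 \<le> \<kappa>"
      unfolding less_top_ennreal by blast
    show ?thesis
      unfolding wmass_representative[OF ae] Cap_representative[OF ae]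
      by (intro exI[of _ m] exI[of _ w] exI[of _ \<kappa>] conjI) (rule mm m ae Apq q1 np w0 w \<kappa>)+
  qed
  define c4 where "c4 = upper_const N p B"
  have c4: "0 < c4"
    unfolding c4_def upper_const_def using upper_consts_ge_1[OF N B, of p] p
    by (intro powr_gt_zero[THEN iffD2] less_imp_neq[symmetric] add_pos_nonneg mult_pos_pos) auto
  have eavg1: "eavg (cube x0 \<rho>) (\<lambda>x. F x * \<mu> x powr e) = (\<integral>\<^sup>+x\<in>cube x0 \<rho>. ennreal (F x * m x powr e) \<partial>lborel) / ennreal ((2 * \<rho>) powr real CARD('n))"
    if "AE x in lborel. \<mu> x = m x" "0 < \<rho>" for \<mu> m F :: "real^'n \<Rightarrow> real" and x0 \<rho> e
    using eavg_representative[OF that(1) cube_borel, where F = "\<lambda>x t. F x * t powr e"] that(2) by (simp add: emeasure_cube)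
  have part_a: "\<exists>C\<ge>0.
          (\<forall>u \<in> test_funs (closure (cube x0 r)) K.
             epowr (eavg (cube x0 r) (\<lambda>x. \<bar>u x / r\<bar> powr p * \<mu> x powr p)) (1/p)
             \<le> ennreal C * epowr (eavg (cube x0 r) (\<lambda>x. norm (grad u x) powr q * \<mu> x powr q)) (1/q)) \<and>
          ennreal C \<le> ennreal (c4 / r) *
            epowr (cap_quot (wmass (\<lambda>x. \<mu> x powr q) (cube x0 (2*r)))
                            (Cap q (\<lambda>x. \<mu> x powr q) K (cube x0 (2*r)))) (1/q)"
    if \<mu>: "weight \<mu>" "(\<lambda>x. \<mu> x powr p) \<in> Ap p" "Ap_const p (\<lambda>x. \<mu> x powr p) = A"
      and r: "0 < r" and K: "K \<subseteq> closure (cube x0 r)" and q: "q \<in> {p0..p}"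
      and nz: "Cap q (\<lambda>x. \<mu> x powr q) K (cube x0 (2*r)) \<noteq> 0"
    for \<mu> :: "real^'n \<Rightarrow> real" and x0 r K q
  proof -
    obtain m w \<kappa> where mm: "m \<in> borel_measurable borel" and m: "\<forall>x. 0 < m x" and ae: "AE x in lborel. \<mu> x = m x"
      and Apq: "Apq m p q B" and q1: "1 < q" "q \<le> p" and np: "CARD('n) * (p / q - 1) \<le> 1 / 2"
      and w: "0 < w" "(\<integral>\<^sup>+x\<in>cube x0 (2 * r). ennreal (m x powr q) \<partial>lborel) = ennreal w" "wmass (\<lambda>x. \<mu> x powr q) (cube x0 (2 * r)) = ennreal w"
      and \<kappa>: "0 \<le> \<kappa>" "Cap q (\<lambda>x. m x powr q) K (cube x0 (2 * r)) = ennreal \<kappa>" "Cap q (\<lambda>x. \<mu> x powr q) K (cube x0 (2 * r)) = ennreal \<kappa>"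
      using data[OF \<mu> r K q] by blast
    have \<kappa>0: "0 < \<kappa>" using nz \<kappa> by (auto simp: less_le)
    define C where "C = c4 / r * (w / \<kappa>) powr (1 / q)"
    have "epowr (eavg (cube x0 r) (\<lambda>x. \<bar>u x / r\<bar> powr p * \<mu> x powr p)) (1/p)
             \<le> ennreal C * epowr (eavg (cube x0 r) (\<lambda>x. norm (grad u x) powr q * \<mu> x powr q)) (1/q)"
      if u: "u \<in> test_funs (closure (cube x0 r)) K" for u
    proof -
      obtain v d where v: "smooth v" "0 < d" "\<forall>x\<in>cube x0 r. u x = v x \<and> grad u x = grad v x"
        "\<forall>k\<in>K. \<forall>w\<in>cube x0 r. infnorm (w - k) < d \<longrightarrow> v w = 0"
        by (rule test_funsE[OF u])
      have C1: "C_k (Suc 0) v" using v(1) unfolding smooth_def by blast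
      have "epowr ((\<integral>\<^sup>+x\<in>cube x0 r. ennreal (\<bar>v x / r\<bar> powr p * m x powr p) \<partial>lborel) / ennreal ((2 * r) powr real CARD('n))) (1 / p)
        \<le> ennreal C * epowr ((\<integral>\<^sup>+y\<in>cube x0 r. ennreal (norm (grad v y) powr q * m y powr q) \<partial>lborel) / ennreal ((2 * r) powr real CARD('n))) (1 / q)"
        unfolding C_def c4_def N_def
        by (rule upper_estimate[OF Apq mm _ q1 np B r C1 K v(2) _ \<kappa>(2) \<kappa>0 w(2) w(1)]) (use m v(4) in auto)
      moreover have "(\<integral>\<^sup>+x\<in>cube x0 r. ennreal (\<bar>u x / r\<bar> powr p * m x powr p) \<partial>lborel) = (\<integral>\<^sup>+x\<in>cube x0 r. ennreal (\<bar>v x / r\<bar> powr p * m x powr p) \<partial>lborel)"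
        by (intro nn_integral_cong) (use v(3) in \<open>auto simp: indicator_def\<close>)
      moreover have "(\<integral>\<^sup>+x\<in>cube x0 r. ennreal (norm (grad u x) powr q * m x powr q) \<partial>lborel) = (\<integral>\<^sup>+x\<in>cube x0 r. ennreal (norm (grad v x) powr q * m x powr q) \<partial>lborel)"
        by (intro nn_integral_cong) (use v(3) in \<open>auto simp: indicator_def\<close>)
      ultimately show ?thesis unfolding eavg1[OF ae r] by (simp only:)
    qed
    moreover have "ennreal C \<le> ennreal (c4 / r) *
            epowr (cap_quot (wmass (\<lambda>x. \<mu> x powr q) (cube x0 (2*r)))
                            (Cap q (\<lambda>x. \<mu> x powr q) K (cube x0 (2*r)))) (1/q)"
      unfolding C_def cap_quot_def w(3) \<kappa>(3) using \<kappa>0 w(1) c4 r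
      by (simp add: divide_ennreal epowr_ennreal ennreal_mult[symmetric])
    moreover have "0 \<le> C" using c4 r by (simp add: C_def)
    ultimately show ?thesis by blast
  qed
  define \<gamma> where "\<gamma> = small_const N p B"
  have \<gamma>: "0 < \<gamma>" "\<gamma> < 1 / 2" using small_const_bounds[OF N B p] by (auto simp: \<gamma>_def)
  define M where "M = 2 * doubling_const N p B * 2 powr p * 4 powr p"
  have M: "1 \<le> M"
  proof -
    have m: "1 \<le> a * b" if "1 \<le> a" "1 \<le> b" for a b :: real
      using mult_mono[of 1 a 1 b] that by simp
    show ?thesis unfolding M_def
      using p by (intro m lower_consts_ge_1(2)[OF N B]) (auto intro!: ge_one_powr_ge_zero)
  qed
  \<comment> \<open>The 2 comes from applying the lower estimate at twice the capacity.\<close>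
  define c5 where "c5 = 1 / (2 * M)"
  have c5: "0 < c5" using M by (simp add: c5_def)
  have part_b: "ennreal (c5 / r) *
            epowr (cap_quot (wmass (\<lambda>x. \<mu> x powr q) (cube x0 (2*r)))
                            (Cap q (\<lambda>x. \<mu> x powr q) K (cube x0 (2*r)))) (1/q) \<le> ennreal C"
    if \<mu>: "weight \<mu>" "(\<lambda>x. \<mu> x powr p) \<in> Ap p" "Ap_const p (\<lambda>x. \<mu> x powr p) = A"
      and r: "0 < r" and K: "closed K" "K \<subseteq> closure (cube x0 r)" and q: "q \<in> {p0..p}"
      and H: "\<forall>u \<in> test_funs (closure (cube x0 r)) K.
             epowr (eavg (cube x0 (r/2)) (\<lambda>x. \<bar>u x / r\<bar> powr p * \<mu> x powr p)) (1/p)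
             \<le> ennreal C * epowr (eavg (cube x0 r) (\<lambda>x. norm (grad u x) powr q * \<mu> x powr q)) (1/q)"
      and small: "K \<in> negligible_sets (\<lambda>x. \<mu> x powr q) \<gamma> q x0 r"
    for \<mu> :: "real^'n \<Rightarrow> real" and x0 r K q C
  proof -
    obtain m w \<kappa> where mm: "m \<in> borel_measurable borel" and m: "\<forall>x. 0 < m x" and ae: "AE x in lborel. \<mu> x = m x"
      and Apq: "Apq m p q B" and q1: "1 < q" "q \<le> p" and np: "CARD('n) * (p / q - 1) \<le> 1 / 2"
      and w: "0 < w" "(\<integral>\<^sup>+x\<in>cube x0 (2 * r). ennreal (m x powr q) \<partial>lborel) = ennreal w" "wmass (\<lambda>x. \<mu> x powr q) (cube x0 (2 * r)) = ennreal w"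
      and \<kappa>: "0 \<le> \<kappa>" "Cap q (\<lambda>x. m x powr q) K (cube x0 (2 * r)) = ennreal \<kappa>" "Cap q (\<lambda>x. \<mu> x powr q) K (cube x0 (2 * r)) = ennreal \<kappa>"
      using data[OF \<mu> r K(2) q] by blast
    have Aqq: "Apq m q q B" by (rule Apq_diag[OF Apq mm q1 B_nonneg])
    \<comment> \<open>\<open>C\<close> is an arbitrary real number, and \<open>ennreal\<close>
      truncates negative ones to 0.\<close>
    define C' where "C' = max 0 C"
    have C': "0 \<le> C'" "ennreal C' = ennreal C" by (auto simp: C'_def max_def ennreal_neg)
    have bdd: "bounded (closure (cube x0 r))" unfolding cube_eq_box by (intro bounded_closure bounded_box)
    then have cK: "compact K" using K by (simp add: compact_eq_bounded_closed bounded_subset)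
    \<comment> \<open>The energy level \<open>E\<close> is free above the capacity: small
      \<open>E\<close> will exclude capacity 0, and \<open>E = 2 * \<kappa>\<close> will give the
      bound.\<close>
    have est: "r powr - q * (w / E) / M \<le> C' powr q"
      if E: "\<kappa> < E" "E \<le> 2 * \<gamma> * r powr - q * w" for E
    proof -
      have E0: "0 < E" using E(1) \<kappa>(1) by simp
      have "Cap q (\<lambda>x. m x powr q) K (cube x0 (2 * r)) < ennreal E"
        unfolding \<kappa>(2) using E(1) \<kappa>(1) by (simp add: ennreal_less_iff)
      then obtain f d where f: "smooth f" "0 < d" "\<forall>k\<in>K. \<forall>x. infnorm (x - k) < d \<longrightarrow> f x = 1"
        "\<forall>x. x \<notin> cube x0 (2 * r) \<longrightarrow> f x = 0 \<and> grad f x = 0"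
        "(\<integral>\<^sup>+x\<in>cube x0 (2 * r). ennreal (norm (grad f x) powr q * m x powr q) \<partial>lborel) \<le> ennreal (4 powr q * E)"
        by (rule near_extremal[OF mm q1(1) w(2) less_imp_le[OF w(1)] cK])
      have C1: "C_k (Suc 0) f" using f(1) unfolding smooth_def by blast
      define u where "u x = (- 1) * f x + 1" for x
      have su: "smooth u" using f(1) unfolding smooth_def u_def by (blast intro: C_k_affine)
      have gu: "grad u x = (- 1) *\<^sub>R grad f x" for x
      proof (rule grad_eqI)
        have "f differentiable (at x)" using C1 unfolding C_k.simps by blast
        from has_derivative_grad[OF this] show "(u has_derivative (\<lambda>h. h \<bullet> ((- 1) *\<^sub>R grad f x))) (at x)"
          unfolding u_def by (auto intro!: derivative_eq_intros)
      qed
      have "ennreal d \<le> esetdist (supp_in (closure (cube x0 r)) u) K"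
        unfolding esetdist_def
      proof (intro INF_greatest ennreal_leI)
        fix x k assume x: "x \<in> supp_in (closure (cube x0 r)) u" and k: "k \<in> K"
        have "closed {x. d \<le> infnorm (x - k)}" by (intro closed_Collect_le continuous_intros)
        moreover have "{x \<in> closure (cube x0 r). u x \<noteq> 0} \<subseteq> {x. d \<le> infnorm (x - k)}"
          using f(3) k by (auto simp: u_def not_less[symmetric])
        ultimately have "d \<le> infnorm (x - k)" using x closure_minimal unfolding supp_in_def by blast
        also have "\<dots> \<le> dist x k" unfolding dist_norm by (rule infnorm_le_norm)
        finally show "d \<le> dist x k" .
      qed
      moreover have "0 < ennreal d" using f(2) by simp
      ultimately have "0 < esetdist (supp_in (closure (cube x0 r)) u) K" by (rule less_le_trans[rotated])
      then have "u \<in> test_funs (closure (cube x0 r)) K"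
        using su by (auto simp: test_funs_def Cinf_closed_def)
      with H have "epowr (eavg (cube x0 (r/2)) (\<lambda>x. \<bar>u x / r\<bar> powr p * \<mu> x powr p)) (1/p)
             \<le> ennreal C' * epowr (eavg (cube x0 r) (\<lambda>x. norm (grad u x) powr q * \<mu> x powr q)) (1/q)"
        unfolding C'(2) by blast
      moreover have "0 < r / 2" using r by simp
      ultimately have "epowr ((\<integral>\<^sup>+x\<in>cube x0 (r / 2). ennreal (\<bar>(1 - f x) / r\<bar> powr p * m x powr p) \<partial>lborel) / ennreal (r powr real CARD('n))) (1 / p)
        \<le> ennreal C' * epowr ((\<integral>\<^sup>+x\<in>cube x0 r. ennreal (norm (grad f x) powr q * m x powr q) \<partial>lborel) / ennreal ((2 * r) powr real CARD('n))) (1 / q)"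
        unfolding eavg1[OF ae r] by (subst (asm) eavg1[OF ae]) (simp_all add: u_def gu)
      then show ?thesis
        unfolding M_def N_def
        by (intro lower_estimate[OF Aqq mm _ q1 B r C1 f(4) w(2) _ f(5) E0 _ C'(1)])
          (use m w E(2) in \<open>auto simp: \<gamma>_def N_def\<close>)
    qed
    have \<kappa>_le: "\<kappa> \<le> \<gamma> * r powr - q * w"
    proof -
      have "ennreal \<kappa> / ennreal w \<le> ennreal (\<gamma> * r powr - q)"
        using small by (simp add: negligible_sets_def \<kappa>(3) w(3))
      then have "\<kappa> / w \<le> \<gamma> * r powr - q" using w(1) \<kappa>(1) \<gamma> by (simp add: divide_ennreal)
      then show ?thesis using w(1) by (simp add: field_simps)
    qed
    have \<gamma>w: "0 < \<gamma> * r powr - q * w" using \<gamma> r w by simp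
    \<comment> \<open>With capacity 0 every small \<open>E\<close> would be allowed; the
      \<open>E\<close> below is so small that \<open>est\<close> forces \<open>C' powr q + 1\<close>
      to be at most \<open>C' powr q\<close>. So the infinite value of the quotient does not occur
      under the assumed inequality.\<close>
    have \<kappa>0: "0 < \<kappa>"
    proof (rule ccontr)
      assume "\<not> 0 < \<kappa>"
      then have \<kappa>z: "\<kappa> = 0" using \<kappa>(1) by simp
      define E where "E = min (2 * \<gamma> * r powr - q * w) (r powr - q * w / (M * (C' powr q + 1)))"
      have Cq: "0 < C' powr q + 1" by (rule add_nonneg_pos) auto
      have E: "0 < E" unfolding E_def min_less_iff_conj using \<gamma> r w M Cq
        by (intro conjI mult_pos_pos divide_pos_pos) auto
      have "E \<le> r powr - q * w / (M * (C' powr q + 1))" by (simp add: E_def)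
      moreover have "0 < M * (C' powr q + 1)" "0 < M" using M Cq by auto
      ultimately have "C' powr q + 1 \<le> r powr - q * (w / E) / M"
        using E by (simp only: times_divide_eq_right times_divide_eq_left pos_le_divide_eq mult_ac)
      also have "\<dots> \<le> C' powr q" using E \<kappa>z by (intro est) (auto simp: E_def)
      finally show False by simp
    qed
    have "r powr - q * (w / (2 * \<kappa>)) / M \<le> C' powr q"
      using \<kappa>0 \<kappa>_le by (intro est) auto
    then have "(r powr - q * (w / (2 * \<kappa>)) / M) powr (1 / q) \<le> (C' powr q) powr (1 / q)"
      using r w \<kappa>0 M q1 by (intro powr_mono2) auto
    also have "\<dots> = C'" using q1 C' by (simp add: powr_powr)
    also have "r powr - q * (w / (2 * \<kappa>)) / M = c5 * (r powr - q * (w / \<kappa>))" by (simp add: c5_def)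
    also have "(c5 * (r powr - q * (w / \<kappa>))) powr (1 / q) = c5 powr (1 / q) * (1 / r * (w / \<kappa>) powr (1 / q))"
    proof -
      have "(r powr - q) powr (1 / q) = 1 / r"
        using r q1 powr_minus_divide[of r 1] by (simp add: powr_powr)
      then show ?thesis by (simp only: powr_mult)
    qed
    finally have le: "c5 powr (1 / q) * (1 / r * (w / \<kappa>) powr (1 / q)) \<le> C'" .
    \<comment> \<open>Since \<open>c5\<close> is at most 1, its \<open>q\<close>-th root is at least
      \<open>c5\<close>, which frees the final constant from \<open>q\<close>.\<close>
    have "c5 powr 1 \<le> c5 powr (1 / q)"
      using M q1 by (intro powr_mono') (auto simp: c5_def)
    then have "c5 * (1 / r * (w / \<kappa>) powr (1 / q)) \<le> c5 powr (1 / q) * (1 / r * (w / \<kappa>) powr (1 / q))"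
      using c5 r by (intro mult_right_mono) auto
    then have "c5 / r * (w / \<kappa>) powr (1 / q) \<le> C'" using le by simp
    then have "ennreal (c5 / r * (w / \<kappa>) powr (1 / q)) \<le> ennreal C" unfolding C'(2)[symmetric] by (rule ennreal_leI)
    then show ?thesis
      unfolding cap_quot_def w(3) \<kappa>(3) using \<kappa>0 w(1) c5 r
      by (simp add: divide_ennreal epowr_ennreal ennreal_mult[symmetric])
  qed
  show ?thesis
  proof (rule exI[of _ p0], intro conjI p0, goal_cases)
    case 1
    show ?case
      by (rule exI[of _ c4], intro conjI c4 allI impI, elim conjE, rule part_a)
  next
    case 2
    show ?case
      by (rule exI[of _ \<gamma>], rule exI[of _ c5], intro conjI \<gamma> c5 allI impI, elim conjE, rule part_b)
  qed
qed

end
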